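(* Let $I=(-1,1)$ and, for $\lambda>0$, let $g_\lambda:\mathbb{R}\to\mathbb{S}^1$ be given by $g_\lambda(x)=\Pi_+^{-1}\left(\frac{x}{\lambda}\right)$, where $\Pi_+:\mathbb{S}^1\setminus\{i\}\to\mathbb{R}$, $\Pi_+(x+iy)=\frac{x}{1-y}$. Then: (i) for every $\lambda>0$, $u_0=g_\lambda$ is the only minimizer of $E$ in $\mathcal{E}_{g_\lambda,1}$; (ii) there exists $\lambda^*>1$ such that for $\lambda\ge\lambda^*$, $u_0=g_\lambda$ is the only minimizer of $E$ in $\mathcal{E}_{g_\lambda}$; (iii) for every $\lambda>0$, $E$ has a minimizer $u^*$ in $\mathcal{E}_{g_\lambda,0}$, and there exists $\lambda_0>1$ such that for $\lambda\in(0,\lambda_0)$, $u^*$ is an absolute minimizer, i.e. it minimizes $E$ in $\mathcal{E}_{g_\lambda}$, while $g_\lambda$ does not minimize $E$ in $\mathcal{E}_{g_\lambda}$; (iv) for every $\lambda>0$, $E$ has no minimizer in $\mathcal{E}_{g_\lambda,k}$ for $k>1$ ($k\in\mathbb{Z}$).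
   Context: Identify $\mathbb{C}\simeq\mathbb{R}^2$; $\mathbb{S}^1\subset\mathbb{C}$ is the unit circle. $\dot H^{\frac12,2}(\mathbb{R},\mathbb{C})$ is the space of measurable $u:\mathbb{R}\to\mathbb{C}$ with $[u]^2_{H^{\frac12,2}(\mathbb{R})}:=\int_{\mathbb{R}}\int_{\mathbb{R}}\frac{|u(x)-u(\xi)|^2}{(x-\xi)^2}\,dx\,d\xi<\infty$, and $\dot H^{\frac12,2}(\mathbb{R},\mathbb{S}^1)$ is the subset of those $u$ with $|u(x)|=1$ for a.e. $x$. Functions are identified when equal a.e. The energy is $E(u):=\int_{\mathbb{R}}|(-\Delta)^{\frac14}u|^2dx=\frac{1}{2\pi}[u]^2_{H^{\frac12,2}(\mathbb{R})}=\int_{\mathbb{R}^2_+}|\nabla\tilde u|^2\,dx\,dy$, where $\tilde u$ is the Poisson harmonic extension of $u$ to $\mathbb{R}^2_+=\mathbb{R}\times(0,\infty)$. Degree: for $f(e^{i\theta})=\frac{1}{\sqrt{2\pi}}\sum_{k\in\mathbb{Z}}a_ke^{ik\theta}$ in $H^{\frac12,2}(\mathbb{S}^1,\mathbb{S}^1)$ (maps $f\in L^2(\mathbb{S}^1,\mathbb{C})$ with $|f|=1$ a.e. and $\sum_k|k||a_k|^2<\infty$), $\deg(f):=\frac{1}{2\pi}\sum_{k\in\mathbb{Z}}k|a_k|^2$, which is an integer and coincides with the Brouwer degree when $f$ is continuous. For $u\in\dot H^{\frac12,2}(\mathbb{R},\mathbb{S}^1)$, $\deg(u):=\deg(u\circ\Pi_+)$.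 For $g\in\dot H^{\frac12,2}(\mathbb{R},\mathbb{S}^1)$ and $k\in\mathbb{Z}$: $\mathcal{E}_g=\{u\in\dot H^{\frac12,2}(\mathbb{R},\mathbb{S}^1):u=g\text{ in }\mathbb{R}\setminus I\}$ and $\mathcal{E}_{g,k}=\{u\in\mathcal{E}_g:\deg(u)=k\}$. *)

theory Defs
  imports "HOL-Analysis.Analysis"
begin

text \<open>
  Equality of functions is almost-everywhere equality for Lebesgue measure; elements of the
  function spaces are represented by arbitrary Lebesgue measurable representatives.
\<close>

definition seminorm_sq :: "(real \<Rightarrow> complex) \<Rightarrow> ennreal" where
  "seminorm_sq u =
     (\<integral>\<^sup>+ x. \<integral>\<^sup>+ \<xi>. ennreal ((cmod (u x - u \<xi>))\<^sup>2 / (x - \<xi>)\<^sup>2) \<partial>lebesgue \<partial>lebesgue)"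

definition Hdot :: "(real \<Rightarrow> complex) set" where
  "Hdot = {u. u \<in> borel_measurable lebesgue \<and> seminorm_sq u < \<infinity>}"

definition Hdot_S1 :: "(real \<Rightarrow> complex) set" where
  "Hdot_S1 = {u \<in> Hdot. AE x in lebesgue. cmod (u x) = 1}"

text \<open>
  The half-Dirichlet energy, i.e. the squared \<open>L\<^sup>2\<close> norm of \<open>(-\<Delta>)\<^bsup>1/4\<^esup> u\<close>, through its
  Gagliardo double integral.
\<close>

definition energy :: "(real \<Rightarrow> complex) \<Rightarrow> ennreal" where
  "energy u = ennreal (1 / (2 * pi)) * seminorm_sq u"

text \<open>Meaningful off the pole \<open>\<i>\<close>; the value at the pole is irrelevant (a null set).\<close>

definition Pi_plus :: "complex \<Rightarrow> real" where
  "Pi_plus z = Re z / (1 - Im z)"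

definition Pi_plus_inv :: "real \<Rightarrow> complex" where
  "Pi_plus_inv = the_inv_into (sphere 0 1 - {\<i>}) Pi_plus"

definition g_map :: "real \<Rightarrow> real \<Rightarrow> complex" where
  "g_map lam x = Pi_plus_inv (x / lam)"

text \<open>
  Normalised so that \<open>f (cis \<theta>) = (1 / sqrt (2 * pi)) * (\<Sum>k. a k * cis (k * \<theta>))\<close> in \<open>L\<^sup>2\<close>.
\<close>

definition fourier_coeff :: "(complex \<Rightarrow> complex) \<Rightarrow> int \<Rightarrow> complex" where
  "fourier_coeff f k = of_real (1 / sqrt (2 * pi)) *
     (LINT \<theta>:{0..2 * pi}|lebesgue. f (cis \<theta>) * cis (- (of_int k * \<theta>)))"

text \<open>
  The sum converges absolutely for \<open>f\<close> in \<open>H\<^bsup>1/2,2\<^esup>\<close> of the circle; by conformal invariance of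
  the seminorm this covers \<open>u \<circ> Pi_plus\<close> for every \<open>u\<close> in \<open>Hdot_S1\<close>.
\<close>

definition degree_circle :: "(complex \<Rightarrow> complex) \<Rightarrow> real" where
  "degree_circle f =
     1 / (2 * pi) * (\<Sum>\<^sub>\<infinity>k\<in>(UNIV :: int set). of_int k * (cmod (fourier_coeff f k))\<^sup>2)"

definition degree_line :: "(real \<Rightarrow> complex) \<Rightarrow> real" where
  "degree_line u = degree_circle (u \<circ> Pi_plus)"

definition adm :: "real set \<Rightarrow> (real \<Rightarrow> complex) \<Rightarrow> (real \<Rightarrow> complex) set" where
  "adm I g = {u \<in> Hdot_S1. AE x in lebesgue. x \<notin> I \<longrightarrow> u x = g x}"

definition adm_deg ::
  "real set \<Rightarrow> (real \<Rightarrow> complex) \<Rightarrow> int \<Rightarrow> (real \<Rightarrow> complex) set" where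
  "adm_deg I g k = {u \<in> adm I g. degree_line u = of_int k}"

definition minimizes :: "(real \<Rightarrow> complex) \<Rightarrow> (real \<Rightarrow> complex) set \<Rightarrow> bool" where
  "minimizes u A \<longleftrightarrow> u \<in> A \<and> (\<forall>v\<in>A. energy u \<le> energy v)"

definition unique_minimizer :: "(real \<Rightarrow> complex) \<Rightarrow> (real \<Rightarrow> complex) set \<Rightarrow> bool" where
  "unique_minimizer u A \<longleftrightarrow>
     minimizes u A \<and> (\<forall>v. minimizes v A \<longrightarrow> (AE x in lebesgue. v x = u x))"

lemma bij_betw_Pi_plus: "bij_betw Pi_plus (sphere 0 1 - {\<i>}) UNIV"
  and Pi_plus_inv_eq: "Pi_plus_inv t = Complex (2 * t / (t\<^sup>2 + 1)) ((t\<^sup>2 - 1) / (t\<^sup>2 + 1))"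
proof -
  define h where "h t = Complex (2 * t / (t\<^sup>2 + 1)) ((t\<^sup>2 - 1) / (t\<^sup>2 + 1))" for t :: real
  have pos: "t\<^sup>2 + 1 > 0" for t :: real
    by (smt (verit) zero_le_power2)
  have Ph: "Pi_plus (h t) = t" for t
  proof -
    have "1 - (t\<^sup>2 - 1) / (t\<^sup>2 + 1) = 2 / (t\<^sup>2 + 1)"
      using pos[of t] by (simp add: field_simps)
    then show ?thesis
      using pos[of t] by (simp add: Pi_plus_def h_def)
  qed
  have hS: "h t \<in> sphere 0 1 - {\<i>}" for t
  proof -
    have "(2 * t)\<^sup>2 + (t\<^sup>2 - 1)\<^sup>2 = (t\<^sup>2 + 1)\<^sup>2"
      by algebra
    then have "(2 * t / (t\<^sup>2 + 1))\<^sup>2 + ((t\<^sup>2 - 1) / (t\<^sup>2 + 1))\<^sup>2 = 1"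
      using pos[of t] by (simp add: power_divide flip: add_divide_distrib)
    moreover have "(t\<^sup>2 - 1) / (t\<^sup>2 + 1) \<noteq> 1"
      using pos[of t] by (simp add: field_simps)
    ultimately show ?thesis
      by (simp add: h_def cmod_def complex_eq_iff)
  qed
  have hP: "h (Pi_plus z) = z" if z: "z \<in> sphere 0 1 - {\<i>}" for z
  proof -
    have n: "(Re z)\<^sup>2 + (Im z)\<^sup>2 = 1"
      using z by (simp add: cmod_def)
    have ne: "1 - Im z \<noteq> 0"
      using z n by (auto simp: complex_eq_iff)
    have s: "(Pi_plus z)\<^sup>2 = (1 + Im z) / (1 - Im z)"
    proof -
      have "(Re z)\<^sup>2 = (1 + Im z) * (1 - Im z)"
        using n by algebra
      then show ?thesis
        using ne by (simp add: Pi_plus_def power_divide power2_eq_square)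
    qed
    have s1: "(Pi_plus z)\<^sup>2 + 1 = 2 / (1 - Im z)" and s2: "(Pi_plus z)\<^sup>2 - 1 = 2 * Im z / (1 - Im z)"
      using ne by (simp_all add: s field_simps)
    show ?thesis
      unfolding h_def s1 s2 using ne by (simp add: complex_eq_iff Pi_plus_def)
  qed
  show bij: "bij_betw Pi_plus (sphere 0 1 - {\<i>}) UNIV"
    by (rule bij_betwI[where g = h]) (use Ph hP hS in auto)
  then show "Pi_plus_inv t = Complex (2 * t / (t\<^sup>2 + 1)) ((t\<^sup>2 - 1) / (t\<^sup>2 + 1))"
    unfolding Pi_plus_inv_def bij_betw_def
    using the_inv_into_f_eq[of Pi_plus "sphere 0 1 - {\<i>}" "h t" t] Ph hS
    by (simp add: h_def)
qed

end

theory Submission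
  imports Defs "HOL-Complex_Analysis.Complex_Analysis" "HOL-Real_Asymp.Real_Asymp"
begin

text \<open>
  Through the stereographic projection a map \<open>u\<close> from the line to the unit circle becomes a map of the
  circle, with Fourier coefficients \<open>a\<^sub>k\<close>. By conformal invariance the energy is \<open>\<Sum> \<bar>k\<bar> * \<bar>a\<^sub>k\<bar>\<^sup>2\<close>
  (\<open>energy_fourier\<close>), while \<open>2 \<pi>\<close> times the degree is \<open>\<Sum> k * \<bar>a\<^sub>k\<bar>\<^sup>2\<close>. Hence the energy is at least
  \<open>2 \<pi>\<close> times the absolute value of the degree, and a map with \<open>E(u) = 2 \<pi> deg u\<close> has no negative
  frequencies (\<open>coef_neg_zero\<close>). The datum \<open>g\<^sub>\<lambda>\<close> is a Blaschke factor times \<open>\<i>\<close>; it has degree one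
  and energy \<open>2 \<pi>\<close>.

  Degree one. A competitor with energy \<open>2 \<pi>\<close> has no negative frequencies either. Its difference to the
  datum lies in the Hardy space and vanishes off the interval, so it is zero (\<open>hardy_vanishing\<close>,
  \<open>rigidity\<close>).

  Higher degrees. Multiplication by a Blaschke factor concentrated at a small scale, tapered so that it is
  1 off the interval, raises the degree by one at a cost arbitrarily close to \<open>2 \<pi>\<close>
  (\<open>bubble_competitor\<close>). So the infimum in degree \<open>k > 1\<close> is \<open>2 \<pi> k\<close>, and a map attaining it would be the
  datum by rigidity.

  Large scales. After rescaling, the datum is the first character \<open>e\<close> and a competitor is \<open>e + w\<close>
  with \<open>w\<close> supported in \<open>(-1/\<lambda>, 1/\<lambda>)\<close>. Because both \<open>e\<close> and \<open>e + w\<close> are unimodular,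
  \<open>E(e + w) = 2 \<pi> + E(w) - \<integral> \<bar>w\<bar>\<^sup>2\<close> (\<open>energy_expansion\<close>), and a Poincare inequality on the short interval
  makes \<open>E(w) - \<integral> \<bar>w\<bar>\<^sup>2\<close> positive for \<open>w \<noteq> 0\<close>, whatever the degree is.

  Degree zero. A limit of a minimizing sequence may change its degree only at the price of \<open>2 \<pi>\<close> per unit,
  and a map of nonzero degree itself has energy at least \<open>2 \<pi>\<close>; so an infimum below \<open>4 \<pi>\<close> is attained
  (\<open>degree_zero_limit\<close>, \<open>degree_zero_minimizer\<close>). The map that equals \<open>g\<^sub>\<lambda>(1/x)\<close> in the interval is
  symmetric under \<open>x \<mapsto> 1/x\<close> and has degree zero. Its energy is below \<open>4 \<pi>\<close> for all \<open>\<lambda>\<close>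
  (\<open>fold_bound_lt_8\<close>), and below \<open>2 \<pi>\<close> for all \<open>\<lambda>\<close> up to some value above one (\<open>fold_bound_lt_4\<close>); in the
  second case no map of nonzero degree can compete.

  Several of these steps need that the degree, defined by a series, is an integer (\<open>deg_integer\<close>). Maps of
  finite energy need not be continuous, but their Fejer means have modulus bounded away from zero and
  winding numbers that approach the degree.
\<close>

section \<open>Stereographic coordinates\<close>

text \<open>
  The polar angle, between \<open>- 3 \<pi> / 2\<close> and \<open>\<pi> / 2\<close>, of the point of the circle that
  the stereographic projection from \<open>\<i>\<close> sends to \<open>x\<close>.
\<close>

definition angle :: "real \<Rightarrow> real" where "angle x = 2 * arctan x - pi / 2"

text \<open>
  The \<open>k\<close>-th character of the circle in the stereographic coordinate.
\<close>

definition chr :: "int \<Rightarrow> real \<Rightarrow> complex" where "chr k x = cis (of_int k * angle x)"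

text \<open>
  Arc length of the circle in the stereographic coordinate.
\<close>

definition circ :: "real measure" where "circ = density lborel (\<lambda>x. ennreal (2 / (1 + x\<^sup>2)))"

definition coef :: "(real \<Rightarrow> complex) \<Rightarrow> int \<Rightarrow> complex" where
  "coef u k = of_real (1 / sqrt (2 * pi)) * (\<integral>x. u x * chr (- k) x \<partial>circ)"

lemma one_plus_sq_pos [simp]: "1 + (x::real)\<^sup>2 > 0" "1 + (x::real)\<^sup>2 \<noteq> 0"
  by (smt (verit) zero_le_power2)+

lemma cmod_chr [simp]: "cmod (chr k x) = 1"
  by (simp add: chr_def)

lemma chr_0 [simp]: "chr 0 x = 1"
  by (simp add: chr_def)

lemma chr_add: "chr (k + l) x = chr k x * chr l x"
  by (simp add: chr_def cis_mult distrib_right)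

lemma cnj_chr [simp]: "cnj (chr k x) = chr (- k) x"
  by (simp add: chr_def cis_cnj)

lemma chr_measurable [measurable]: "chr k \<in> borel_measurable borel"
proof -
  have "continuous_on UNIV (chr k)"
    unfolding chr_def angle_def by (intro continuous_intros)
  then show ?thesis by (rule borel_measurable_continuous_onI)
qed

lemma chr_1: "chr 1 x = \<i> * (of_real x - \<i>) / (of_real x + \<i>)"
proof -
  have s: "sqrt (1 + x\<^sup>2) * sqrt (1 + x\<^sup>2) = 1 + x\<^sup>2" by simp
  have c: "cis (arctan x) = Complex (1 / sqrt (1 + x\<^sup>2)) (x / sqrt (1 + x\<^sup>2))"
    by (simp add: complex_eq_iff cos_arctan sin_arctan)
  have "cis (angle x) = cis (arctan x) * cis (arctan x) * cis (- (pi / 2))"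
    unfolding angle_def cis_mult by (simp add: algebra_simps)
  also have "\<dots> = Complex (2 * x / (1 + x\<^sup>2)) ((x\<^sup>2 - 1) / (1 + x\<^sup>2))"
    unfolding c using s by (simp add: complex_eq_iff diff_divide_distrib power2_eq_square)
  also have "\<dots> = \<i> * (of_real x - \<i>) / (of_real x + \<i>)"
  proof -
    have "Complex (2 * x / (1 + x\<^sup>2)) ((x\<^sup>2 - 1) / (1 + x\<^sup>2)) * (of_real x + \<i>) = \<i> * (of_real x - \<i>)"
      by (simp add: complex_eq_iff divide_simps) (simp add: power2_eq_square algebra_simps)
    moreover have "of_real x + \<i> \<noteq> 0" by (simp add: complex_eq_iff)
    ultimately show ?thesis by (simp add: divide_simps)
  qed
  finally show ?thesis by (simp add: chr_def)
qed

lemma chr_1_Pi_plus_inv: "chr 1 x = Pi_plus_inv x"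
proof -
  have "Pi_plus_inv x * (of_real x + \<i>) = \<i> * (of_real x - \<i>)"
    unfolding Pi_plus_inv_eq
    by (simp add: complex_eq_iff divide_simps add.commute) (simp add: power2_eq_square algebra_simps)
  moreover have "of_real x + \<i> \<noteq> 0" by (simp add: complex_eq_iff)
  ultimately show ?thesis unfolding chr_1 by (simp add: divide_simps)
qed

lemma cmod_real_plus_ii: "(cmod (of_real x + \<i> * of_real a))\<^sup>2 = x\<^sup>2 + a\<^sup>2"
  by (simp add: cmod_power2)

text \<open>
  The conformal invariance behind everything that follows: the kernel \<open>dx dy / (x - y)\<^sup>2\<close> of the line
  is the kernel \<open>ds dt / \<bar>p - q\<bar>\<^sup>2\<close> of the circle, with chordal distance and arc length, because
  stereographic projection distorts chords and arcs by the same conformal factor.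
\<close>

lemma chr_1_diff: "(cmod (chr 1 x - chr 1 y))\<^sup>2 = 4 * (x - y)\<^sup>2 / ((1 + x\<^sup>2) * (1 + y\<^sup>2))"
proof -
  have nz: "of_real x + \<i> \<noteq> 0" "of_real y + \<i> \<noteq> 0" by (simp_all add: complex_eq_iff)
  have "chr 1 x - chr 1 y = - 2 * of_real (x - y) / ((of_real x + \<i>) * (of_real y + \<i>))"
    unfolding chr_1 using nz by (simp add: field_simps)
  moreover have "(cmod (of_real x + \<i>))\<^sup>2 = 1 + x\<^sup>2" for x by (simp add: cmod_power2)
  ultimately show ?thesis
    by (simp add: norm_divide norm_mult power_divide power_mult_distrib flip: of_real_diff)
qed

lemma emeasure_circ_greaterThan: "emeasure circ {a<..} = ennreal (pi - 2 * arctan a)"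
proof -
  have "emeasure circ {a<..} = (\<integral>\<^sup>+x. ennreal (2 / (1 + x\<^sup>2)) * indicator {a<..} x \<partial>lborel)"
    by (simp add: circ_def emeasure_density)
  also have "\<dots> = (\<integral>\<^sup>+x. ennreal (2 / (1 + x\<^sup>2)) * indicator {a..} x \<partial>lborel)"
    by (intro nn_integral_cong_AE) (use AE_lborel_singleton[of a] in eventually_elim, auto simp: indicator_def)
  also have "\<dots> = ennreal (pi - 2 * arctan a)"
  proof (rule nn_integral_FTC_atLeast)
    show "((\<lambda>x. 2 * arctan x) has_real_derivative 2 / (1 + x\<^sup>2)) (at x)" for x :: real
      by (auto intro!: derivative_eq_intros simp: inverse_eq_divide)
    show "((\<lambda>x. 2 * arctan x) \<longlongrightarrow> pi) at_top"
      using tendsto_mult_left[OF tendsto_arctan_at_top, of 2] by simp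
    show "0 \<le> 2 / (1 + x\<^sup>2)" for x :: real
      using one_plus_sq_pos(1)[of x] by (simp add: less_imp_le)
  qed auto
  finally show ?thesis .
qed

lemma emeasure_circ_UNIV: "emeasure circ UNIV = ennreal (2 * pi)"
proof -
  have "(\<lambda>n::nat. emeasure circ {- real n<..}) \<longlonglongrightarrow> emeasure circ (\<Union>n. {- real n<..})"
    by (rule Lim_emeasure_incseq) (auto simp: circ_def incseq_def)
  moreover have "(\<Union>n::nat. {- real n<..}) = UNIV"
    by (auto, metis minus_less_iff reals_Archimedean2)
  moreover have "(\<lambda>n::nat. ennreal (pi - 2 * arctan (- real n))) \<longlonglongrightarrow> ennreal (pi - 2 * (- (pi / 2)))"
    by (intro tendsto_intros tendsto_ennrealI filterlim_compose[OF tendsto_arctan_at_bot]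
          filterlim_compose[OF filterlim_uminus_at_bot_at_top] filterlim_real_sequentially)
  ultimately show ?thesis
    by (auto simp: emeasure_circ_greaterThan intro: LIMSEQ_unique)
qed

lemma sets_circ [measurable_cong, simp]: "sets circ = sets borel"
  and space_circ [simp]: "space circ = UNIV"
  by (simp_all add: circ_def)

interpretation circ: finite_measure circ
  by (rule finite_measureI) (simp add: emeasure_circ_UNIV)

lemma measure_circ_UNIV [simp]: "measure circ UNIV = 2 * pi"
  by (simp add: measure_def emeasure_circ_UNIV)

lemma AE_circ: "(AE x in circ. P x) \<longleftrightarrow> (AE x in lborel. P x)"
proof -
  have "0 < 2 / (1 + x\<^sup>2)" for x :: real by simp
  then show ?thesis unfolding circ_def
    by (subst AE_density) (auto simp: ennreal_eq_0_iff)
qed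

abbreviation angle_measure :: "real measure" where
  "angle_measure \<equiv> density lborel (\<lambda>\<theta>. ennreal (indicator {0..2 * pi} \<theta>))"

lemma cis_cong_mult: assumes "cis a = cis b" shows "cis (of_int k * a) = cis (of_int k * b)"
  using assms by (metis cis_power_int)

lemma Pi_plus_inv_Pi_plus: assumes "cmod z = 1" "z \<noteq> \<i>" shows "Pi_plus_inv (Pi_plus z) = z"
  unfolding Pi_plus_inv_def using bij_betw_Pi_plus assms
  by (intro the_inv_into_f_f) (auto simp: bij_betw_def)

lemma Pi_plus_tan:
  assumes "cos \<phi> \<noteq> 0" shows "Pi_plus (cis (2 * \<phi> - pi / 2)) = tan \<phi>"
proof -
  have 1: "cos (2 * \<phi> - pi / 2) = 2 * sin \<phi> * cos \<phi>"
    by (simp add: cos_diff sin_double)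
  have 2: "1 - sin (2 * \<phi> - pi / 2) = 2 * cos \<phi> * cos \<phi>"
    by (simp add: sin_diff cos_double_cos power2_eq_square)
  show ?thesis unfolding Pi_plus_def using assms by (simp add: 1 2 tan_def)
qed

lemma Pi_plus_chr_1 [simp]: "Pi_plus (chr 1 x) = x"
  using Pi_plus_tan[of "arctan x"] cos_arctan_not_zero[of x]
  by (simp add: chr_def angle_def tan_arctan)

lemma Pi_plus_cis_measurable [measurable]: "(\<lambda>\<theta>. Pi_plus (cis \<theta>)) \<in> borel_measurable borel"
proof -
  have [measurable]: "(cos :: real \<Rightarrow> real) \<in> borel_measurable borel" "(sin :: real \<Rightarrow> real) \<in> borel_measurable borel"
    by (auto intro!: borel_measurable_continuous_onI continuous_intros)
  show ?thesis unfolding Pi_plus_def by simp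
qed

lemma Pi_plus_cis_less_iff:
  assumes "0 \<le> \<theta>" "\<theta> \<le> 2 * pi" "\<theta> \<noteq> pi / 2"
  shows "a < Pi_plus (cis \<theta>) \<longleftrightarrow> (if \<theta> < pi / 2 then angle a < \<theta> else angle a + 2 * pi < \<theta>)"
proof -
  define \<phi> where "\<phi> = (if \<theta> < pi / 2 then \<theta> / 2 + pi / 4 else \<theta> / 2 + pi / 4 - pi)"
  have \<phi>: "- pi / 2 < \<phi>" "\<phi> < pi / 2"
    using assms by (auto simp: \<phi>_def field_simps split: if_splits)
  have "cis \<theta> = cis (2 * \<phi> - pi / 2)"
  proof (cases "\<theta> < pi / 2")
    case False
    then have "2 * \<phi> - pi / 2 = \<theta> - 2 * pi" by (simp add: \<phi>_def field_simps)
    then show ?thesis by (simp add: complex_eq_iff cos_diff sin_diff)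
  qed (simp add: \<phi>_def field_simps)
  moreover have "cos \<phi> \<noteq> 0" using cos_gt_zero_pi[of \<phi>] \<phi> by auto
  ultimately have "Pi_plus (cis \<theta>) = tan \<phi>" using Pi_plus_tan by simp
  then have "a < Pi_plus (cis \<theta>) \<longleftrightarrow> arctan a < \<phi>"
    using arctan_less_iff[of a "tan \<phi>"] arctan_tan[of \<phi>] \<phi> by simp
  then show ?thesis by (auto simp: \<phi>_def angle_def field_simps)
qed

text \<open>
  A finite measure is determined by its values on half-lines. The preimage of a half-line is an arc
  ending at the pole, whose angle \<open>\<pi> / 2\<close> is interior to \<open>{0..2 * \<pi>}\<close>; hence the two pieces.
\<close>

lemma distr_angle_measure: "distr angle_measure borel (\<lambda>\<theta>. Pi_plus (cis \<theta>)) = circ"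
proof (rule measure_eqI_lessThan[symmetric])
  fix a :: real
  show "emeasure circ {a<..} < \<infinity>" by (simp add: emeasure_circ_greaterThan)
  have b: "- (3 * pi / 2) < angle a" "angle a < pi / 2"
    using arctan_bounded[of a] by (auto simp: angle_def field_simps)
  let ?S = "({max 0 (angle a)..<pi/2} \<union> {max (pi/2) (angle a + 2 * pi)..2 * pi})"
  have "emeasure (distr angle_measure borel (\<lambda>\<theta>. Pi_plus (cis \<theta>))) {a<..}
     = (\<integral>\<^sup>+\<theta>. ennreal (indicator {0..2 * pi} \<theta>) * indicator ((\<lambda>\<theta>. Pi_plus (cis \<theta>)) -` {a<..}) \<theta> \<partial>lborel)"
    by (subst emeasure_distr) (auto intro!: emeasure_density measurable_sets_borel[OF Pi_plus_cis_measurable])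
  also have "\<dots> = (\<integral>\<^sup>+\<theta>. indicator ?S \<theta> \<partial>lborel)"
    by (intro nn_integral_cong_AE)
      (use AE_lborel_singleton[of "pi/2"] AE_lborel_singleton[of "angle a"] AE_lborel_singleton[of "angle a + 2 * pi"]
       in eventually_elim, use b in \<open>auto simp: indicator_def Pi_plus_cis_less_iff max_def\<close>)
  also have "\<dots> = emeasure lborel ?S" by simp
  also have "\<dots> = emeasure lborel {max 0 (angle a)..<pi/2} + emeasure lborel {max (pi/2) (angle a + 2 * pi)..2 * pi}"
    by (intro plus_emeasure[symmetric]) auto
  also have "\<dots> = ennreal (pi / 2 - max 0 (angle a)) + ennreal (2 * pi - max (pi/2) (angle a + 2 * pi))
     "
    using b by (auto simp: max_def ennreal_neg emeasure_lborel_Icc_eq)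
  also have "\<dots> = ennreal (pi - 2 * arctan a)"
    using b by (auto simp: max_def angle_def field_simps ennreal_neg simp flip: ennreal_plus)
  finally show "emeasure circ {a<..} = emeasure (distr angle_measure borel (\<lambda>\<theta>. Pi_plus (cis \<theta>))) {a<..}"
    by (simp add: emeasure_circ_greaterThan)
qed auto

lemma lebesgue_AE_measurable:
  assumes f: "f \<in> borel_measurable lebesgue" and ae: "AE x in lebesgue. f x = g x"
  shows "g \<in> borel_measurable lebesgue"
proof (rule measurableI)
  fix B :: "'b set" assume B: "B \<in> sets borel"
  obtain N where N: "N \<in> null_sets lebesgue" "{x. f x \<noteq> g x} \<subseteq> N"
  proof -
    from AE_E[OF ae] obtain N where "{x \<in> space lebesgue. f x \<noteq> g x} \<subseteq> N" "emeasure lebesgue N = 0" "N \<in> sets lebesgue"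
      by blast
    then show thesis by (intro that[of N]) (simp_all only: null_sets_def mem_Collect_eq simp_thms UNIV_I space_completion space_lborel space_borel Collect_mem_eq)
  qed
  have "f x = g x" if "x \<notin> N" for x using N(2) that by blast
  then have "g -` B = (f -` B - N) \<union> (g -` B \<inter> N)" by auto
  moreover have "f -` B \<in> sets lebesgue" using measurable_sets[OF f B] by simp
  moreover have "g -` B \<inter> N \<in> sets lebesgue"
    by (rule completion.complete2[of _ N, THEN null_setsD2]) (use N in auto)
  ultimately have "g -` B \<in> sets lebesgue" using null_setsD2[OF N(1)] by (metis sets.Un sets.Diff)
  then show "g -` B \<inter> space lebesgue \<in> sets lebesgue" by simp
qed simp

text \<open>
  The angle \<open>\<pi> / 2\<close>, where \<open>Pi_plus\<close> divides by zero, is a null set; elsewhere this is the change of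
  variables of the preceding lemmas.
\<close>

lemma fourier_coeff_Pi_plus:
  fixes u v :: "real \<Rightarrow> complex"
  assumes v [measurable]: "v \<in> borel_measurable borel" and ae: "AE x in lborel. v x = u x"
  shows "fourier_coeff (u \<circ> Pi_plus) k = coef v k"
proof -
  have "AE x in distr angle_measure borel (\<lambda>\<theta>. Pi_plus (cis \<theta>)). v x = u x"
    unfolding distr_angle_measure AE_circ by (rule ae)
  then have "AE \<theta> in angle_measure. v (Pi_plus (cis \<theta>)) = u (Pi_plus (cis \<theta>))"
    by (rule AE_distrD[rotated]) simp
  then have 1: "AE \<theta> in lborel. \<theta> \<in> {0..2*pi} \<longrightarrow> v (Pi_plus (cis \<theta>)) = u (Pi_plus (cis \<theta>))"
    by (subst (asm) AE_density) (auto elim!: eventually_mono simp: indicator_def split: if_splits)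
  have 2: "AE \<theta> in lborel. \<theta> \<in> {0..2*pi} \<longrightarrow> cis (- (of_int k * \<theta>)) = chr (- k) (Pi_plus (cis \<theta>))"
    using AE_lborel_singleton[of "pi/2"]
  proof eventually_elim
    case (elim \<theta>)
    show ?case
    proof
      assume \<theta>: "\<theta> \<in> {0..2*pi}"
      have "cis \<theta> \<noteq> \<i>"
      proof
        assume "cis \<theta> = \<i>"
        then have c: "cos \<theta> = 0" "sin \<theta> = 1" by (simp_all add: complex_eq_iff)
        have "\<theta> = pi / 2 \<or> \<theta> = 3 * pi / 2"
          using c(1) \<theta> cos_zero_iff_int2[of \<theta>]
        proof -
          obtain n :: int where n: "odd n" "\<theta> = of_int n * (pi / 2)"
            using c(1) by (auto simp: cos_zero_iff_int)
          have "0 \<le> n" "n \<le> 4"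
            using \<theta> n(2) pi_gt_zero by (auto simp: field_simps zero_le_mult_iff)
          then have "n = 1 \<or> n = 3" using n(1) by presburger
          then show ?thesis using n(2) by auto
        qed
        with elim have "\<theta> = 3 * pi / 2" by simp
        then have "\<theta> = pi / 2 + pi" by simp
        then have "sin \<theta> = - 1" by (simp only: sin_add) simp
        then show False using c(2) by simp
      qed
      then have "cis (angle (Pi_plus (cis \<theta>))) = cis \<theta>"
        using Pi_plus_inv_Pi_plus[of "cis \<theta>"] chr_1_Pi_plus_inv[of "Pi_plus (cis \<theta>)"]
        by (simp add: chr_def)
      from cis_cong_mult[OF this, of "- k"]
      show "cis (- (of_int k * \<theta>)) = chr (- k) (Pi_plus (cis \<theta>))"
        by (simp add: chr_def)
    qed
  qed
  let ?h = "\<lambda>\<theta>. indicator {0..2*pi} \<theta> *\<^sub>R (v (Pi_plus (cis \<theta>)) * chr (- k) (Pi_plus (cis \<theta>)))"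
  have hm: "?h \<in> borel_measurable lborel" by measurable
  have ae3: "AE \<theta> in lebesgue. ?h \<theta> = indicator {0..2*pi} \<theta> *\<^sub>R ((u \<circ> Pi_plus) (cis \<theta>) * cis (- (of_int k * \<theta>)))"
    by (rule AE_completion) (use 1 2 in eventually_elim, auto simp: indicator_def)
  have "(LINT \<theta>:{0..2 * pi}|lebesgue. (u \<circ> Pi_plus) (cis \<theta>) * cis (- (of_int k * \<theta>))) = (\<integral>\<theta>. ?h \<theta> \<partial>lebesgue)"
    unfolding set_lebesgue_integral_def
    by (rule integral_cong_AE) (use lebesgue_AE_measurable[OF measurable_completion[OF hm] ae3] ae3 measurable_completion[OF hm] in \<open>auto elim!: eventually_mono\<close>)
  also have "\<dots> = (\<integral>\<theta>. ?h \<theta> \<partial>lborel)" by (rule integral_completion[OF hm])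
  also have "\<dots> = (\<integral>\<theta>. v (Pi_plus (cis \<theta>)) * chr (- k) (Pi_plus (cis \<theta>)) \<partial>angle_measure)"
    by (rule integral_density[symmetric]) auto
  also have "\<dots> = (\<integral>x. v x * chr (- k) x \<partial>distr angle_measure borel (\<lambda>\<theta>. Pi_plus (cis \<theta>)))"
    by (rule integral_distr[symmetric]) auto
  finally show ?thesis unfolding fourier_coeff_def coef_def distr_angle_measure by simp
qed

section \<open>Energy and degree of unimodular maps\<close>

text \<open>
  Every class of \<open>Hdot_S1\<close> has a Borel representative that is unimodular without exceptional points.
  Energy and degree are studied for these representatives, which can be multiplied, rescaled and
  reflected point by point without exceptional sets.
\<close>

definition S1_map :: "(real \<Rightarrow> complex) \<Rightarrow> bool" where
  "S1_map u \<longleftrightarrow> u \<in> borel_measurable borel \<and> (\<forall>x. cmod (u x) = 1) \<and> seminorm_sq u < \<infinity>"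

text \<open>
  The energy as a real number, so that energies can be subtracted; meaningful when the seminorm is
  finite.
\<close>

definition En :: "(real \<Rightarrow> complex) \<Rightarrow> real" where
  "En u = enn2real (seminorm_sq u) / (2 * pi)"

text \<open>
  By \<open>degree_line_deg\<close> this is the degree of the class that \<open>u\<close> represents.
\<close>

definition deg :: "(real \<Rightarrow> complex) \<Rightarrow> real" where
  "deg u = 1 / (2 * pi) * (\<Sum>\<^sub>\<infinity>k\<in>(UNIV :: int set). of_int k * (cmod (coef u k))\<^sup>2)"

lemma seminorm_sq_cong_AE:
  assumes ae: "AE x in lborel. u x = v x" shows "seminorm_sq u = seminorm_sq v"
proof -
  have "(\<integral>\<^sup>+ \<xi>. ennreal ((cmod (u x - u \<xi>))\<^sup>2 / (x - \<xi>)\<^sup>2) \<partial>lborel)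
      = (\<integral>\<^sup>+ \<xi>. ennreal ((cmod (v x - v \<xi>))\<^sup>2 / (x - \<xi>)\<^sup>2) \<partial>lborel)" if "u x = v x" for x
    by (intro nn_integral_cong_AE) (use ae that in auto)
  then show ?thesis
    unfolding seminorm_sq_def nn_integral_completion
    by (intro nn_integral_cong_AE) (use ae in auto)
qed

lemma seminorm_sq_pair:
  assumes [measurable]: "u \<in> borel_measurable borel"
  shows "seminorm_sq u = (\<integral>\<^sup>+ z. ennreal ((cmod (u (fst z) - u (snd z)))\<^sup>2 / (fst z - snd z)\<^sup>2) \<partial>(lborel \<Otimes>\<^sub>M lborel))"
  unfolding seminorm_sq_def nn_integral_completion
  by (subst lborel.nn_integral_fst[symmetric]) auto

lemma Hdot_S1_representative:
  assumes "u \<in> Hdot_S1"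
  obtains v where "S1_map v" "AE x in lborel. v x = u x"
proof -
  have u: "u \<in> borel_measurable lebesgue" "seminorm_sq u < \<infinity>" "AE x in lborel. cmod (u x) = 1"
    using assms by (auto simp: Hdot_S1_def Hdot_def AE_completion_iff)
  have "(\<lambda>x. Re (u x)) \<in> borel_measurable lebesgue" "(\<lambda>x. Im (u x)) \<in> borel_measurable lebesgue"
    using u(1) by (auto intro: borel_measurable_Re borel_measurable_Im measurable_compose)
  then obtain p q where [measurable]: "p \<in> borel_measurable lborel" "q \<in> borel_measurable lborel"
    and pq: "AE x in lborel. Re (u x) = p x" "AE x in lborel. Im (u x) = q x"
    using completion_ex_borel_measurable_real[of "\<lambda>x. Re (u x)" lborel] completion_ex_borel_measurable_real[of "\<lambda>x. Im (u x)" lborel]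
    by blast
  define v0 where "v0 x = Complex (p x) (q x)" for x
  have [measurable]: "v0 \<in> borel_measurable borel"
    unfolding v0_def Complex_eq by simp
  define v where "v x = (if cmod (v0 x) = 1 then v0 x else 1)" for x
  have [measurable]: "v \<in> borel_measurable borel" unfolding v_def by simp
  have ae: "AE x in lborel. v x = u x"
    using pq u(3)
  proof eventually_elim
    case (elim x)
    then have "v0 x = u x" by (simp add: v0_def complex_eq_iff)
    then show ?case using elim by (simp add: v_def)
  qed
  have "cmod (v x) = 1" for x by (simp add: v_def)
  moreover have "seminorm_sq v < \<infinity>"
    using seminorm_sq_cong_AE[OF ae] u(2) by simp
  ultimately have "S1_map v" unfolding S1_map_def by simp
  then show thesis using ae that by blast
qed

lemma S1_map_Hdot_S1: assumes "S1_map u" shows "u \<in> Hdot_S1"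
proof -
  have "u \<in> borel_measurable lebesgue"
    by (rule measurable_completion) (use assms in \<open>simp add: S1_map_def\<close>)
  then show ?thesis using assms by (simp add: S1_map_def Hdot_S1_def Hdot_def)
qed

lemma degree_line_deg:
  assumes "S1_map v" "AE x in lborel. v x = u x"
  shows "degree_line u = deg v"
  unfolding degree_line_def degree_circle_def deg_def
  using fourier_coeff_Pi_plus[of v u] assms by (simp add: S1_map_def)

lemma energy_En:
  assumes "S1_map v" "AE x in lborel. v x = u x"
  shows "energy u = ennreal (En v)"
proof -
  have e: "seminorm_sq u = ennreal (enn2real (seminorm_sq v))"
    using assms seminorm_sq_cong_AE[OF assms(2)] by (simp add: S1_map_def)
  have "energy u = ennreal (1 / (2 * pi) * enn2real (seminorm_sq v))"
    unfolding energy_def e by (rule ennreal_mult'[symmetric]) simp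
  then show ?thesis unfolding En_def by simp
qed

section \<open>Fourier series of the energy\<close>

lemma has_sum_int_from_nat:
  fixes h :: "int \<Rightarrow> real"
  assumes "\<And>k. h k \<ge> 0" and "(\<lambda>n. \<Sum>k\<in>{int n, - int n}. h k) sums s"
  shows "(h has_sum s) UNIV"
proof -
  let ?B = "\<lambda>n::nat. {int n, - int n}"
  have s: "((\<lambda>n. \<Sum>k\<in>?B n. h k) has_sum s) UNIV"
    using assms by (intro sums_nonneg_imp_has_sum sum_nonneg) auto
  have f: "((\<lambda>y. (h \<circ> snd) (n, y)) has_sum (\<Sum>k\<in>?B n. h k)) (?B n)" for n
    using has_sum_finite[of "?B n" h] by simp
  have "((h \<circ> snd) has_sum s) (Sigma UNIV ?B)"
  proof (rule has_sum_SigmaI[OF f s])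
    show "(h \<circ> snd) summable_on Sigma UNIV ?B"
      by (rule summable_on_SigmaI[OF f]) (use s assms(1) in \<open>auto simp: has_sum_imp_summable\<close>)
  qed
  moreover have "bij_betw snd (Sigma UNIV ?B) UNIV"
  proof (rule bij_betwI[where g = "\<lambda>k. (nat \<bar>k\<bar>, k)"])
    show "(\<lambda>k. (nat \<bar>k\<bar>, k)) \<in> UNIV \<rightarrow> Sigma UNIV ?B" by auto
  qed auto
  ultimately show ?thesis
    using has_sum_reindex_bij_betw[of snd "Sigma UNIV ?B" UNIV h s] by (simp add: o_def)
qed

text \<open>
  Abel summation and its converse for nonnegative terms. The quotient of \<open>\<Sum>(1 - r\<^sup>n) A n\<close> by \<open>1 - r\<close>
  is \<open>\<Sum>(1 + r + \<dots> + r\<^sup>n\<^sup>-\<^sup>1) A n\<close>, which increases to \<open>\<Sum> n * A n\<close> as \<open>r\<close> tends to 1; the limit of the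
  quotients, known from another source, is therefore the weighted sum.
\<close>

lemma abel_energy:
  fixes A :: "nat \<Rightarrow> real" and r G :: "nat \<Rightarrow> real"
  assumes A: "\<And>n. A n \<ge> 0" and r: "\<And>j. 0 \<le> r j" "\<And>j. r j < 1" "r \<longlonglongrightarrow> 1"
    and G: "\<And>j. G j \<ge> 0" "G \<longlonglongrightarrow> E"
    and s: "\<And>j. (\<lambda>n. r j ^ n * A n) sums (N - (1 - r j) * G j)"
  shows "A sums N" and "(\<lambda>n. real n * A n) sums E"
proof -
  have fN: "(\<lambda>j. N - (1 - r j) * G j) \<longlonglongrightarrow> N - (1 - 1) * E"
    by (intro tendsto_intros r G)
  have part: "(\<Sum>n<m. A n) \<le> N" for m
  proof (rule LIMSEQ_le_const2)
    show "(\<lambda>j. \<Sum>n<m. r j ^ n * A n) \<longlonglongrightarrow> (\<Sum>n<m. A n)"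
      by (rule tendsto_eq_intros r | simp)+
    have "(\<Sum>n<m. r j ^ n * A n) \<le> N" for j
    proof -
      have "(\<Sum>n<m. r j ^ n * A n) \<le> (\<Sum>n. r j ^ n * A n)"
        by (rule sum_le_suminf) (use sums_summable[OF s[of j]] r A in auto)
      also have "\<dots> \<le> N" proof -
        have "0 \<le> (1 - r j) * G j" using r(2)[of j] G(1)[of j] by simp
        then show ?thesis using s[of j, THEN sums_unique] by linarith
      qed
      finally show ?thesis .
    qed
    then show "\<exists>j0. \<forall>j\<ge>j0. (\<Sum>n<m. r j ^ n * A n) \<le> N" by blast
  qed
  have sA: "summable A" by (rule summableI_nonneg_bounded[OF A part])
  have le1: "suminf A \<le> N" by (rule suminf_le_const[OF sA part])
  have "N - (1 - r j) * G j \<le> suminf A" for j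
  proof -
    have "(\<Sum>n. r j ^ n * A n) \<le> suminf A"
      by (rule suminf_le) (use sA sums_summable[OF s] A r(1)[of j] r(2)[of j] in
          \<open>auto intro!: mult_left_le_one_le power_le_one simp: less_imp_le[of _ 1]\<close>)
    then show ?thesis using s[of j, THEN sums_unique] by simp
  qed
  then have "N \<le> suminf A"
    using LIMSEQ_le_const2[OF fN, of "suminf A"] by auto
  with le1 have "suminf A = N" by simp
  then show AN: "A sums N" using summable_sums[OF sA] by simp
  have sG: "(\<lambda>n. (\<Sum>i<n. r j ^ i) * A n) sums G j" for j
  proof -
    have "(\<lambda>n. (A n - r j ^ n * A n) / (1 - r j)) sums ((N - (N - (1 - r j) * G j)) / (1 - r j))"
      by (intro sums_divide sums_diff AN s)
    moreover have "(A n - r j ^ n * A n) / (1 - r j) = (\<Sum>i<n. r j ^ i) * A n" for n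
    proof -
      have "A n - r j ^ n * A n = (1 - r j ^ n) * A n" by (simp add: algebra_simps)
      also have "\<dots> = (1 - r j) * (\<Sum>i<n. r j ^ i) * A n" by (simp only: one_diff_power_eq)
      finally show ?thesis using r(2)[of j] by simp
    qed
    ultimately show ?thesis using r(2)[of j] by simp
  qed
  have gn: "0 \<le> (\<Sum>i<n. r j ^ i)" "(\<Sum>i<n. r j ^ i) \<le> real n" for j n
  proof -
    show "0 \<le> (\<Sum>i<n. r j ^ i)" by (intro sum_nonneg) (use r in auto)
    have "(\<Sum>i<n. r j ^ i) \<le> (\<Sum>i<n. 1)"
      by (intro sum_mono power_le_one) (use r in \<open>auto intro: less_imp_le\<close>)
    then show "(\<Sum>i<n. r j ^ i) \<le> real n" by simp
  qed
  have part2: "(\<Sum>n<m. real n * A n) \<le> E" for m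
  proof (rule LIMSEQ_le[OF _ G(2)])
    have "(\<lambda>j. \<Sum>n<m. (\<Sum>i<n. r j ^ i) * A n) \<longlonglongrightarrow> (\<Sum>n<m. (\<Sum>i<n. 1 ^ i) * A n)"
      by (intro tendsto_intros r)
    then show "(\<lambda>j. \<Sum>n<m. (\<Sum>i<n. r j ^ i) * A n) \<longlonglongrightarrow> (\<Sum>n<m. real n * A n)" by simp
    have "(\<Sum>n<m. (\<Sum>i<n. r j ^ i) * A n) \<le> G j" for j
      using sum_le_suminf[OF sums_summable[OF sG[of j]], of "{..<m}"] gn A sums_unique[OF sG[of j]] by simp
    then show "\<exists>N. \<forall>j\<ge>N. (\<Sum>n<m. (\<Sum>i<n. r j ^ i) * A n) \<le> G j" by blast
  qed
  have sn: "summable (\<lambda>n. real n * A n)"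
    by (rule summableI_nonneg_bounded[OF _ part2]) (use A in auto)
  have "suminf (\<lambda>n. real n * A n) \<le> E" by (rule suminf_le_const[OF sn part2])
  moreover have "G j \<le> suminf (\<lambda>n. real n * A n)" for j
    unfolding sums_unique[OF sG[of j]]
    by (rule suminf_le) (use gn A sn sums_summable[OF sG[of j]] in \<open>auto intro: mult_right_mono\<close>)
  then have "E \<le> suminf (\<lambda>n. real n * A n)"
    using LIMSEQ_le_const2[OF G(2)] by auto
  ultimately show "(\<lambda>n. real n * A n) sums E" using sn by (simp add: sums_iff)
qed

lemma integral_cis:
  "(\<integral>\<theta>. indicator {0..2 * pi} \<theta> *\<^sub>R cis (of_int k * \<theta>) \<partial>lborel) = (if k = 0 then of_real (2 * pi) else 0)"
proof (cases "k = 0")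
  case False
  have "(\<integral>\<theta>. indicator {0..2 * pi} \<theta> *\<^sub>R cis (of_int k * \<theta>) \<partial>lborel)
     = cis (of_int k * (2 * pi)) / (\<i> * of_int k) - cis (of_int k * 0) / (\<i> * of_int k)"
  proof (rule integral_FTC_atLeastAtMost)
    show "((\<lambda>\<theta>. cis (of_int k * \<theta>) / (\<i> * of_int k)) has_vector_derivative cis (of_int k * x)) (at x within {0..2*pi})" for x
    proof -
      have "((\<lambda>\<theta>. cis (of_int k * \<theta>)) has_vector_derivative (of_int k * (\<i> * cis (of_int k * x)))) (at x within {0..2*pi})"
      proof -
        have "((\<lambda>z. exp (\<i> * (of_int k * z))) has_field_derivative of_int k * (\<i> * exp (\<i> * (of_int k * of_real x)))) (at (of_real x))"
          by (auto intro!: derivative_eq_intros)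
        from has_vector_derivative_real_field[OF this, of "{0..2*pi}"] show ?thesis
          by (simp add: cis_conv_exp)
      qed
      from has_vector_derivative_divide[OF this, of "\<i> * of_int k"] False show ?thesis by simp
    qed
    show "continuous_on {0..2*pi} (\<lambda>\<theta>. cis (of_int k * \<theta>))" by (intro continuous_intros)
  qed simp
  also have "cis (of_int k * (2 * pi)) = 1" using cis_multiple_2pi[of "of_int k"] by (simp add: mult_ac)
  finally show ?thesis using False by simp
qed (simp add: scaleR_conv_of_real)

lemma integral_chr: "(\<integral>x. chr k x \<partial>circ) = (if k = 0 then of_real (2 * pi) else 0)"
proof -
  have "coef (\<lambda>_. 1) (- k) = fourier_coeff ((\<lambda>_. 1) \<circ> Pi_plus) (- k)"
    by (rule fourier_coeff_Pi_plus[symmetric]) auto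
  also have "\<dots> = of_real (1 / sqrt (2 * pi)) * (\<integral>\<theta>. indicator {0..2 * pi} \<theta> *\<^sub>R cis (of_int k * \<theta>) \<partial>lborel)"
    unfolding fourier_coeff_def set_lebesgue_integral_def
  proof (subst integral_completion)
    have [measurable]: "(\<lambda>\<theta>. cis (of_int k * \<theta>)) \<in> borel_measurable borel"
      by (intro borel_measurable_continuous_onI continuous_intros)
    show "(\<lambda>x. indicat_real {0..2 * pi} x *\<^sub>R (((\<lambda>_. 1) \<circ> Pi_plus) (cis x) * cis (- (real_of_int (- k) * x)))) \<in> borel_measurable lborel"
      by simp
  qed simp
  finally show ?thesis unfolding integral_cis coef_def
    by (auto split: if_splits)
qed

interpretation circ2: pair_sigma_finite circ circ ..

abbreviation circ2 :: "(real \<times> real) measure" where "circ2 \<equiv> circ \<Otimes>\<^sub>M circ"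

interpretation circ2: finite_measure circ2
  by (rule finite_measure_pair_measure) unfold_locales

lemma measure_circ2_UNIV: "measure circ2 UNIV = (2 * pi)\<^sup>2"
proof -
  have "emeasure circ2 (UNIV \<times> UNIV) = emeasure circ UNIV * emeasure circ UNIV"
    by (rule circ.emeasure_pair_measure_Times) auto
  then show ?thesis
    by (simp add: measure_def emeasure_circ_UNIV power2_eq_square flip: ennreal_mult)
qed

lemma integrable_circ_bounded:
  fixes f :: "real \<Rightarrow> 'b::{banach, second_countable_topology}"
  assumes "f \<in> borel_measurable borel" "\<And>x. norm (f x) \<le> B"
  shows "integrable circ f"
  by (rule circ.integrable_const_bound[where B = B]) (use assms in auto)

lemma integrable_circ2_bounded:
  fixes f :: "real \<times> real \<Rightarrow> 'b::{banach, second_countable_topology}"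
  assumes "f \<in> borel_measurable (borel \<Otimes>\<^sub>M borel)" "\<And>x. norm (f x) \<le> B"
  shows "integrable circ2 f"
proof (rule circ2.integrable_const_bound[where B = B])
  show "f \<in> borel_measurable circ2" using assms(1) by measurable
qed (use assms in auto)

lemma integral_circ2_prod:
  fixes f g :: "real \<Rightarrow> 'b::{real_normed_field, banach, second_countable_topology}"
  assumes [measurable]: "f \<in> borel_measurable borel" "g \<in> borel_measurable borel"
    and b: "\<And>x. norm (f x) \<le> B" "\<And>x. norm (g x) \<le> C"
  shows "(\<integral>z. f (fst z) * g (snd z) \<partial>circ2) = (\<integral>x. f x \<partial>circ) * (\<integral>x. g x \<partial>circ)"
proof -
  have i: "integrable circ2 (\<lambda>z. f (fst z) * g (snd z))"
  proof (rule integrable_circ2_bounded)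
    have "0 \<le> B" using b(1)[of 0] norm_ge_zero order_trans by blast
    then show "norm (f (fst x) * g (snd x)) \<le> B * C" for x
      using b by (simp add: norm_mult mult_mono)
  qed simp
  have "(\<integral>z. f (fst z) * g (snd z) \<partial>circ2) = (\<integral>x. (\<integral>y. f x * g y \<partial>circ) \<partial>circ)"
    using circ2.integral_fst'[OF i] by simp
  then show ?thesis by simp
qed

lemma coef_integral: "(\<integral>x. u x * chr (- k) x \<partial>circ) = of_real (sqrt (2 * pi)) * coef u k"
  by (simp add: coef_def)

lemma coef_integral': "(\<integral>x. cnj (u x) * chr k x \<partial>circ) = of_real (sqrt (2 * pi)) * cnj (coef u k)"
proof -
  have "(\<integral>x. cnj (u x) * chr k x \<partial>circ) = (\<integral>x. cnj (u x * chr (- k) x) \<partial>circ)" by simp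
  also have "\<dots> = cnj (\<integral>x. u x * chr (- k) x \<partial>circ)"
    by (simp only: Bochner_Integration.integral_cnj)
  also have "\<dots> = cnj (of_real (sqrt (2 * pi)) * coef u k)"
    by (simp only: coef_integral)
  finally show ?thesis by simp
qed

lemma cnj_measurable [measurable]: "cnj \<in> borel_measurable borel"
  by (intro borel_measurable_continuous_onI continuous_intros)

lemma cmod_diff_sq:
  "complex_of_real ((cmod (a - b))\<^sup>2) = of_real ((cmod a)\<^sup>2) + of_real ((cmod b)\<^sup>2) - a * cnj b - cnj a * b"
  unfolding cmod_power2 by (simp add: complex_eq_iff) (simp add: power2_eq_square algebra_simps)

text \<open>
  Expanding the square leaves products of functions of one variable, and these integrate to products
  of coefficients of index \<open>\<plusminus> k\<close>.
\<close>

lemma moment_circ2: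
  assumes [measurable]: "w \<in> borel_measurable borel" and b: "\<And>x. cmod (w x) \<le> C"
  shows "(\<integral>z. of_real ((cmod (w (fst z) - w (snd z)))\<^sup>2) * (chr k (fst z) * chr (- k) (snd z)) \<partial>circ2)
     = of_real ((if k = 0 then 4 * pi * (\<integral>x. (cmod (w x))\<^sup>2 \<partial>circ) else 0)
         - 2 * pi * ((cmod (coef w k))\<^sup>2 + (cmod (coef w (- k)))\<^sup>2))"
proof -
  have C: "0 \<le> C" using b[of 0] norm_ge_zero order_trans by blast
  have b2: "(cmod (w x))\<^sup>2 \<le> C\<^sup>2" for x by (simp add: b power_mono)
  have mm[measurable]: "(\<lambda>x. of_real ((cmod (w x))\<^sup>2) * chr k x) \<in> borel_measurable borel" for k by simp
  let ?f = "\<lambda>k x. of_real ((cmod (w x))\<^sup>2) * chr k x"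
  have int: "integrable circ2 (\<lambda>z. f (fst z) * g (snd z))"
    if [measurable]: "f \<in> borel_measurable borel" "g \<in> borel_measurable borel"
      and "\<And>x. cmod (f x) \<le> C1" "\<And>x. cmod (g x) \<le> C2" for f g :: "real \<Rightarrow> complex" and C1 C2
  proof (rule integrable_circ2_bounded)
    have "0 \<le> C1" using that(3)[of 0] norm_ge_zero order_trans by blast
    then show "norm (f (fst x) * g (snd x)) \<le> C1 * C2" for x
      using that by (simp add: norm_mult mult_mono)
  qed simp
  have split: "of_real ((cmod (w (fst z) - w (snd z)))\<^sup>2) * (chr k (fst z) * chr (- k) (snd z))
     = ?f k (fst z) * chr (- k) (snd z) + chr k (fst z) * ?f (- k) (snd z)
       - (w (fst z) * chr k (fst z)) * (cnj (w (snd z)) * chr (- k) (snd z))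
       - (cnj (w (fst z)) * chr k (fst z)) * (w (snd z) * chr (- k) (snd z))" for z
    unfolding cmod_diff_sq by (simp add: algebra_simps)
  have i1: "integrable circ2 (\<lambda>z. ?f k (fst z) * chr (- k) (snd z))"
    by (rule int[where ?C1.0 = "C\<^sup>2" and ?C2.0 = 1]) (use b2 in \<open>auto simp: norm_mult norm_power\<close>)
  have i2: "integrable circ2 (\<lambda>z. chr k (fst z) * ?f (- k) (snd z))"
    by (rule int[where ?C1.0 = 1 and ?C2.0 = "C\<^sup>2"]) (use b2 in \<open>auto simp: norm_mult norm_power\<close>)
  have i3: "integrable circ2 (\<lambda>z. (w (fst z) * chr k (fst z)) * (cnj (w (snd z)) * chr (- k) (snd z)))"
    by (rule int[where ?C1.0 = C and ?C2.0 = C]) (use b in \<open>auto simp: norm_mult\<close>)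
  have i4: "integrable circ2 (\<lambda>z. (cnj (w (fst z)) * chr k (fst z)) * (w (snd z) * chr (- k) (snd z)))"
    by (rule int[where ?C1.0 = C and ?C2.0 = C]) (use b in \<open>auto simp: norm_mult\<close>)
  have e1: "(\<integral>z. ?f k (fst z) * chr (- k) (snd z) \<partial>circ2) = (\<integral>x. ?f k x \<partial>circ) * (\<integral>x. chr (- k) x \<partial>circ)"
    by (rule integral_circ2_prod[where B = "C\<^sup>2" and C = 1]) (use b2 in \<open>auto simp: norm_mult norm_power\<close>)
  have e2: "(\<integral>z. chr k (fst z) * ?f (- k) (snd z) \<partial>circ2) = (\<integral>x. chr k x \<partial>circ) * (\<integral>x. ?f (- k) x \<partial>circ)"
    by (rule integral_circ2_prod[where B = 1 and C = "C\<^sup>2"]) (use b2 in \<open>auto simp: norm_mult norm_power\<close>)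
  have e3: "(\<integral>z. (w (fst z) * chr k (fst z)) * (cnj (w (snd z)) * chr (- k) (snd z)) \<partial>circ2)
     = (\<integral>x. w x * chr k x \<partial>circ) * (\<integral>x. cnj (w x) * chr (- k) x \<partial>circ)"
    by (rule integral_circ2_prod[where B = C and C = C]) (use b in \<open>auto simp: norm_mult\<close>)
  have e4: "(\<integral>z. (cnj (w (fst z)) * chr k (fst z)) * (w (snd z) * chr (- k) (snd z)) \<partial>circ2)
     = (\<integral>x. cnj (w x) * chr k x \<partial>circ) * (\<integral>x. w x * chr (- k) x \<partial>circ)"
    by (rule integral_circ2_prod[where B = C and C = C]) (use b in \<open>auto simp: norm_mult\<close>)
  have sq: "of_real (sqrt (2 * pi)) * a * (of_real (sqrt (2 * pi)) * cnj a) = (of_real (2 * pi * (cmod a)\<^sup>2) :: complex)" for a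
  proof -
    have "of_real (sqrt (2 * pi)) * a * (of_real (sqrt (2 * pi)) * cnj a)
       = of_real (sqrt (2 * pi) * sqrt (2 * pi)) * (a * cnj a)"
      by (simp only: of_real_mult mult_ac)
    also have "\<dots> = of_real (2 * pi) * of_real ((cmod a)\<^sup>2)"
      by (simp only: complex_norm_square[symmetric] real_sqrt_mult_self of_real_power) simp
    finally show ?thesis by simp
  qed
  have w1: "(\<integral>x. w x * chr k x \<partial>circ) = of_real (sqrt (2 * pi)) * coef w (- k)"
    using coef_integral[of w "- k"] by simp
  have w2: "(\<integral>x. cnj (w x) * chr (- k) x \<partial>circ) = of_real (sqrt (2 * pi)) * cnj (coef w (- k))"
    using coef_integral'[of w "- k"] by simp
  have re: "(\<integral>x. complex_of_real ((cmod (w x))\<^sup>2) \<partial>circ) = of_real (\<integral>x. (cmod (w x))\<^sup>2 \<partial>circ)"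
    by (rule integral_complex_of_real)
  have "(\<integral>z. of_real ((cmod (w (fst z) - w (snd z)))\<^sup>2) * (chr k (fst z) * chr (- k) (snd z)) \<partial>circ2)
     = (\<integral>x. ?f k x \<partial>circ) * (\<integral>x. chr (- k) x \<partial>circ) + (\<integral>x. chr k x \<partial>circ) * (\<integral>x. ?f (- k) x \<partial>circ)
       - (\<integral>x. w x * chr k x \<partial>circ) * (\<integral>x. cnj (w x) * chr (- k) x \<partial>circ)
       - (\<integral>x. cnj (w x) * chr k x \<partial>circ) * (\<integral>x. w x * chr (- k) x \<partial>circ)"
    unfolding split
    by (simp only: Bochner_Integration.integral_diff Bochner_Integration.integral_add
       Bochner_Integration.integrable_diff Bochner_Integration.integrable_add i1 i2 i3 i4 e1 e2 e3 e4)
  also have "(\<integral>x. w x * chr k x \<partial>circ) * (\<integral>x. cnj (w x) * chr (- k) x \<partial>circ) = of_real (2 * pi * (cmod (coef w (- k)))\<^sup>2)"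
    unfolding w1 w2 by (rule sq)
  also have "(\<integral>x. cnj (w x) * chr k x \<partial>circ) * (\<integral>x. w x * chr (- k) x \<partial>circ) = of_real (2 * pi * (cmod (coef w k))\<^sup>2)"
    unfolding coef_integral coef_integral' by (subst mult.commute) (rule sq)
  also have "(\<integral>x. ?f k x \<partial>circ) * (\<integral>x. chr (- k) x \<partial>circ) + (\<integral>x. chr k x \<partial>circ) * (\<integral>x. ?f (- k) x \<partial>circ)
     = of_real (if k = 0 then 4 * pi * (\<integral>x. (cmod (w x))\<^sup>2 \<partial>circ) else 0)"
    by (simp add: integral_chr re del: of_real_power)
  finally show ?thesis by (simp add: algebra_simps)
qed

lemma seminorm_sq_circ2:
  assumes [measurable]: "w \<in> borel_measurable borel"
  shows "seminorm_sq w = (\<integral>\<^sup>+ z. ennreal ((cmod (w (fst z) - w (snd z)))\<^sup>2 / (cmod (chr 1 (fst z) - chr 1 (snd z)))\<^sup>2) \<partial>circ2)"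
proof -
  let ?g = "\<lambda>x y. ennreal ((cmod (w x - w y))\<^sup>2 / (cmod (chr 1 x - chr 1 y))\<^sup>2)"
  have pt: "ennreal (2 / (1 + x\<^sup>2)) * (ennreal (2 / (1 + y\<^sup>2)) * ?g x y) = ennreal ((cmod (w x - w y))\<^sup>2 / (x - y)\<^sup>2)" for x y
  proof -
    have "0 < 1 + x\<^sup>2" "0 < 1 + y\<^sup>2" by auto
    then have "2 / (1 + x\<^sup>2) * (2 / (1 + y\<^sup>2) * ((cmod (w x - w y))\<^sup>2 / (cmod (chr 1 x - chr 1 y))\<^sup>2))
       = (cmod (w x - w y))\<^sup>2 / (x - y)\<^sup>2"
      unfolding chr_1_diff by (cases "x = y") (simp_all add: divide_simps)
    then show ?thesis by (simp flip: ennreal_mult')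
  qed
  have "(\<integral>\<^sup>+ z. ?g (fst z) (snd z) \<partial>circ2) = (\<integral>\<^sup>+x. (\<integral>\<^sup>+y. ?g x y \<partial>circ) \<partial>circ)"
    by (subst circ.nn_integral_fst[symmetric]) auto
  also have "\<dots> = (\<integral>\<^sup>+x. (\<integral>\<^sup>+y. ennreal (2 / (1 + y\<^sup>2)) * ?g x y \<partial>lborel) \<partial>circ)"
    unfolding circ_def by (subst (2) nn_integral_density) auto
  also have "\<dots> = (\<integral>\<^sup>+x. ennreal (2 / (1 + x\<^sup>2)) * (\<integral>\<^sup>+y. ennreal (2 / (1 + y\<^sup>2)) * ?g x y \<partial>lborel) \<partial>lborel)"
    unfolding circ_def by (subst nn_integral_density) auto
  also have "\<dots> = (\<integral>\<^sup>+x. (\<integral>\<^sup>+y. ennreal (2 / (1 + x\<^sup>2)) * (ennreal (2 / (1 + y\<^sup>2)) * ?g x y) \<partial>lborel) \<partial>lborel)"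
    by (subst nn_integral_cmult) auto
  also have "\<dots> = seminorm_sq w"
    unfolding pt seminorm_sq_def nn_integral_completion ..
  finally show ?thesis ..
qed

lemma chr_1_power: "chr 1 x ^ n = chr (int n) x" "chr (- 1) x ^ n = chr (- int n) x"
  using Complex.DeMoivre[of "angle x" n] Complex.DeMoivre[of "- angle x" n] by (simp_all add: chr_def)

text \<open>
  The Poisson kernel of the circle as a cosine series.
\<close>

lemma poisson_sums:
  assumes r: "0 \<le> r" "r < 1" and v: "cmod v = 1"
  shows "(\<lambda>n. r ^ n * (if n = 0 then 1 else 2 * Re (v ^ n))) sums ((1 - r\<^sup>2) / (cmod (1 - of_real r * v))\<^sup>2)"
proof -
  let ?q = "of_real r * v"
  have q: "cmod ?q < 1" using r v by (simp add: norm_mult)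
  have nz: "1 - ?q \<noteq> 0" using q by auto
  have "(\<lambda>n. 2 * Re (?q ^ n) - (if n = 0 then 1 else 0)) sums (2 * Re (1 / (1 - ?q)) - 1)"
    by (intro sums_diff sums_mult sums_Re geometric_sums q) (use sums_single[of 0 "\<lambda>_. 1::real"] in simp)
  moreover have "2 * Re (?q ^ n) - (if n = 0 then 1 else 0) = r ^ n * (if n = 0 then 1 else 2 * Re (v ^ n))" for n
    by (simp add: power_mult_distrib flip: of_real_power)
  moreover have "2 * Re (1 / (1 - ?q)) - 1 = (1 - r\<^sup>2) / (cmod (1 - ?q))\<^sup>2"
  proof -
    have v2: "(Re v)\<^sup>2 + (Im v)\<^sup>2 = 1" using v by (metis cmod_power2 one_power2)
    have c: "(cmod (1 - ?q))\<^sup>2 = 1 - 2 * r * Re v + r\<^sup>2"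
    proof -
      have "(cmod (1 - ?q))\<^sup>2 = 1 - 2 * r * Re v + r\<^sup>2 * ((Re v)\<^sup>2 + (Im v)\<^sup>2)"
        unfolding cmod_power2 by (simp add: power2_eq_square algebra_simps)
      then show ?thesis using v2 by simp
    qed
    have "(cmod (1 - ?q))\<^sup>2 \<noteq> 0" using nz by simp
    moreover have "Re (1 / (1 - ?q)) = (1 - r * Re v) / (cmod (1 - ?q))\<^sup>2"
      by (simp add: Re_divide cmod_power2)
    ultimately show ?thesis using c by (simp add: field_simps)
  qed
  ultimately show ?thesis by simp
qed

text \<open>
  The function \<open>\<bar>w x - w y\<bar>\<^sup>2\<close> is integrated against the Poisson kernel of radius \<open>r\<close> in the
  difference of the two angles. The series of the kernel turns the integral into Abel means of the
  squared coefficients; the closed form of the kernel is \<open>1 - r\<^sup>2\<close> times a majorised approximation of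
  \<open>1 / \<bar>p - q\<bar>\<^sup>2\<close>, so dominated convergence gives the seminorm as \<open>r\<close> tends to 1. Lemma \<open>abel_energy\<close>
  reads both identities off this limit.
\<close>

theorem
  assumes [measurable]: "w \<in> borel_measurable borel" and b: "\<And>x. cmod (w x) \<le> C"
    and fin: "seminorm_sq w < \<infinity>"
  shows parseval: "((\<lambda>k. (cmod (coef w k))\<^sup>2) has_sum (\<integral>x. (cmod (w x))\<^sup>2 \<partial>circ)) UNIV"
    and energy_fourier: "((\<lambda>k. of_int \<bar>k\<bar> * (cmod (coef w k))\<^sup>2) has_sum En w) UNIV"
proof -
  define F where "F z = (cmod (w (fst z) - w (snd z)))\<^sup>2" for z :: "real \<times> real"
  define v where "v z = chr 1 (fst z) * chr (- 1) (snd z)" for z :: "real \<times> real"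
  define N where "N = (\<integral>x. (cmod (w x))\<^sup>2 \<partial>circ)"
  define A where "A n = (\<Sum>k\<in>{int n, - int n}. (cmod (coef w k))\<^sup>2)" for n :: nat
  define r where "r j = real j / (real j + 1)" for j :: nat
  define P where "P j z = F z / (cmod (1 - of_real (r j) * v z))\<^sup>2" for j z
  define P1 where "P1 z = F z / (cmod (1 - v z))\<^sup>2" for z
  define G where "G j = (1 + r j) / (4 * pi) * (\<integral>z. P j z \<partial>circ2)" for j
  have [measurable]: "F \<in> borel_measurable (borel \<Otimes>\<^sub>M borel)" "v \<in> borel_measurable (borel \<Otimes>\<^sub>M borel)"
    unfolding F_def v_def by measurable
  have [measurable]: "P j \<in> borel_measurable (borel \<Otimes>\<^sub>M borel)" "P1 \<in> borel_measurable (borel \<Otimes>\<^sub>M borel)" for j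
    unfolding P_def P1_def by measurable
  have r: "0 \<le> r j" "r j < 1" for j by (auto simp: r_def)
  have r1: "r \<longlonglongrightarrow> 1" unfolding r_def by real_asymp
  have C: "0 \<le> C" using b[of 0] norm_ge_zero order_trans by blast
  have v1: "cmod (v z) = 1" for z by (simp add: v_def norm_mult)
  have F0: "0 \<le> F z" for z by (simp add: F_def)
  have FC: "F z \<le> (2 * C)\<^sup>2" for z
  proof -
    have "cmod (w (fst z) - w (snd z)) \<le> 2 * C"
      using norm_triangle_ineq4[of "w (fst z)" "w (snd z)"] b[of "fst z"] b[of "snd z"] by linarith
    then show ?thesis unfolding F_def by (intro power_mono) auto
  qed
  have vpow: "v z ^ n = chr (int n) (fst z) * chr (- int n) (snd z)" for z n
    by (simp add: v_def power_mult_distrib chr_1_power)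
  have A0: "0 \<le> A n" for n unfolding A_def by (intro sum_nonneg) auto
  have intF: "integrable circ2 (\<lambda>z. of_real (F z) * v z ^ n)" for n
    by (rule integrable_circ2_bounded[where B = "(2 * C)\<^sup>2"]) (use F0 FC v1 in \<open>auto simp: norm_mult norm_power\<close>)
  define T where "T n z = F z * (if n = 0 then 1 else 2 * Re (v z ^ n))" for n :: nat and z
  have Tb: "\<bar>T n z\<bar> \<le> 2 * (2 * C)\<^sup>2" for n z
  proof -
    have "\<bar>Re (v z ^ n)\<bar> \<le> 1" using abs_Re_le_cmod[of "v z ^ n"] v1[of z] by (simp add: norm_power)
    then have "\<bar>if n = 0 then 1 else 2 * Re (v z ^ n)\<bar> \<le> 2" by auto
    then have "F z * \<bar>if n = 0 then 1 else 2 * Re (v z ^ n)\<bar> \<le> (2 * C)\<^sup>2 * 2"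
      using F0[of z] FC[of z] by (intro mult_mono) auto
    then show ?thesis using F0[of z] by (simp add: T_def abs_mult mult.commute)
  qed
  have [measurable]: "T n \<in> borel_measurable (borel \<Otimes>\<^sub>M borel)" for n
    unfolding T_def by measurable
  have Tint: "integrable circ2 (T n)" for n
    by (rule integrable_circ2_bounded[where B = "2 * (2 * C)\<^sup>2"]) (use Tb in auto)
  have Tval: "(\<integral>z. T n z \<partial>circ2) = (if n = 0 then 4 * pi * N else 0) - 4 * pi * A n" for n
  proof -
    have "(\<integral>z. F z * Re (v z ^ n) \<partial>circ2) = Re (\<integral>z. of_real (F z) * v z ^ n \<partial>circ2)"
      by (subst integral_Re[OF intF, symmetric]) simp
    also have "\<dots> = (if n = 0 then 4 * pi * N else 0)
         - 2 * pi * ((cmod (coef w (int n)))\<^sup>2 + (cmod (coef w (- int n)))\<^sup>2)"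
      unfolding vpow F_def N_def using moment_circ2[OF assms(1) b, of "int n"] by simp
    finally have m: "(\<integral>z. F z * Re (v z ^ n) \<partial>circ2) = \<dots>" .
    show ?thesis
    proof (cases "n = 0")
      case True
      then show ?thesis using m by (simp add: T_def A_def)
    next
      case False
      then have "(\<integral>z. T n z \<partial>circ2) = 2 * (\<integral>z. F z * Re (v z ^ n) \<partial>circ2)"
      proof -
        have "T n z = 2 * (F z * Re (v z ^ n))" for z using False by (simp add: T_def)
        then show ?thesis by simp
      qed
      then show ?thesis using m False by (simp add: A_def)
    qed
  qed
  have S: "(\<lambda>n. r j ^ n * A n) sums (N - (1 - r j) * G j)" for j
  proof -
    have pw: "(\<lambda>n. r j ^ n * T n z) sums ((1 - (r j)\<^sup>2) * P j z)" for z
      using sums_mult[OF poisson_sums[OF r[of j] v1[of z]], of "F z"]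
      by (simp add: T_def P_def mult_ac)
    have "(\<lambda>n. \<integral>z. r j ^ n * T n z \<partial>circ2) sums (\<integral>z. (\<Sum>n. r j ^ n * T n z) \<partial>circ2)"
    proof (rule sums_integral)
      show "integrable circ2 (\<lambda>z. r j ^ n * T n z)" for n using Tint by simp
      have sg: "summable (\<lambda>n. r j ^ n * (2 * (2 * C)\<^sup>2))"
        using r[of j] by (intro summable_mult2 summable_geometric) auto
      show "AE z in circ2. summable (\<lambda>n. norm (r j ^ n * T n z))"
      proof (intro AE_I2 summable_comparison_test'[OF sg])
        show "norm (norm (r j ^ n * T n z)) \<le> r j ^ n * (2 * (2 * C)\<^sup>2)" for n z
          using Tb[of n z] r[of j] by (simp add: abs_mult mult_left_mono)
      qed
      have sg2: "summable (\<lambda>n. r j ^ n * (2 * (2 * C)\<^sup>2) * (2 * pi)\<^sup>2)"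
        using sg by (rule summable_mult2)
      show "summable (\<lambda>n. \<integral>z. norm (r j ^ n * T n z) \<partial>circ2)"
      proof (rule summable_comparison_test'[OF sg2])
        fix n :: nat
        have "(\<integral>z. norm (r j ^ n * T n z) \<partial>circ2) \<le> (\<integral>z. r j ^ n * (2 * (2 * C)\<^sup>2) \<partial>circ2)"
        proof (rule integral_mono)
          show "integrable circ2 (\<lambda>z. norm (r j ^ n * T n z))" using Tint by (intro integrable_norm) simp
          show "norm (r j ^ n * T n z) \<le> r j ^ n * (2 * (2 * C)\<^sup>2)" for z
            using Tb[of n z] r[of j] by (simp add: abs_mult mult_left_mono)
        qed simp
        then show "norm (\<integral>z. norm (r j ^ n * T n z) \<partial>circ2) \<le> r j ^ n * (2 * (2 * C)\<^sup>2) * (2 * pi)\<^sup>2"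
          using measure_circ2_UNIV by (simp add: space_pair_measure mult_ac)
      qed
    qed
    also have "(\<integral>z. (\<Sum>n. r j ^ n * T n z) \<partial>circ2) = (1 - (r j)\<^sup>2) * (\<integral>z. P j z \<partial>circ2)"
      using pw[THEN sums_unique, symmetric] by simp
    finally have "(\<lambda>n. r j ^ n * ((if n = 0 then 4 * pi * N else 0) - 4 * pi * A n)) sums ((1 - (r j)\<^sup>2) * (\<integral>z. P j z \<partial>circ2))"
      by (simp add: Tval)
    moreover have "(\<lambda>n. if n = 0 then 4 * pi * N else 0) sums (4 * pi * N)"
      using sums_single[of 0 "\<lambda>_. 4 * pi * N"] by simp
    ultimately have "(\<lambda>n. ((if n = 0 then 4 * pi * N else 0) - r j ^ n * ((if n = 0 then 4 * pi * N else 0) - 4 * pi * A n)) / (4 * pi))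
       sums ((4 * pi * N - (1 - (r j)\<^sup>2) * (\<integral>z. P j z \<partial>circ2)) / (4 * pi))"
      by (intro sums_divide sums_diff) auto
    moreover have "((if n = 0 then 4 * pi * N else 0) - r j ^ n * ((if n = 0 then 4 * pi * N else 0) - 4 * pi * A n)) / (4 * pi) = r j ^ n * A n" for n
      by (cases "n = 0") auto
    moreover have "(4 * pi * N - (1 - (r j)\<^sup>2) * (\<integral>z. P j z \<partial>circ2)) / (4 * pi) = N - (1 - r j) * G j"
      unfolding G_def by (simp add: field_simps power2_eq_square)
    ultimately show ?thesis by simp
  qed
  have dist_v: "cmod (1 - v z) = cmod (chr 1 (fst z) - chr 1 (snd z))" for z
  proof -
    have "chr 1 (snd z) * (1 - v z) = chr 1 (snd z) - chr 1 (fst z) * (chr 1 (snd z) * chr (-1) (snd z))"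
      by (simp add: v_def algebra_simps)
    also have "chr 1 (snd z) * chr (-1) (snd z) = 1" by (simp flip: chr_add)
    finally have "cmod (chr 1 (snd z) * (1 - v z)) = cmod (chr 1 (fst z) - chr 1 (snd z))"
      by (simp add: norm_minus_commute)
    then show ?thesis by (simp add: norm_mult)
  qed
  have P1nn: "(\<integral>\<^sup>+z. ennreal (P1 z) \<partial>circ2) = seminorm_sq w"
    unfolding seminorm_sq_circ2[OF assms(1)] P1_def dist_v F_def ..
  have P10: "0 \<le> P1 z" for z using F0 by (simp add: P1_def)
  have P1int: "integrable circ2 P1"
    by (rule integrableI_nonneg) (use P10 P1nn fin in auto)
  have P1val: "(\<integral>z. P1 z \<partial>circ2) = enn2real (seminorm_sq w)"
    by (subst integral_eq_nn_integral) (use P10 P1nn in auto)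
  (* On the unit circle \<bar>1 - v\<bar> \<le> 2 * \<bar>1 - r * v\<bar>, because 1 - r is the distance of r * v from the circle. *)
  have ker: "P j z \<le> 4 * P1 z" for j z
  proof (cases "v z = 1")
    case True
    then have "cmod (chr 1 (fst z) - chr 1 (snd z)) = 0" using dist_v[of z] by simp
    then have "fst z = snd z" using Pi_plus_chr_1 by (metis right_minus_eq norm_eq_zero)
    then show ?thesis by (simp add: P_def P1_def F_def)
  next
    case False
    have "v z * (1 - of_real (r j)) = (1 - of_real (r j) * v z) - (1 - v z)" by (simp add: algebra_simps)
    have "1 - r j \<le> cmod (1 - of_real (r j) * v z)"
      using norm_triangle_ineq2[of 1 "of_real (r j) * v z"] r[of j] v1[of z] by (simp add: norm_mult)
    moreover have "cmod (1 - v z) \<le> cmod (1 - of_real (r j) * v z) + cmod (v z * of_real (r j - 1))"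
      using norm_triangle_ineq[of "1 - of_real (r j) * v z" "v z * of_real (r j - 1)"] by (simp add: algebra_simps)
    moreover have "cmod (v z * of_real (r j - 1)) = 1 - r j"
      using r[of j] v1[of z] by (simp only: norm_mult norm_of_real) simp
    ultimately have le: "cmod (1 - v z) \<le> 2 * cmod (1 - of_real (r j) * v z)" by linarith
    have pos: "0 < cmod (1 - v z)" using False by simp
    have "(cmod (1 - v z))\<^sup>2 \<le> (2 * cmod (1 - of_real (r j) * v z))\<^sup>2"
      using le by (intro power_mono) auto
    then have "(cmod (1 - v z))\<^sup>2 / 4 \<le> (cmod (1 - of_real (r j) * v z))\<^sup>2"
      by (simp add: power_mult_distrib)
    then have "F z / (cmod (1 - of_real (r j) * v z))\<^sup>2 \<le> F z / ((cmod (1 - v z))\<^sup>2 / 4)"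
      using F0[of z] pos le by (intro divide_left_mono) (auto intro!: mult_pos_pos)
    then show ?thesis by (simp add: P_def P1_def mult.commute)
  qed
  have lim: "(\<lambda>j. \<integral>z. P j z \<partial>circ2) \<longlonglongrightarrow> (\<integral>z. P1 z \<partial>circ2)"
  proof (rule integral_dominated_convergence[where w = "\<lambda>z. 4 * P1 z"])
    show "AE z in circ2. (\<lambda>j. P j z) \<longlonglongrightarrow> P1 z"
    proof (rule AE_I2)
      fix z
      show "(\<lambda>j. P j z) \<longlonglongrightarrow> P1 z"
      proof (cases "v z = 1")
        case True
        then have "cmod (chr 1 (fst z) - chr 1 (snd z)) = 0" using dist_v[of z] by simp
        then have "fst z = snd z" using Pi_plus_chr_1 by (metis right_minus_eq norm_eq_zero)
        then show ?thesis by (simp add: P_def P1_def F_def)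
      next
        case False
        have "(\<lambda>j. F z / (cmod (1 - of_real (r j) * v z))\<^sup>2) \<longlonglongrightarrow> F z / (cmod (1 - of_real 1 * v z))\<^sup>2"
          by (intro tendsto_intros r1) (use False in auto)
        then show ?thesis by (simp add: P_def P1_def)
      qed
    qed
    have "0 \<le> P j z" for j z using F0 by (simp add: P_def)
    then show "AE z in circ2. norm (P j z) \<le> 4 * P1 z" for j using ker by auto
  qed (use P1int in auto)
  have G: "G \<longlonglongrightarrow> En w"
  proof -
    have "G \<longlonglongrightarrow> (1 + 1) / (4 * pi) * (\<integral>z. P1 z \<partial>circ2)"
      unfolding G_def by (intro tendsto_intros r1 lim) simp
    then show ?thesis by (simp add: P1val En_def)
  qed
  have G0: "0 \<le> G j" for j unfolding G_def using r F0
    by (intro mult_nonneg_nonneg integral_nonneg) (auto simp: P_def add_nonneg_nonneg)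
  from abel_energy[OF A0 r r1 G0 G S] have sums: "A sums N" "(\<lambda>n. real n * A n) sums En w" by auto
  show "((\<lambda>k. (cmod (coef w k))\<^sup>2) has_sum (\<integral>x. (cmod (w x))\<^sup>2 \<partial>circ)) UNIV"
    by (rule has_sum_int_from_nat) (use sums(1) in \<open>simp_all only: A_def[abs_def] N_def zero_le_power2\<close>)
  show "((\<lambda>k. of_int \<bar>k\<bar> * (cmod (coef w k))\<^sup>2) has_sum En w) UNIV"
  proof (rule has_sum_int_from_nat)
    have "real n * A n = (\<Sum>k\<in>{int n, - int n}. of_int \<bar>k\<bar> * (cmod (coef w k))\<^sup>2)" for n
      unfolding A_def sum_distrib_left by (rule sum.cong) auto
    then show "(\<lambda>n. \<Sum>k\<in>{int n, - int n}. of_int \<bar>k\<bar> * (cmod (coef w k))\<^sup>2) sums En w"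
      using sums(2) by simp
  qed simp
qed

section \<open>Sums over the integers\<close>

lemma filterlim_int_intervals:
  "filterlim (\<lambda>N. {- int N<..<int N}) (finite_subsets_at_top UNIV) sequentially"
  unfolding filterlim_finite_subsets_at_top
proof (intro allI impI)
  fix X :: "int set" assume X: "finite X \<and> X \<subseteq> UNIV"
  define B where "B = (\<Sum>k\<in>X. \<bar>k\<bar>)"
  have B: "\<bar>k\<bar> \<le> B" if "k \<in> X" for k
    unfolding B_def using X that by (intro member_le_sum) auto
  have "eventually (\<lambda>N. B < int N) sequentially"
    using eventually_gt_at_top[of "nat B"] by eventually_elim linarith
  then show "\<forall>\<^sub>F N in sequentially. finite {- int N<..<int N} \<and> X \<subseteq> {- int N<..<int N} \<and> {- int N<..<int N} \<subseteq> UNIV"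
    by eventually_elim (use B in force)
qed

lemma has_sum_int_intervals:
  fixes h :: "int \<Rightarrow> real"
  assumes "(h has_sum s) UNIV"
  shows "(\<lambda>N. \<Sum>k\<in>{- int N<..<int N}. h k) \<longlonglongrightarrow> s"
  using filterlim_compose[OF assms[unfolded has_sum_def] filterlim_int_intervals] .

text \<open>
  Kronecker's lemma: the indices with \<open>\<bar>k\<bar> < M\<close> contribute a fixed amount divided by \<open>N\<close>, and the
  others at most a tail of the convergent sum.
\<close>

lemma kronecker_int:
  fixes h :: "int \<Rightarrow> real"
  assumes h0: "\<And>k. 0 \<le> h k" and hs: "(h has_sum s) UNIV"
  shows "(\<lambda>N. (\<Sum>k\<in>{- int N<..<int N}. of_int \<bar>k\<bar> * h k) / real N) \<longlonglongrightarrow> 0"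
proof (rule LIMSEQ_I)
  fix e :: real assume e: "0 < e"
  have part: "sum h F \<le> s" if "finite F" for F
    using has_sum_mono2[OF has_sum_finite[OF that] hs, of ] h0 by auto
  have "eventually (\<lambda>N. dist (\<Sum>k\<in>{- int N<..<int N}. h k) s < e / 2) sequentially"
    using has_sum_int_intervals[OF hs] e by (intro tendstoD) auto
  then obtain M where M: "dist (\<Sum>k\<in>{- int M<..<int M}. h k) s < e / 2"
    by (auto simp: eventually_sequentially)
  let ?F = "{- int M<..<int M}"
  define B where "B = (\<Sum>k\<in>?F. of_int \<bar>k\<bar> * h k)"
  have B0: "0 \<le> B" unfolding B_def by (intro sum_nonneg) (auto simp: h0)
  obtain N0 :: nat where N0: "real N0 > 2 * B / e" using reals_Archimedean2 by blast
  show "\<exists>no. \<forall>N\<ge>no. norm ((\<Sum>k\<in>{- int N<..<int N}. of_int \<bar>k\<bar> * h k) / real N - 0) < e"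
  proof (intro exI[of _ "Suc N0"] allI impI)
    fix N assume N: "N \<ge> Suc N0"
    let ?K = "{- int N<..<int N}"
    have Npos: "real N > 0" using N by simp
    have "B / real N < e / 2"
    proof -
      have "2 * B / e < real N" using N0 N by linarith
      then show ?thesis using e Npos by (simp add: field_simps)
    qed
    moreover have "sum h (?K - ?F) < e / 2"
    proof -
      have "sum h (?K - ?F) + sum h ?F = sum h (?K \<union> ?F)"
        by (subst sum.union_disjoint[symmetric]) (auto simp: Un_commute)
      moreover have "s - sum h ?F < e / 2" using M abs_ge_minus_self[of "sum h ?F - s"] unfolding dist_real_def by linarith
      ultimately show ?thesis using part[of "?K \<union> ?F"] by simp
    qed
    moreover have "(\<Sum>k\<in>?K. of_int \<bar>k\<bar> * h k) / real N \<le> B / real N + sum h (?K - ?F)"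
    proof -
      have "(\<Sum>k\<in>?K. of_int \<bar>k\<bar> * h k) = (\<Sum>k\<in>?K \<inter> ?F. of_int \<bar>k\<bar> * h k) + (\<Sum>k\<in>?K - ?F. of_int \<bar>k\<bar> * h k)"
        by (subst sum.union_disjoint[symmetric]) (auto intro: sum.cong)
      also have "(\<Sum>k\<in>?K \<inter> ?F. of_int \<bar>k\<bar> * h k) \<le> B"
        unfolding B_def by (intro sum_mono2) (auto simp: h0)
      also have "(\<Sum>k\<in>?K - ?F. of_int \<bar>k\<bar> * h k) \<le> (\<Sum>k\<in>?K - ?F. real N * h k)"
        by (intro sum_mono mult_right_mono h0) auto
      finally have "(\<Sum>k\<in>?K. of_int \<bar>k\<bar> * h k) \<le> B + real N * sum h (?K - ?F)"
        by (simp add: sum_distrib_left)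
      then show ?thesis using Npos by (simp add: field_simps)
    qed
    moreover have "0 \<le> (\<Sum>k\<in>?K. of_int \<bar>k\<bar> * h k)" by (intro sum_nonneg) (auto simp: h0)
    ultimately have "(\<Sum>k\<in>?K. of_int \<bar>k\<bar> * h k) / real N < e" "0 \<le> (\<Sum>k\<in>?K. of_int \<bar>k\<bar> * h k) / real N"
      by (linarith, intro divide_nonneg_nonneg) auto
    then show "norm ((\<Sum>k\<in>?K. of_int \<bar>k\<bar> * h k) / real N - 0) < e" by simp
  qed
qed

text \<open>
  Each difference \<open>k\<close> arises from \<open>N - \<bar>k\<bar>\<close> pairs of indices.
\<close>

lemma double_sum_diff:
  fixes \<phi> :: "int \<Rightarrow> complex"
  shows "(\<Sum>j<N. \<Sum>l<N. \<phi> (int j - int l)) = (\<Sum>k\<in>{- int N<..<int N}. of_int (int N - \<bar>k\<bar>) * \<phi> k)"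
proof (induction N)
  case (Suc N)
  have "(\<Sum>j<Suc N. \<Sum>l<Suc N. \<phi> (int j - int l))
     = (\<Sum>j<N. \<Sum>l<N. \<phi> (int j - int l)) + ((\<Sum>j<N. \<phi> (int j - int N)) + \<phi> 0 + (\<Sum>l<N. \<phi> (int N - int l)))"
    by (simp add: sum.distrib)
  also have "(\<Sum>j<N. \<phi> (int j - int N)) = (\<Sum>k\<in>{- int N..<0}. \<phi> k)"
    by (rule sum.reindex_bij_witness[of _ "\<lambda>k. nat (k + int N)" "\<lambda>j. int j - int N"]) auto
  also have "(\<Sum>l<N. \<phi> (int N - int l)) = (\<Sum>k\<in>{0<..int N}. \<phi> k)"
    by (rule sum.reindex_bij_witness[of _ "\<lambda>k. nat (int N - k)" "\<lambda>l. int N - int l"]) auto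
  also have "(\<Sum>k\<in>{- int N..<0}. \<phi> k) + \<phi> 0 + (\<Sum>k\<in>{0<..int N}. \<phi> k) = (\<Sum>k\<in>{- int N..int N}. \<phi> k)"
  proof -
    have "{- int N..int N} = {- int N..<0} \<union> {0} \<union> {0<..int N}" by auto
    then show ?thesis by (simp only:) (subst sum.union_disjoint, auto)+
  qed
  also have "(\<Sum>j<N. \<Sum>l<N. \<phi> (int j - int l)) = (\<Sum>k\<in>{- int N..int N}. of_int (int N - \<bar>k\<bar>) * \<phi> k)"
    unfolding Suc.IH by (rule sum.mono_neutral_left) auto
  also have "\<dots> + (\<Sum>k\<in>{- int N..int N}. \<phi> k) = (\<Sum>k\<in>{- int N..int N}. of_int (int (Suc N) - \<bar>k\<bar>) * \<phi> k)"
    by (simp add: sum.distrib[symmetric] algebra_simps)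
  also have "{- int N..int N} = {- int (Suc N)<..<int (Suc N)}" by auto
  finally show ?case .
qed simp

section \<open>Trigonometric polynomials and winding numbers\<close>

lemma integral_cis_HK: "integral {0..2 * pi} (\<lambda>\<theta>. cis (of_int k * \<theta>)) = (if k = 0 then of_real (2 * pi) else 0)"
proof -
  have "set_integrable lborel {0..2 * pi} (\<lambda>\<theta>. cis (of_int k * \<theta>))"
    by (rule borel_integrable_atLeastAtMost') (intro continuous_intros)
  from set_borel_integral_eq_integral(2)[OF this] show ?thesis
    using integral_cis[of k] by (simp add: set_lebesgue_integral_def)
qed

definition trig_poly :: "int set \<Rightarrow> (int \<Rightarrow> complex) \<Rightarrow> real \<Rightarrow> complex" where
  "trig_poly K c \<theta> = (\<Sum>k\<in>K. c k * cis (of_int k * \<theta>))"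

lemma continuous_on_trig_poly: "continuous_on A (trig_poly K c)"
  unfolding trig_poly_def by (intro continuous_intros)

lemma trig_poly_inner:
  assumes "finite K"
  shows "integral {0..2 * pi} (\<lambda>\<theta>. cnj (trig_poly K c \<theta>) * trig_poly K d \<theta>) = of_real (2 * pi) * (\<Sum>k\<in>K. cnj (c k) * d k)"
proof -
  have e: "cnj (trig_poly K c \<theta>) * trig_poly K d \<theta> = (\<Sum>k\<in>K. \<Sum>l\<in>K. (cnj (c k) * d l) * cis (of_int (l - k) * \<theta>))" for \<theta>
    unfolding trig_poly_def cnj_sum sum_product
    by (intro sum.cong refl) (simp add: cis_cnj cis_mult algebra_simps)
  have i: "(\<lambda>\<theta>. (cnj (c k) * d l) * cis (of_int (l - k) * \<theta>)) integrable_on {0..2*pi}" for k l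
    by (intro integrable_continuous_interval continuous_intros)
  have "integral {0..2 * pi} (\<lambda>\<theta>. cnj (trig_poly K c \<theta>) * trig_poly K d \<theta>)
     = (\<Sum>k\<in>K. \<Sum>l\<in>K. (cnj (c k) * d l) * integral {0..2*pi} (\<lambda>\<theta>. cis (of_int (l - k) * \<theta>)))"
    unfolding e
    by (subst integral_sum[OF assms], intro integrable_sum assms i, intro sum.cong refl,
        subst integral_sum[OF assms], rule i, intro sum.cong refl, rule Henstock_Kurzweil_Integration.integral_mult_right)
  also have "\<dots> = (\<Sum>k\<in>K. \<Sum>l\<in>K. if k = l then of_real (2 * pi) * (cnj (c k) * d l) else 0)"
    unfolding integral_cis_HK by (intro sum.cong refl) auto
  also have "\<dots> = of_real (2 * pi) * (\<Sum>k\<in>K. cnj (c k) * d k)"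
    using assms by (simp add: sum.delta sum_distrib_left)
  finally show ?thesis .
qed

lemma cmod_sq_cnj: "complex_of_real ((cmod z)\<^sup>2) = cnj z * z"
  by (metis complex_norm_square mult.commute of_real_power)

lemma trig_poly_norm_sq:
  assumes "finite K"
  shows "integral {0..2 * pi} (\<lambda>\<theta>. (cmod (trig_poly K c \<theta>))\<^sup>2) = 2 * pi * (\<Sum>k\<in>K. (cmod (c k))\<^sup>2)"
proof -
  have "complex_of_real (integral {0..2 * pi} (\<lambda>\<theta>. (cmod (trig_poly K c \<theta>))\<^sup>2))
     = integral {0..2 * pi} (\<lambda>\<theta>. complex_of_real ((cmod (trig_poly K c \<theta>))\<^sup>2))"
  proof -
    have "(\<lambda>\<theta>. (cmod (trig_poly K c \<theta>))\<^sup>2) integrable_on {0..2 * pi}"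
      by (intro integrable_continuous_interval continuous_intros continuous_on_trig_poly)
    then show ?thesis by (rule integral_linear[OF _ bounded_linear_of_real, unfolded o_def, symmetric])
  qed
  also have "\<dots> = integral {0..2 * pi} (\<lambda>\<theta>. cnj (trig_poly K c \<theta>) * trig_poly K c \<theta>)"
    by (simp only: cmod_sq_cnj)
  also have "\<dots> = of_real (2 * pi * (\<Sum>k\<in>K. (cmod (c k))\<^sup>2))"
    unfolding trig_poly_inner[OF assms] by (simp only: of_real_mult of_real_sum cmod_sq_cnj)
  finally show ?thesis by (simp only: of_real_eq_iff)
qed

lemma trig_poly_deriv: "(trig_poly K c has_vector_derivative trig_poly K (\<lambda>k. \<i> * of_int k * c k) \<theta>) (at \<theta> within S)"
proof -
  have d: "((\<lambda>\<theta>. cis (of_int k * \<theta>)) has_vector_derivative \<i> * of_int k * cis (of_int k * \<theta>)) (at \<theta> within S)" for k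
  proof -
    have "((\<lambda>z. exp (\<i> * (of_int k * z))) has_field_derivative \<i> * of_int k * exp (\<i> * (of_int k * of_real \<theta>))) (at (of_real \<theta>))"
      by (auto intro!: derivative_eq_intros)
    from has_vector_derivative_real_field[OF this, of S] show ?thesis by (simp add: cis_conv_exp)
  qed
  have "((\<lambda>\<theta>. c k * cis (of_int k * \<theta>)) has_vector_derivative \<i> * of_int k * c k * cis (of_int k * \<theta>)) (at \<theta> within S)" for k
    using has_vector_derivative_mult_right[OF d, of "c k" k] by (simp add: mult_ac)
  then show ?thesis unfolding trig_poly_def by (intro has_vector_derivative_sum)
qed

text \<open>
  The product of \<open>T\<close> and \<open>exp (- \<integral> T' / T)\<close> has derivative zero, so periodicity of \<open>T\<close> makes the
  exponential of the full integral equal to 1.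
\<close>

lemma winding_integer:
  fixes T T' :: "real \<Rightarrow> complex"
  assumes d: "\<And>\<theta>. (T has_vector_derivative T' \<theta>) (at \<theta> within {0..2 * pi})"
    and c: "continuous_on {0..2 * pi} T'" and per: "T (2 * pi) = T 0"
    and nz: "\<And>\<theta>. \<theta> \<in> {0..2 * pi} \<Longrightarrow> T \<theta> \<noteq> 0"
  shows "\<exists>n::int. integral {0..2 * pi} (\<lambda>\<theta>. T' \<theta> / T \<theta>) = 2 * of_real pi * \<i> * of_int n"
proof -
  let ?q = "\<lambda>\<theta>. T' \<theta> / T \<theta>"
  define L where "L \<theta> = integral {0..\<theta>} ?q" for \<theta>
  have cT: "continuous_on {0..2*pi} T"
    using d by (meson continuous_on_eq_continuous_within has_vector_derivative_continuous)
  have cq: "continuous_on {0..2*pi} ?q" using c cT nz by (intro continuous_intros) auto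
  have L: "(L has_vector_derivative ?q \<theta>) (at \<theta> within {0..2*pi})" if "\<theta> \<in> {0..2*pi}" for \<theta>
    unfolding L_def by (rule integral_has_vector_derivative[OF cq that])
  have eL: "((\<lambda>\<theta>. exp (- L \<theta>)) has_vector_derivative - ?q \<theta> * exp (- L \<theta>)) (at \<theta> within {0..2*pi})"
    if "\<theta> \<in> {0..2*pi}" for \<theta>
    using field_vector_diff_chain_within[OF has_vector_derivative_minus[OF L[OF that]], of exp "exp (- L \<theta>)"]
    by (simp add: o_def DERIV_exp has_field_derivative_at_within)
  have G: "((\<lambda>\<theta>. T \<theta> * exp (- L \<theta>)) has_vector_derivative 0) (at \<theta> within {0..2*pi})"
    if "\<theta> \<in> {0..2*pi}" for \<theta>
  proof -
    have "T \<theta> * (- ?q \<theta> * exp (- L \<theta>)) + T' \<theta> * exp (- L \<theta>) = 0" using nz[OF that] by simp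
    with has_vector_derivative_mult[OF d eL[OF that]] show ?thesis by simp
  qed
  have "\<exists>c. \<forall>\<theta>\<in>{0..2*pi}. T \<theta> * exp (- L \<theta>) = c"
    by (intro has_derivative_zero_constant) (use G in \<open>auto simp: has_vector_derivative_def\<close>)
  then have "T (2 * pi) * exp (- L (2 * pi)) = T 0 * exp (- L 0)" by (metis atLeastAtMost_iff order_refl pi_ge_zero mult_nonneg_nonneg zero_le_numeral)
  then have "exp (- L (2 * pi)) = 1" using per nz[of 0] by (simp add: L_def)
  then have "exp (L (2 * pi)) = 1" by (simp add: exp_minus)
  then obtain n :: int where "Re (L (2 * pi)) = 0" "Im (L (2 * pi)) = of_int (2 * n) * pi"
    using exp_eq_1 by auto
  then have "L (2 * pi) = 2 * of_real pi * \<i> * of_int n" by (simp add: complex_eq_iff)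
  then show ?thesis unfolding L_def by blast
qed

section \<open>Fejer means of unimodular maps\<close>

text \<open>
  The Fejer kernel of order \<open>N\<close> centred at the point of angle \<open>\<theta>\<close>, in the stereographic coordinate.
\<close>

definition fejer :: "nat \<Rightarrow> real \<Rightarrow> real \<Rightarrow> real" where
  "fejer N \<theta> y = (cmod (\<Sum>j<N. cis (real j * \<theta>) * chr (- int j) y))\<^sup>2 / real N"

lemma fejer_measurable [measurable]: "fejer N \<theta> \<in> borel_measurable borel"
  unfolding fejer_def[abs_def] by measurable

lemma fejer_nonneg: "0 \<le> fejer N \<theta> y"
  by (simp add: fejer_def)

lemma fejer_le: "fejer N \<theta> y \<le> real N"
proof (cases "N = 0")
  case False
  have "cmod (\<Sum>j<N. cis (real j * \<theta>) * chr (- int j) y) \<le> (\<Sum>j<N. 1)"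
    by (rule order_trans[OF norm_sum]) (simp add: norm_mult)
  then have "(cmod (\<Sum>j<N. cis (real j * \<theta>) * chr (- int j) y))\<^sup>2 \<le> (real N)\<^sup>2"
    by (intro power_mono) auto
  then show ?thesis using False by (simp add: fejer_def power2_eq_square divide_simps)
qed (simp add: fejer_def)

lemma fejer_away: "N > 0 \<Longrightarrow> fejer N \<theta> y * (cmod (cis \<theta> - chr 1 y))\<^sup>2 \<le> 4 / real N"
proof -
  assume N: "N > 0"
  let ?q = "cis \<theta> * chr (- 1) y"
  have q1: "cmod ?q = 1" by (simp add: norm_mult)
  have S: "(\<Sum>j<N. cis (real j * \<theta>) * chr (- int j) y) = (\<Sum>j<N. ?q ^ j)"
    by (intro sum.cong refl) (simp add: power_mult_distrib chr_1_power Complex.DeMoivre)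
  have "chr 1 y * (1 - ?q) = chr 1 y - cis \<theta> * (chr 1 y * chr (-1) y)" by (simp add: algebra_simps)
  also have "chr 1 y * chr (-1) y = 1" by (simp flip: chr_add)
  finally have "cmod (chr 1 y * (1 - ?q)) = cmod (cis \<theta> - chr 1 y)" by (simp add: norm_minus_commute)
  then have d: "cmod (1 - ?q) = cmod (cis \<theta> - chr 1 y)" by (simp add: norm_mult)
  have "(1 - ?q) * (\<Sum>j<N. ?q ^ j) = 1 - ?q ^ N" by (rule one_diff_power_eq[symmetric])
  then have "cmod (1 - ?q) * cmod (\<Sum>j<N. ?q ^ j) = cmod (1 - ?q ^ N)" by (metis norm_mult)
  also have "\<dots> \<le> 2" using norm_triangle_ineq4[of 1 "?q ^ N"] q1 by (simp add: norm_power)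
  finally have "(cmod (1 - ?q) * cmod (\<Sum>j<N. ?q ^ j))\<^sup>2 \<le> 2\<^sup>2" by (intro power_mono) auto
  then have "(cmod (\<Sum>j<N. ?q ^ j))\<^sup>2 * (cmod (cis \<theta> - chr 1 y))\<^sup>2 \<le> 4"
    unfolding d by (simp add: power_mult_distrib mult.commute)
  then show ?thesis using N unfolding fejer_def S by (simp add: divide_simps)
qed

lemma fejer_expand:
  assumes "N > 0"
  shows "complex_of_real (fejer N \<theta> y)
    = (\<Sum>k\<in>{- int N<..<int N}. of_real (1 - \<bar>of_int k\<bar> / real N) * (cis (of_int k * \<theta>) * chr (- k) y))"
proof -
  have "complex_of_real (fejer N \<theta> y)
     = (\<Sum>j<N. cis (real j * \<theta>) * chr (- int j) y) * cnj (\<Sum>j<N. cis (real j * \<theta>) * chr (- int j) y) / of_nat N"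
    unfolding fejer_def of_real_divide cmod_sq_cnj of_real_of_nat_eq by (simp only: mult.commute)
  also have "\<dots> = (\<Sum>j<N. \<Sum>l<N. cis (of_int (int j - int l) * \<theta>) * chr (- (int j - int l)) y) / of_nat N"
  proof -
    have "cis (real j * \<theta>) * chr (- int j) y * cnj (cis (real l * \<theta>) * chr (- int l) y)
       = cis (of_int (int j - int l) * \<theta>) * chr (- (int j - int l)) y" for j l :: nat
    proof -
      have "cis (real j * \<theta>) * chr (- int j) y * cnj (cis (real l * \<theta>) * chr (- int l) y)
         = (cis (real j * \<theta>) * cis (- (real l * \<theta>))) * (chr (- int j) y * chr (int l) y)"
        by (simp add: cis_cnj)
      also have "\<dots> = cis (real j * \<theta> + - (real l * \<theta>)) * chr (- int j + int l) y"
        by (simp only: cis_mult chr_add)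
      finally show ?thesis by (simp add: algebra_simps)
    qed
    then show ?thesis unfolding cnj_sum sum_product by simp
  qed
  also have "\<dots> = (\<Sum>k\<in>{- int N<..<int N}. of_int (int N - \<bar>k\<bar>) * (cis (of_int k * \<theta>) * chr (- k) y)) / of_nat N"
    using double_sum_diff[of "\<lambda>k. cis (of_int k * \<theta>) * chr (- k) y" N] by simp
  also have "\<dots> = (\<Sum>k\<in>{- int N<..<int N}. of_real (1 - \<bar>of_int k\<bar> / real N) * (cis (of_int k * \<theta>) * chr (- k) y))"
  proof -
    have "complex_of_real \<bar>real_of_int x\<bar> = of_int \<bar>x\<bar>" for x by (metis of_int_abs of_real_of_int_eq)
    then show ?thesis
      unfolding sum_divide_distrib using assms by (intro sum.cong refl) (simp add: field_simps)
  qed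
  finally show ?thesis .
qed

text \<open>
  The coefficients of the Fejer mean of \<open>u\<close>; the factor \<open>1 / sqrt (2 * \<pi>)\<close> undoes the normalisation
  of \<open>coef\<close>.
\<close>

definition fejer_coef :: "(real \<Rightarrow> complex) \<Rightarrow> nat \<Rightarrow> int \<Rightarrow> complex" where
  "fejer_coef u N k = of_real ((1 - \<bar>of_int k\<bar> / real N) / sqrt (2 * pi)) * coef u k"

lemma fejer_mean:
  assumes [measurable]: "u \<in> borel_measurable borel" and b: "\<And>x. cmod (u x) \<le> C" and N: "N > 0"
  shows "(\<integral>y. u y * of_real (fejer N \<theta> y) \<partial>circ) = of_real (2 * pi) * trig_poly {- int N<..<int N} (fejer_coef u N) \<theta>"
proof -
  have i: "integrable circ (\<lambda>y. u y * chr (- k) y)" for k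
    by (rule integrable_circ_bounded[where B = C]) (use b in \<open>auto simp: norm_mult\<close>)
  have "(\<integral>y. u y * of_real (fejer N \<theta> y) \<partial>circ)
     = (\<integral>y. (\<Sum>k\<in>{- int N<..<int N}. (of_real (1 - \<bar>of_int k\<bar> / real N) * cis (of_int k * \<theta>)) * (u y * chr (- k) y)) \<partial>circ)"
    unfolding fejer_expand[OF N] by (simp add: sum_distrib_left mult_ac)
  also have "\<dots> = (\<Sum>k\<in>{- int N<..<int N}. (of_real (1 - \<bar>of_int k\<bar> / real N) * cis (of_int k * \<theta>)) * (\<integral>y. u y * chr (- k) y \<partial>circ))"
    by (subst Bochner_Integration.integral_sum) (use i in auto)
  also have "\<dots> = of_real (2 * pi) * trig_poly {- int N<..<int N} (fejer_coef u N) \<theta>"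
  proof -
    have s: "complex_of_real (sqrt (2 * pi)) = of_real (2 * pi) * of_real (1 / sqrt (2 * pi))"
      by (simp only: of_real_mult[symmetric] of_real_eq_iff) (simp add: field_simps)
    show ?thesis unfolding coef_integral trig_poly_def fejer_coef_def sum_distrib_left s
      by (intro sum.cong refl) (simp only: of_real_divide of_real_mult of_real_1 mult_ac, simp add: field_simps)
  qed
  finally show ?thesis .
qed

lemma fejer_mass: assumes "N > 0" shows "(\<integral>y. fejer N \<theta> y \<partial>circ) = 2 * pi"
proof -
  have "complex_of_real (\<integral>y. fejer N \<theta> y \<partial>circ) = (\<integral>y. of_real (fejer N \<theta> y) \<partial>circ)"
    by (rule integral_complex_of_real[symmetric])
  also have "\<dots> = (\<Sum>k\<in>{- int N<..<int N}. of_real (1 - \<bar>of_int k\<bar> / real N) * cis (of_int k * \<theta>) * (\<integral>y. chr (- k) y \<partial>circ))"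
  proof -
    have i: "integrable circ (\<lambda>y. chr (- k) y)" for k
      by (rule integrable_circ_bounded[where B = 1]) auto
    show ?thesis unfolding fejer_expand[OF assms]
      by (subst Bochner_Integration.integral_sum) (use i in \<open>auto simp: mult.assoc[symmetric]\<close>)
  qed
  also have "\<dots> = (\<Sum>k\<in>{- int N<..<int N}. if k = 0 then of_real (2 * pi) else 0)"
    unfolding integral_chr by (intro sum.cong refl) auto
  also have "\<dots> = of_real (2 * pi)" using assms by simp
  finally show ?thesis by (simp only: of_real_eq_iff)
qed

lemma S1_map_measurable: "S1_map u \<Longrightarrow> u \<in> borel_measurable borel"
  and S1_map_cmod: "S1_map u \<Longrightarrow> cmod (u x) = 1"
  and S1_map_fin: "S1_map u \<Longrightarrow> seminorm_sq u < \<infinity>"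
  by (auto simp: S1_map_def)

text \<open>
  Averaging unimodular numbers \<open>u y\<close> against a probability density gives a number whose squared modulus
  misses 1 by half the mean of \<open>\<bar>u y - u z\<bar>\<^sup>2\<close>.
\<close>

lemma fejer_modulus:
  assumes u: "S1_map u" and N: "N > 0"
  shows "1 - (cmod (trig_poly {- int N<..<int N} (fejer_coef u N) \<theta>))\<^sup>2
    = (\<integral>z. fejer N \<theta> (fst z) * fejer N \<theta> (snd z) * (cmod (u (fst z) - u (snd z)))\<^sup>2 \<partial>circ2) / (8 * pi\<^sup>2)"
proof -
  note [measurable] = S1_map_measurable[OF u]
  let ?k = "fejer N \<theta>"
  have kb: "norm (?k y) \<le> real N" for y using fejer_le fejer_nonneg by simp
  define t where "t = trig_poly {- int N<..<int N} (fejer_coef u N) \<theta>"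
  have i1: "integrable circ2 (\<lambda>z. complex_of_real (?k (fst z)) * complex_of_real (?k (snd z)))"
    by (rule integrable_circ2_bounded[where B = "real N * real N"])
      (use kb in \<open>auto simp: norm_mult intro!: mult_mono\<close>)
  have i2: "integrable circ2 (\<lambda>z. (u (fst z) * complex_of_real (?k (fst z))) * (cnj (u (snd z)) * complex_of_real (?k (snd z))))"
    by (rule integrable_circ2_bounded[where B = "real N * real N"])
      (use kb S1_map_cmod[OF u] in \<open>auto simp: norm_mult intro!: mult_mono\<close>)
  have i3: "integrable circ2 (\<lambda>z. (cnj (u (fst z)) * complex_of_real (?k (fst z))) * (u (snd z) * complex_of_real (?k (snd z))))"
    by (rule integrable_circ2_bounded[where B = "real N * real N"])
      (use kb S1_map_cmod[OF u] in \<open>auto simp: norm_mult intro!: mult_mono\<close>)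
  have e1: "(\<integral>z. complex_of_real (?k (fst z)) * complex_of_real (?k (snd z)) \<partial>circ2) = of_real (2 * pi) * of_real (2 * pi)"
    by (subst integral_circ2_prod[where B = "real N" and C = "real N"])
      (use kb in \<open>auto simp: fejer_mass[OF N]\<close>)
  have m: "(\<integral>y. u y * of_real (?k y) \<partial>circ) = of_real (2 * pi) * t"
    unfolding t_def by (rule fejer_mean[where C = 1]) (use u N in \<open>auto simp: S1_map_def\<close>)
  have "(\<integral>y. cnj (u y) * of_real (?k y) \<partial>circ) = (\<integral>y. cnj (u y * of_real (?k y)) \<partial>circ)" by simp
  also have "\<dots> = cnj (of_real (2 * pi) * t)"
    by (simp only: Bochner_Integration.integral_cnj m)
  finally have m': "(\<integral>y. cnj (u y) * of_real (?k y) \<partial>circ) = of_real (2 * pi) * cnj t" by simp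
  have e2: "(\<integral>z. (u (fst z) * complex_of_real (?k (fst z))) * (cnj (u (snd z)) * complex_of_real (?k (snd z))) \<partial>circ2)
     = of_real (2 * pi) * t * (of_real (2 * pi) * cnj t)"
    by (subst integral_circ2_prod[where B = "real N" and C = "real N"])
      (use kb S1_map_cmod[OF u] in \<open>auto simp: norm_mult m m'\<close>)
  have e3: "(\<integral>z. (cnj (u (fst z)) * complex_of_real (?k (fst z))) * (u (snd z) * complex_of_real (?k (snd z))) \<partial>circ2)
     = of_real (2 * pi) * cnj t * (of_real (2 * pi) * t)"
    by (subst integral_circ2_prod[where B = "real N" and C = "real N"])
      (use kb S1_map_cmod[OF u] in \<open>auto simp: norm_mult m m'\<close>)
  have pt: "complex_of_real (?k (fst z) * ?k (snd z) * (cmod (u (fst z) - u (snd z)))\<^sup>2)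
     = 2 * (complex_of_real (?k (fst z)) * complex_of_real (?k (snd z)))
       - (u (fst z) * complex_of_real (?k (fst z))) * (cnj (u (snd z)) * complex_of_real (?k (snd z)))
       - (cnj (u (fst z)) * complex_of_real (?k (fst z))) * (u (snd z) * complex_of_real (?k (snd z)))" for z
    unfolding of_real_mult cmod_diff_sq S1_map_cmod[OF u] by (simp add: algebra_simps)
  have "complex_of_real (\<integral>z. ?k (fst z) * ?k (snd z) * (cmod (u (fst z) - u (snd z)))\<^sup>2 \<partial>circ2)
     = 2 * (of_real (2 * pi) * of_real (2 * pi)) - of_real (2 * pi) * t * (of_real (2 * pi) * cnj t) - of_real (2 * pi) * cnj t * (of_real (2 * pi) * t)"
    unfolding integral_complex_of_real[symmetric] pt
    using i1 i2 i3 by (simp only: Bochner_Integration.integral_diff Bochner_Integration.integrable_diff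
       integrable_mult_right Bochner_Integration.integral_mult_right_zero e1 e2 e3)
  also have "\<dots> = of_real (8 * pi\<^sup>2 * (1 - (cmod t)\<^sup>2))"
    unfolding of_real_mult of_real_diff cmod_sq_cnj
    by (simp add: power2_eq_square algebra_simps)
  finally show ?thesis unfolding t_def[symmetric] by (simp only: of_real_eq_iff) (simp add: field_simps)
qed

text \<open>
  A map of finite energy has vanishing mean oscillation, so its Fejer means stay away from zero
  uniformly in the angle. Pairs at chordal distance below \<open>\<delta>\<close> contribute at most 16 times the seminorm
  integral over that strip, because the product of the two kernels and the squared distance is at most
  16; this integral is small for small \<open>\<delta>\<close>. For the other pairs one of the two points is at distance at least
  \<open>\<delta> / 2\<close> from the centre, where the kernel is of order \<open>1 / N\<close>.
\<close>

lemma fejer_modulus_uniform: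
  assumes u: "S1_map u"
  shows "eventually (\<lambda>N. \<forall>\<theta>. 1 - (cmod (trig_poly {- int N<..<int N} (fejer_coef u N) \<theta>))\<^sup>2 < 1 / 2) sequentially"
proof -
  note [measurable] = S1_map_measurable[OF u]
  define d where "d z = cmod (chr 1 (fst z) - chr 1 (snd z))" for z :: "real \<times> real"
  define H where "H z = (cmod (u (fst z) - u (snd z)))\<^sup>2 / (d z)\<^sup>2" for z :: "real \<times> real"
  have [measurable]: "d \<in> borel_measurable (borel \<Otimes>\<^sub>M borel)" unfolding d_def by measurable
  have [measurable]: "H \<in> borel_measurable (borel \<Otimes>\<^sub>M borel)" unfolding H_def by measurable
  have H0: "0 \<le> H z" for z by (simp add: H_def)
  have Hint: "integrable circ2 H"
    by (rule integrableI_nonneg)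
      (use H0 S1_map_fin[OF u] seminorm_sq_circ2[OF S1_map_measurable[OF u]] in \<open>auto simp: H_def d_def\<close>)
  have "(\<lambda>j. \<integral>z. indicator {z. d z < 1 / (real j + 1)} z * H z \<partial>circ2) \<longlonglongrightarrow> (\<integral>z. 0 \<partial>circ2)"
  proof (rule integral_dominated_convergence[where w = H])
    show "AE z in circ2. (\<lambda>j. indicator {z. d z < 1 / (real j + 1)} z * H z) \<longlonglongrightarrow> 0"
    proof (rule AE_I2)
      fix z
      show "(\<lambda>j. indicator {z. d z < 1 / (real j + 1)} z * H z) \<longlonglongrightarrow> 0"
      proof (cases "d z = 0")
        case True then show ?thesis by (simp add: H_def)
      next
        case False
        then have "0 < d z" by (simp add: d_def)
        moreover have "(\<lambda>j. 1 / (real j + 1)) \<longlonglongrightarrow> 0" by real_asymp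
        ultimately have "eventually (\<lambda>j. 1 / (real j + 1) < d z) sequentially" by (rule order_tendstoD(2)[rotated])
        then have "eventually (\<lambda>j. indicator {z. d z < 1 / (real j + 1)} z * H z = 0) sequentially"
          by eventually_elim (auto simp: indicator_def)
        then show ?thesis by (simp add: tendsto_eventually)
      qed
    qed
    show "AE z in circ2. norm (indicator {z. d z < 1 / (real j + 1)} z * H z) \<le> H z" for j
      using H0 by (auto simp: indicator_def)
  qed (use Hint in auto)
  then have "(\<lambda>j. \<integral>z. indicator {z. d z < 1 / (real j + 1)} z * H z \<partial>circ2) \<longlonglongrightarrow> 0" by simp
  (* The threshold 1/16 leaves 2 * I + c < 1/8 + 1/4 in the final estimate. *)
  then have "eventually (\<lambda>j. (\<integral>z. indicator {z. d z < 1 / (real j + 1)} z * H z \<partial>circ2) < 1 / 16) sequentially"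
    by (rule order_tendstoD(2)) simp
  then obtain j where j: "(\<integral>z. indicator {z. d z < 1 / (real j + 1)} z * H z \<partial>circ2) < 1 / 16"
    by (auto simp: eventually_sequentially)
  define \<delta> where "\<delta> = 1 / (real j + 1)"
  have \<delta>: "0 < \<delta>" by (simp add: \<delta>_def)
  define I where "I = (\<integral>z. indicator {z. d z < \<delta>} z * H z \<partial>circ2)"
  have I: "I < 1 / 16" using j by (simp add: I_def \<delta>_def)
  have "(\<lambda>N. 64 / (real N * \<delta>\<^sup>2)) \<longlonglongrightarrow> 0"
    using \<delta> by real_asymp
  then have "eventually (\<lambda>N. 64 / (real N * \<delta>\<^sup>2) < 1 / 4) sequentially"
    by (rule order_tendstoD(2)) simp
  then show ?thesis using eventually_gt_at_top[of 0]
  proof eventually_elim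
    case (elim N)
    then have N: "N > 0" by simp
    show ?case
    proof
      fix \<theta>
      let ?k = "fejer N \<theta>"
      define c where "c = 64 / (real N * \<delta>\<^sup>2)"
      have kb: "norm (?k y) \<le> real N" for y using fejer_le fejer_nonneg by simp
      have pt: "?k (fst z) * ?k (snd z) * (cmod (u (fst z) - u (snd z)))\<^sup>2
          \<le> 16 * (indicator {z. d z < \<delta>} z * H z) + c * (?k (fst z) + ?k (snd z))" for z
      proof -
        define a b k l where "a = cmod (cis \<theta> - chr 1 (fst z))" and "b = cmod (cis \<theta> - chr 1 (snd z))"
          and "k = ?k (fst z)" and "l = ?k (snd z)"
        have kl: "0 \<le> k" "0 \<le> l" "k \<le> real N" "l \<le> real N" using fejer_nonneg fejer_le by (auto simp: k_def l_def)
        have ka: "k * a\<^sup>2 \<le> 4 / real N" "l * b\<^sup>2 \<le> 4 / real N"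
          using fejer_away[OF N] by (auto simp: k_def l_def a_def b_def)
        have dab: "d z \<le> a + b" unfolding d_def a_def b_def
          using norm_triangle_ineq4[of "cis \<theta> - chr 1 (snd z)" "cis \<theta> - chr 1 (fst z)"] by simp
        have d0: "0 \<le> d z" by (simp add: d_def)
        have ab0: "0 \<le> a" "0 \<le> b" by (simp_all add: a_def b_def)
        have uu: "(cmod (u (fst z) - u (snd z)))\<^sup>2 \<le> 4"
        proof -
          have "cmod (u (fst z) - u (snd z)) \<le> 2"
            using norm_triangle_ineq4[of "u (fst z)" "u (snd z)"] S1_map_cmod[OF u] by simp
          then have "(cmod (u (fst z) - u (snd z)))\<^sup>2 \<le> 2\<^sup>2" by (intro power_mono) auto
          then show ?thesis by simp
        qed
        show ?thesis
        proof (cases "d z < \<delta>")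
          case True
          have "(d z)\<^sup>2 \<le> 2 * a\<^sup>2 + 2 * b\<^sup>2"
          proof -
            have "(d z)\<^sup>2 \<le> (a + b)\<^sup>2" using dab d0 by (intro power_mono) auto
            also have "\<dots> \<le> 2 * a\<^sup>2 + 2 * b\<^sup>2" using zero_le_power2[of "a - b"] by (simp add: power2_eq_square algebra_simps)
            finally show ?thesis .
          qed
          then have "k * l * (d z)\<^sup>2 \<le> k * l * (2 * a\<^sup>2 + 2 * b\<^sup>2)" using kl by (intro mult_left_mono) auto
          also have "\<dots> = 2 * (l * (k * a\<^sup>2) + k * (l * b\<^sup>2))" by (simp add: algebra_simps)
          also have "\<dots> \<le> 2 * (real N * (4 / real N) + real N * (4 / real N))"
            using kl ka by (intro mult_left_mono add_mono mult_mono) auto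
          also have "\<dots> = 16" using N by simp
          finally have 16: "k * l * (d z)\<^sup>2 \<le> 16" .
          have "(cmod (u (fst z) - u (snd z)))\<^sup>2 = (d z)\<^sup>2 * H z"
          proof (cases "d z = 0")
            case True
            then have "fst z = snd z" using Pi_plus_chr_1 unfolding d_def by (metis right_minus_eq norm_eq_zero)
            then show ?thesis by (simp add: True)
          qed (simp add: H_def)
          then have "k * l * (cmod (u (fst z) - u (snd z)))\<^sup>2 = k * l * (d z)\<^sup>2 * H z" by simp
          also have "\<dots> \<le> 16 * H z" using 16 H0 by (intro mult_right_mono) auto
          finally have "k * l * (cmod (u (fst z) - u (snd z)))\<^sup>2 \<le> 16 * H z" .
          moreover have "0 \<le> c * (k + l)" using kl \<delta> by (simp add: c_def)
          ultimately show ?thesis using True by (simp add: k_def l_def)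
        next
          case False
          then have "\<delta> / 2 \<le> a \<or> \<delta> / 2 \<le> b" using dab by linarith
          moreover have far: "k' \<le> 16 / (real N * \<delta>\<^sup>2)" if "\<delta> / 2 \<le> a'" "k' * a'\<^sup>2 \<le> 4 / real N" "0 \<le> k'" for k' a'
          proof -
            have "(\<delta> / 2)\<^sup>2 \<le> a'\<^sup>2" using that \<delta> by (intro power_mono) auto
            then have "k' * (\<delta> / 2)\<^sup>2 \<le> k' * a'\<^sup>2" using that by (intro mult_left_mono) auto
            then have "k' * (\<delta> / 2)\<^sup>2 \<le> 4 / real N" using that by simp
            then show ?thesis using N \<delta> by (simp add: field_simps power2_eq_square)
          qed
          ultimately have "k * l \<le> 16 / (real N * \<delta>\<^sup>2) * (k + l)"
          proof (elim disjE)
            assume "\<delta> / 2 \<le> a"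
            then have "k * l \<le> 16 / (real N * \<delta>\<^sup>2) * l" using far[OF _ ka(1)] kl by (intro mult_right_mono) auto
            also have "\<dots> \<le> 16 / (real N * \<delta>\<^sup>2) * (k + l)" using kl by (intro mult_left_mono) auto
            finally show ?thesis .
          next
            assume "\<delta> / 2 \<le> b"
            then have "l * k \<le> 16 / (real N * \<delta>\<^sup>2) * k" using far[OF _ ka(2)] kl by (intro mult_right_mono) auto
            also have "\<dots> \<le> 16 / (real N * \<delta>\<^sup>2) * (k + l)" using kl by (intro mult_left_mono) auto
            finally show ?thesis by (simp add: mult.commute)
          qed
          then have "k * l * (cmod (u (fst z) - u (snd z)))\<^sup>2 \<le> 16 / (real N * \<delta>\<^sup>2) * (k + l) * 4"
            by (rule mult_mono) (use uu kl \<delta> N in auto)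
          then show ?thesis using False by (simp add: k_def l_def c_def)
        qed
      qed
      have i1: "integrable circ2 (\<lambda>z. ?k (fst z) * ?k (snd z) * (cmod (u (fst z) - u (snd z)))\<^sup>2)"
      proof (rule integrable_circ2_bounded[where B = "real N * real N * 4"])
        fix z
        have "cmod (u (fst z) - u (snd z)) \<le> 2"
          using norm_triangle_ineq4[of "u (fst z)" "u (snd z)"] S1_map_cmod[OF u] by simp
        then have "(cmod (u (fst z) - u (snd z)))\<^sup>2 \<le> 2\<^sup>2" by (intro power_mono) auto
        then show "norm (?k (fst z) * ?k (snd z) * (cmod (u (fst z) - u (snd z)))\<^sup>2) \<le> real N * real N * 4"
          using kb unfolding norm_mult by (intro mult_mono) auto
      qed simp
      have i2: "integrable circ2 (\<lambda>z. indicator {z. d z < \<delta>} z * H z)"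
        by (rule Bochner_Integration.integrable_bound[OF Hint]) (use H0 in \<open>auto simp: indicator_def\<close>)
      have i3: "integrable circ2 (\<lambda>z. ?k (fst z))" "integrable circ2 (\<lambda>z. ?k (snd z))"
        using kb by (auto intro!: integrable_circ2_bounded[where B = "real N"])
      have e3: "(\<integral>z. ?k (fst z) \<partial>circ2) = 4 * pi\<^sup>2" "(\<integral>z. ?k (snd z) \<partial>circ2) = 4 * pi\<^sup>2"
      proof -
        have "complex_of_real (\<integral>z. ?k (fst z) \<partial>circ2) = (\<integral>z. complex_of_real (?k (fst z)) * 1 \<partial>circ2)"
          by (simp only: integral_complex_of_real mult_1_right)
        also have "\<dots> = of_real (4 * pi\<^sup>2)"
          by (subst integral_circ2_prod[where B = "real N" and C = 1 and g = "\<lambda>_. 1"])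
            (use kb in \<open>auto simp: fejer_mass[OF N] power2_eq_square scaleR_conv_of_real\<close>)
        finally show "(\<integral>z. ?k (fst z) \<partial>circ2) = 4 * pi\<^sup>2" by (simp only: of_real_eq_iff)
        have "complex_of_real (\<integral>z. ?k (snd z) \<partial>circ2) = (\<integral>z. 1 * complex_of_real (?k (snd z)) \<partial>circ2)"
          by (simp only: integral_complex_of_real mult_1_left)
        also have "\<dots> = of_real (4 * pi\<^sup>2)"
          by (subst integral_circ2_prod[where B = 1 and C = "real N" and f = "\<lambda>_. 1"])
            (use kb in \<open>auto simp: fejer_mass[OF N] power2_eq_square scaleR_conv_of_real\<close>)
        finally show "(\<integral>z. ?k (snd z) \<partial>circ2) = 4 * pi\<^sup>2" by (simp only: of_real_eq_iff)
      qed
      have "(\<integral>z. ?k (fst z) * ?k (snd z) * (cmod (u (fst z) - u (snd z)))\<^sup>2 \<partial>circ2)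
         \<le> (\<integral>z. 16 * (indicator {z. d z < \<delta>} z * H z) + c * (?k (fst z) + ?k (snd z)) \<partial>circ2)"
        by (rule integral_mono[OF i1 _ pt]) (use i2 i3 in auto)
      also have "\<dots> = 16 * I + c * (8 * pi\<^sup>2)"
        using i2 i3 by (simp add: e3 I_def)
      finally have "1 - (cmod (trig_poly {- int N<..<int N} (fejer_coef u N) \<theta>))\<^sup>2 \<le> (16 * I + c * (8 * pi\<^sup>2)) / (8 * pi\<^sup>2)"
        unfolding fejer_modulus[OF u N] by (intro divide_right_mono) auto
      also have "\<dots> = 2 * I / pi\<^sup>2 + c" by (simp add: field_simps)
      also have "2 * I / pi\<^sup>2 \<le> 2 * I"
      proof -
        have "0 \<le> I" unfolding I_def using H0 by (intro Bochner_Integration.integral_nonneg) (auto simp: indicator_def)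
        moreover have "1 \<le> pi\<^sup>2" using pi_gt3 by (simp add: one_le_power)
        ultimately show ?thesis by (intro divide_le_eq[THEN iffD2]) (auto simp: mult_le_cancel_left1)
      qed
      finally show "1 - (cmod (trig_poly {- int N<..<int N} (fejer_coef u N) \<theta>))\<^sup>2 < 1 / 2"
        using I elim(1) unfolding c_def by linarith
    qed
  qed
qed

section \<open>Integrality of the degree\<close>

lemma has_sum_diff_real:
  fixes f g :: "'a \<Rightarrow> real"
  assumes "(f has_sum a) A" "(g has_sum b) A"
  shows "((\<lambda>x. f x - g x) has_sum (a - b)) A"
  using has_sum_add[OF assms(1), of "\<lambda>x. - g x" "- b"] assms(2) by (simp add: has_sum_uminus)

lemma fejer_coef_norm: "2 * pi * (cmod (fejer_coef u N k))\<^sup>2 = (1 - \<bar>of_int k\<bar> / real N)\<^sup>2 * (cmod (coef u k))\<^sup>2"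
  by (simp only: fejer_coef_def norm_mult norm_of_real power_mult_distrib power2_abs power_divide) simp

lemma S1_map_parseval: "S1_map u \<Longrightarrow> ((\<lambda>k. (cmod (coef u k))\<^sup>2) has_sum (2 * pi)) UNIV"
  using parseval[of u 1] by (simp add: S1_map_def)

lemma S1_map_energy: "S1_map u \<Longrightarrow> ((\<lambda>k. of_int \<bar>k\<bar> * (cmod (coef u k))\<^sup>2) has_sum En u) UNIV"
  using energy_fourier[of u 1] by (simp add: S1_map_def)

lemma deg_has_sum:
  assumes u: "S1_map u"
  shows "((\<lambda>k. of_int k * (cmod (coef u k))\<^sup>2) has_sum (2 * pi * deg u)) UNIV"
proof -
  have "(\<lambda>k. norm (of_int k * (cmod (coef u k))\<^sup>2)) summable_on UNIV"
    using has_sum_imp_summable[OF S1_map_energy[OF u]] by (simp add: abs_mult)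
  then have "(\<lambda>k. of_int k * (cmod (coef u k))\<^sup>2) summable_on UNIV"
    by (rule abs_summable_summable)
  then show ?thesis by (simp add: deg_def)
qed

lemma En_nonneg: "0 \<le> En u" by (simp add: En_def)

text \<open>
  Termwise comparison of \<open>\<bar>k\<bar>\<close> with \<open>\<plusminus> k\<close>.
\<close>

lemma En_ge_deg: assumes u: "S1_map u" shows "2 * pi * \<bar>deg u\<bar> \<le> En u"
proof -
  have "2 * pi * deg u \<le> En u"
    by (rule has_sum_mono[OF deg_has_sum[OF u] S1_map_energy[OF u]]) (auto intro: mult_right_mono)
  moreover have "- (2 * pi * deg u) \<le> En u"
  proof (rule has_sum_mono[OF _ S1_map_energy[OF u]])
    show "((\<lambda>k. - (of_int k * (cmod (coef u k))\<^sup>2)) has_sum - (2 * pi * deg u)) UNIV"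
      using deg_has_sum[OF u] by (simp add: has_sum_uminus)
    show "- (of_int k * (cmod (coef u k))\<^sup>2) \<le> of_int \<bar>k\<bar> * (cmod (coef u k))\<^sup>2" for k
      using mult_right_mono[of "- real_of_int k" "of_int \<bar>k\<bar>" "(cmod (coef u k))\<^sup>2"] by simp
  qed
  ultimately show ?thesis by (cases "deg u \<ge> 0") auto
qed

text \<open>
  Equality in the preceding bound is equality of all terms: the map has no negative frequencies, that
  is, it extends holomorphically to the disc.
\<close>

lemma coef_neg_zero:
  assumes u: "S1_map u" and eq: "En u = 2 * pi * deg u" and k: "k < 0"
  shows "coef u k = 0"
proof -
  have hs: "((\<lambda>k. of_int \<bar>k\<bar> * (cmod (coef u k))\<^sup>2 - of_int k * (cmod (coef u k))\<^sup>2) has_sum (En u - 2 * pi * deg u)) UNIV"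
    by (rule has_sum_diff_real[OF S1_map_energy[OF u] deg_has_sum[OF u]])
  have nn: "0 \<le> of_int \<bar>k\<bar> * (cmod (coef u k))\<^sup>2 - of_int k * (cmod (coef u k))\<^sup>2" for k
    using mult_right_mono[of "real_of_int k" "of_int \<bar>k\<bar>" "(cmod (coef u k))\<^sup>2"] by simp
  have "sum (\<lambda>k. of_int \<bar>k\<bar> * (cmod (coef u k))\<^sup>2 - of_int k * (cmod (coef u k))\<^sup>2) {k} \<le> 0"
    using has_sum_mono2[OF has_sum_finite[of "{k}"] hs] nn eq by auto
  then have "(- 2 * of_int k) * (cmod (coef u k))\<^sup>2 \<le> 0" using k by (simp add: algebra_simps)
  then have "(cmod (coef u k))\<^sup>2 \<le> 0" using k by (auto simp: zero_le_mult_iff)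
  then show ?thesis by simp
qed

text \<open>
  The inequality \<open>1 - (1 - \<bar>k\<bar> / N)\<^sup>2 \<le> 2 * \<bar>k\<bar> / N\<close> holds for each index, with the left side read as
  1 for the indices that the mean discards.
\<close>

lemma fejer_deficit:
  assumes u: "S1_map u" and N: "N > 0"
  shows "real N * (2 * pi - 2 * pi * (\<Sum>k\<in>{- int N<..<int N}. (cmod (fejer_coef u N k))\<^sup>2)) \<le> 2 * En u"
proof -
  let ?K = "{- int N<..<int N}"
  define m where "m k = 1 - \<bar>of_int k\<bar> / real N" for k :: int
  have fc: "2 * pi * (cmod (fejer_coef u N k))\<^sup>2 = (m k)\<^sup>2 * (cmod (coef u k))\<^sup>2" for k
    unfolding m_def by (rule fejer_coef_norm)
  have hs1: "((\<lambda>k. if k \<in> ?K then (m k)\<^sup>2 * (cmod (coef u k))\<^sup>2 else 0) has_sum (\<Sum>k\<in>?K. (m k)\<^sup>2 * (cmod (coef u k))\<^sup>2)) UNIV"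
    by (rule has_sum_finite_neutralI[of ?K]) auto
  have "2 * pi - (\<Sum>k\<in>?K. (m k)\<^sup>2 * (cmod (coef u k))\<^sup>2) \<le> 2 / real N * En u"
  proof (rule has_sum_mono[OF has_sum_diff_real[OF S1_map_parseval[OF u] hs1] has_sum_cmult_right[OF S1_map_energy[OF u]]])
    fix k :: int
    show "(cmod (coef u k))\<^sup>2 - (if k \<in> ?K then (m k)\<^sup>2 * (cmod (coef u k))\<^sup>2 else 0) \<le> 2 / real N * (of_int \<bar>k\<bar> * (cmod (coef u k))\<^sup>2)"
    proof (cases "k \<in> ?K")
      case True
      have "1 - (m k)\<^sup>2 \<le> 2 * (1 - m k)" using zero_le_power2[of "1 - m k"] by (simp add: power2_eq_square algebra_simps)
      also have "\<dots> = 2 / real N * of_int \<bar>k\<bar>" by (simp add: m_def)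
      finally have "(1 - (m k)\<^sup>2) * (cmod (coef u k))\<^sup>2 \<le> 2 / real N * of_int \<bar>k\<bar> * (cmod (coef u k))\<^sup>2"
        by (rule mult_right_mono) simp
      then show ?thesis using True by (simp add: algebra_simps)
    next
      case False
      then have "int N \<le> \<bar>k\<bar>" by auto
      then have "real N \<le> of_int \<bar>k\<bar>" by linarith
      then have "1 \<le> 2 / real N * of_int \<bar>k\<bar>" using N by (simp add: divide_simps)
      then have "1 * (cmod (coef u k))\<^sup>2 \<le> 2 / real N * of_int \<bar>k\<bar> * (cmod (coef u k))\<^sup>2"
        by (rule mult_right_mono) simp
      then show ?thesis by (subst if_not_P[OF False]) (simp add: algebra_simps)
    qed
  qed
  then have "2 * pi - 2 * pi * (\<Sum>k\<in>?K. (cmod (fejer_coef u N k))\<^sup>2) \<le> 2 / real N * En u"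
    by (simp add: sum_distrib_left fc)
  then show ?thesis using N by (simp add: field_simps)
qed

lemma weighted_am_gm: assumes "0 < (q::real)" shows "b * a * 2 \<le> q * a\<^sup>2 + 1 / q * b\<^sup>2"
proof -
  have "0 \<le> (q * a - b)\<^sup>2 / q" using assms by simp
  also have "\<dots> = q * a\<^sup>2 + 1 / q * b\<^sup>2 - b * a * 2"
    using assms by (simp add: power2_eq_square field_simps)
  finally show ?thesis by simp
qed

text \<open>
  For the Fejer mean \<open>T\<close> the integral of \<open>T' / T\<close> is \<open>2 \<pi> \<i>\<close> times an integer and that of
  \<open>cnj T * T'\<close> is \<open>\<i>\<close> times the degree sum of the coefficients. The two integrands differ by the factor
  \<open>1 - \<bar>T\<bar>\<^sup>2\<close>. Its product with \<open>T'\<close> is split by the arithmetic-geometric mean inequality with weight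
  \<open>s * N\<close>: the first part is bounded through \<open>fejer_deficit\<close>, the second is a Kronecker mean and tends
  to zero.
\<close>

lemma winding_fejer:
  assumes u: "S1_map u" and N: "N > 0" and s: "s > 0"
    and low: "\<And>\<theta>. 1 - (cmod (trig_poly {- int N<..<int N} (fejer_coef u N) \<theta>))\<^sup>2 < 1 / 2"
  shows "\<exists>n::int. \<bar>2 * pi * of_int n - 2 * pi * (\<Sum>k\<in>{- int N<..<int N}. of_int k * (cmod (fejer_coef u N k))\<^sup>2)\<bar>
     \<le> 2 * s * En u + (\<Sum>k\<in>{- int N<..<int N}. of_int \<bar>k\<bar> * (of_int \<bar>k\<bar> * (cmod (coef u k))\<^sup>2)) / real N / s"
proof -
  let ?K = "{- int N<..<int N}"
  let ?c = "fejer_coef u N"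
  define T where "T = trig_poly ?K ?c"
  define T' where "T' = trig_poly ?K (\<lambda>k. \<i> * of_int k * ?c k)"
  define D where "D = 2 * pi * (\<Sum>k\<in>?K. of_int k * (cmod (?c k))\<^sup>2)"
  have cT: "continuous_on A T" "continuous_on A T'" for A
    by (simp_all add: T_def T'_def continuous_on_trig_poly)
  have T1: "(cmod (T \<theta>))\<^sup>2 \<le> 1" for \<theta>
  proof -
    have "0 \<le> 1 - (cmod (T \<theta>))\<^sup>2" unfolding T_def fejer_modulus[OF u N]
      by (intro divide_nonneg_nonneg Bochner_Integration.integral_nonneg mult_nonneg_nonneg fejer_nonneg) auto
    then show ?thesis by simp
  qed
  have T2: "1 / 2 < (cmod (T \<theta>))\<^sup>2" for \<theta> using low[of \<theta>] by (simp add: T_def)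
  have nz: "T \<theta> \<noteq> 0" for \<theta>
  proof
    assume "T \<theta> = 0" then show False using T2[of \<theta>] by simp
  qed
  have per: "T (2 * pi) = T 0" unfolding T_def trig_poly_def
    using cis_multiple_2pi[of "of_int _"] by (intro sum.cong refl) (simp add: mult_ac)
  obtain n :: int where n: "integral {0..2 * pi} (\<lambda>\<theta>. T' \<theta> / T \<theta>) = 2 * of_real pi * \<i> * of_int n"
    using winding_integer[of T T'] cT(2) per nz trig_poly_deriv unfolding T_def T'_def by blast
  have c: "integral {0..2 * pi} (\<lambda>\<theta>. cnj (T \<theta>) * T' \<theta>) = \<i> * of_real D"
    unfolding T_def T'_def trig_poly_inner[OF finite_greaterThanLessThan_int] D_def
    by (simp add: sum_distrib_left cmod_sq_cnj mult_ac del: of_real_power)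
  have diff: "integral {0..2 * pi} (\<lambda>\<theta>. T' \<theta> / T \<theta> - cnj (T \<theta>) * T' \<theta>) = \<i> * of_real (2 * pi * of_int n - D)"
  proof -
    have "integral {0..2 * pi} (\<lambda>\<theta>. T' \<theta> / T \<theta> - cnj (T \<theta>) * T' \<theta>)
       = integral {0..2 * pi} (\<lambda>\<theta>. T' \<theta> / T \<theta>) - integral {0..2 * pi} (\<lambda>\<theta>. cnj (T \<theta>) * T' \<theta>)"
    proof (rule Henstock_Kurzweil_Integration.integral_diff)
      show "(\<lambda>\<theta>. T' \<theta> / T \<theta>) integrable_on {0..2 * pi}"
        by (intro integrable_continuous_interval continuous_intros cT) (use nz in auto)
      show "(\<lambda>\<theta>. cnj (T \<theta>) * T' \<theta>) integrable_on {0..2 * pi}"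
        by (intro integrable_continuous_interval continuous_intros cT)
    qed
    then show ?thesis unfolding n c by (simp add: algebra_simps)
  qed
  have "norm (integral {0..2 * pi} (\<lambda>\<theta>. T' \<theta> / T \<theta> - cnj (T \<theta>) * T' \<theta>))
     \<le> integral {0..2 * pi} (\<lambda>\<theta>. s * real N * (1 - (cmod (T \<theta>))\<^sup>2) + 1 / (s * real N) * (cmod (T' \<theta>))\<^sup>2)"
  proof (rule integral_norm_bound_integral)
    show "(\<lambda>\<theta>. T' \<theta> / T \<theta> - cnj (T \<theta>) * T' \<theta>) integrable_on {0..2 * pi}"
      by (intro integrable_continuous_interval continuous_intros cT) (use nz in auto)
    show "(\<lambda>\<theta>. s * real N * (1 - (cmod (T \<theta>))\<^sup>2) + 1 / (s * real N) * (cmod (T' \<theta>))\<^sup>2) integrable_on {0..2 * pi}"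
      by (intro integrable_continuous_interval continuous_intros cT)
    fix \<theta>
    define a b where "a = 1 - (cmod (T \<theta>))\<^sup>2" and "b = cmod (T' \<theta>)"
    have a: "0 \<le> a" "a \<le> 1" using T1[of \<theta>] by (auto simp: a_def)
    have "1 / 2 \<le> cmod (T \<theta>)"
    proof (rule ccontr)
      assume "\<not> 1 / 2 \<le> cmod (T \<theta>)"
      then have "(cmod (T \<theta>))\<^sup>2 \<le> (1 / 2)\<^sup>2" by (intro power_mono) auto
      then show False using T2[of \<theta>] by (simp add: power2_eq_square)
    qed
    then have inv: "1 / cmod (T \<theta>) \<le> 2" by (simp add: divide_simps split: if_splits)
    have "T' \<theta> / T \<theta> - cnj (T \<theta>) * T' \<theta> = T' \<theta> * of_real a / T \<theta>"
    proof -
      have e: "of_real a = 1 - cnj (T \<theta>) * T \<theta>" by (simp only: a_def of_real_diff cmod_sq_cnj of_real_1)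
      show ?thesis unfolding e using nz[of \<theta>] by (simp add: field_simps)
    qed
    then have "norm (T' \<theta> / T \<theta> - cnj (T \<theta>) * T' \<theta>) = b * a * (1 / cmod (T \<theta>))"
      using a by (simp add: norm_mult norm_divide b_def)
    also have "\<dots> \<le> b * a * 2" using inv a by (intro mult_left_mono) (auto simp: b_def)
    also have "\<dots> \<le> s * real N * a\<^sup>2 + 1 / (s * real N) * b\<^sup>2"
    proof -
      have "0 < s * real N" using s N by simp
      then show ?thesis by (rule weighted_am_gm)
    qed
    also have "a\<^sup>2 \<le> a" using a by (simp add: power2_eq_square mult_left_le_one_le)
    finally show "norm (T' \<theta> / T \<theta> - cnj (T \<theta>) * T' \<theta>) \<le> s * real N * (1 - (cmod (T \<theta>))\<^sup>2) + 1 / (s * real N) * (cmod (T' \<theta>))\<^sup>2"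
      unfolding a_def b_def using s N by (simp add: mult_left_mono)
  qed
  also have "\<dots> = s * real N * (2 * pi - 2 * pi * (\<Sum>k\<in>?K. (cmod (?c k))\<^sup>2)) + 1 / (s * real N) * (2 * pi * (\<Sum>k\<in>?K. (cmod (\<i> * of_int k * ?c k))\<^sup>2))"
  proof -
    have i: "(\<lambda>\<theta>. (cmod (T \<theta>))\<^sup>2) integrable_on {0..2*pi}" "(\<lambda>\<theta>. (cmod (T' \<theta>))\<^sup>2) integrable_on {0..2*pi}"
      by (intro integrable_continuous_interval continuous_intros cT)+
    have "((\<lambda>\<theta>. s * real N * (1 - (cmod (T \<theta>))\<^sup>2) + 1 / (s * real N) * (cmod (T' \<theta>))\<^sup>2) has_integral
      (s * real N * (2 * pi - integral {0..2*pi} (\<lambda>\<theta>. (cmod (T \<theta>))\<^sup>2)) + 1 / (s * real N) * integral {0..2*pi} (\<lambda>\<theta>. (cmod (T' \<theta>))\<^sup>2))) {0..2*pi}"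
      by (intro has_integral_add has_integral_mult_right has_integral_diff integrable_integral i)
        (use has_integral_const_real[of "1::real" 0 "2 * pi"] in simp)
    then show ?thesis unfolding T_def T'_def trig_poly_norm_sq[OF finite_greaterThanLessThan_int] by (rule integral_unique)
  qed
  also have "\<dots> \<le> 2 * s * En u + (\<Sum>k\<in>?K. of_int \<bar>k\<bar> * (of_int \<bar>k\<bar> * (cmod (coef u k))\<^sup>2)) / real N / s"
  proof (rule add_mono)
    show "s * real N * (2 * pi - 2 * pi * (\<Sum>k\<in>?K. (cmod (?c k))\<^sup>2)) \<le> 2 * s * En u"
      using mult_left_mono[OF fejer_deficit[OF u N], of s] s by (simp add: mult_ac)
    have "2 * pi * (\<Sum>k\<in>?K. (cmod (\<i> * of_int k * ?c k))\<^sup>2) \<le> (\<Sum>k\<in>?K. of_int \<bar>k\<bar> * (of_int \<bar>k\<bar> * (cmod (coef u k))\<^sup>2))"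
      unfolding sum_distrib_left
    proof (rule sum_mono)
      fix k assume k: "k \<in> ?K"
      have "\<bar>real_of_int k\<bar> \<le> real N" using k by auto
      then have "0 \<le> 1 - \<bar>of_int k\<bar> / real N" "1 - \<bar>of_int k\<bar> / real N \<le> 1" using N by (auto simp: divide_simps)
      then have m: "(1 - \<bar>of_int k\<bar> / real N)\<^sup>2 \<le> 1" by (simp add: power_le_one)
      have "2 * pi * (cmod (\<i> * of_int k * ?c k))\<^sup>2 = (1 - \<bar>of_int k\<bar> / real N)\<^sup>2 * ((of_int k)\<^sup>2 * (cmod (coef u k))\<^sup>2)"
        using fejer_coef_norm[of u N k] by (simp add: norm_mult power_mult_distrib algebra_simps)
      also have "\<dots> \<le> 1 * ((of_int k)\<^sup>2 * (cmod (coef u k))\<^sup>2)" using m by (intro mult_right_mono) auto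
      finally show "2 * pi * (cmod (\<i> * of_int k * ?c k))\<^sup>2 \<le> of_int \<bar>k\<bar> * (of_int \<bar>k\<bar> * (cmod (coef u k))\<^sup>2)"
        by (simp add: power2_eq_square mult.assoc[symmetric])
    qed
    then have "2 * pi * (\<Sum>k\<in>?K. (cmod (\<i> * of_int k * ?c k))\<^sup>2) / (s * real N) \<le> (\<Sum>k\<in>?K. of_int \<bar>k\<bar> * (of_int \<bar>k\<bar> * (cmod (coef u k))\<^sup>2)) / (s * real N)"
      using s by (intro divide_right_mono) auto
    then show "1 / (s * real N) * (2 * pi * (\<Sum>k\<in>?K. (cmod (\<i> * of_int k * ?c k))\<^sup>2)) \<le> (\<Sum>k\<in>?K. of_int \<bar>k\<bar> * (of_int \<bar>k\<bar> * (cmod (coef u k))\<^sup>2)) / real N / s"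
      by (simp add: mult.commute)
  qed
  finally show ?thesis unfolding diff D_def[symmetric]
    by (intro exI[of _ n]) (simp only: norm_mult norm_ii norm_of_real mult_1_left)
qed

text \<open>
  The Fejer factors change the partial sums of the degree series by at most twice a Kronecker mean.
\<close>

lemma fejer_degree_tendsto:
  assumes u: "S1_map u"
  shows "(\<lambda>N. 2 * pi * (\<Sum>k\<in>{- int N<..<int N}. of_int k * (cmod (fejer_coef u N k))\<^sup>2)) \<longlonglongrightarrow> 2 * pi * deg u"
proof -
  let ?h = "\<lambda>k. of_int \<bar>k\<bar> * (cmod (coef u k))\<^sup>2"
  let ?D = "\<lambda>N. 2 * pi * (\<Sum>k\<in>{- int N<..<int N}. of_int k * (cmod (fejer_coef u N k))\<^sup>2)"
  let ?P = "\<lambda>N. \<Sum>k\<in>{- int N<..<int N}. of_int k * (cmod (coef u k))\<^sup>2"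
  have kr: "(\<lambda>N. 2 * ((\<Sum>k\<in>{- int N<..<int N}. of_int \<bar>k\<bar> * ?h k) / real N)) \<longlonglongrightarrow> 2 * 0"
    by (intro tendsto_mult tendsto_const kronecker_int[OF _ S1_map_energy[OF u]]) auto
  have "(\<lambda>N. ?P N - ?D N) \<longlonglongrightarrow> 0"
  proof (rule Lim_null_comparison)
    show "(\<lambda>N. 2 * ((\<Sum>k\<in>{- int N<..<int N}. of_int \<bar>k\<bar> * ?h k) / real N)) \<longlonglongrightarrow> 0" using kr by simp
    show "\<forall>\<^sub>F N in sequentially. norm (?P N - ?D N) \<le> 2 * ((\<Sum>k\<in>{- int N<..<int N}. of_int \<bar>k\<bar> * ?h k) / real N)"
      using eventually_gt_at_top[of 0]
    proof eventually_elim
      case (elim N)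
      let ?K = "{- int N<..<int N}"
      have "?P N - ?D N = (\<Sum>k\<in>?K. of_int k * (cmod (coef u k))\<^sup>2 - 2 * pi * (of_int k * (cmod (fejer_coef u N k))\<^sup>2))"
        by (simp add: sum_subtractf sum_distrib_left)
      also have "norm \<dots> \<le> (\<Sum>k\<in>?K. 2 * (of_int \<bar>k\<bar> * ?h k) / real N)"
      proof (rule sum_norm_le)
        fix k assume k: "k \<in> ?K"
        define m where "m = 1 - \<bar>of_int k\<bar> / real N"
        have "\<bar>real_of_int k\<bar> \<le> real N" using k by auto
        then have m: "0 \<le> m" "m \<le> 1" using elim by (auto simp: m_def divide_simps)
        have "1 - m\<^sup>2 \<le> 2 * (1 - m)" using zero_le_power2[of "1 - m"] by (simp add: power2_eq_square algebra_simps)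
        moreover have "0 \<le> 1 - m\<^sup>2" using m by (simp add: power_le_one)
        ultimately have mm: "\<bar>1 - m\<^sup>2\<bar> \<le> 2 * \<bar>of_int k\<bar> / real N" by (simp add: m_def)
        have "of_int k * (cmod (coef u k))\<^sup>2 - 2 * pi * (of_int k * (cmod (fejer_coef u N k))\<^sup>2) = of_int k * (cmod (coef u k))\<^sup>2 * (1 - m\<^sup>2)"
        proof -
          have "2 * pi * (of_int k * (cmod (fejer_coef u N k))\<^sup>2) = of_int k * (2 * pi * (cmod (fejer_coef u N k))\<^sup>2)" by simp
          also have "\<dots> = of_int k * (m\<^sup>2 * (cmod (coef u k))\<^sup>2)" unfolding fejer_coef_norm m_def ..
          finally have e: "2 * pi * (of_int k * (cmod (fejer_coef u N k))\<^sup>2) = \<dots>" .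
          show ?thesis unfolding e by (simp add: algebra_simps)
        qed
        then have "norm (of_int k * (cmod (coef u k))\<^sup>2 - 2 * pi * (of_int k * (cmod (fejer_coef u N k))\<^sup>2)) = ?h k * \<bar>1 - m\<^sup>2\<bar>"
          by (simp add: abs_mult)
        also have "\<dots> \<le> ?h k * (2 * \<bar>of_int k\<bar> / real N)" using mm by (intro mult_left_mono) auto
        finally show "norm (of_int k * (cmod (coef u k))\<^sup>2 - 2 * pi * (of_int k * (cmod (fejer_coef u N k))\<^sup>2)) \<le> 2 * (of_int \<bar>k\<bar> * ?h k) / real N"
          by (simp add: mult_ac)
      qed
      finally show ?case by (simp add: sum_distrib_left sum_divide_distrib)
    qed
  qed
  from tendsto_diff[OF has_sum_int_intervals[OF deg_has_sum[OF u]] this] show ?thesis by simp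
qed

text \<open>
  If the degree had distance \<open>\<delta>\<close> from the integers, the weight \<open>s\<close> in \<open>winding_fejer\<close> could be taken
  so small, and then \<open>N\<close> so large, that \<open>2 \<pi>\<close> times the degree is within \<open>4 * \<delta>\<close> of \<open>2 \<pi>\<close> times an
  integer; but \<open>4 < 2 \<pi>\<close>.
\<close>

theorem deg_integer:
  assumes u: "S1_map u" shows "\<exists>n::int. deg u = of_int n"
proof (rule ccontr)
  assume no: "\<nexists>n::int. deg u = of_int n"
  define \<delta> where "\<delta> = min (deg u - of_int \<lfloor>deg u\<rfloor>) (of_int \<lfloor>deg u\<rfloor> + 1 - deg u)"
  have "of_int \<lfloor>deg u\<rfloor> \<noteq> deg u" using no by metis
  then have \<delta>: "0 < \<delta>" unfolding \<delta>_def min_less_iff_conj using floor_correct[of "deg u"] by linarith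
  have far: "\<delta> \<le> \<bar>of_int n - deg u\<bar>" for n :: int
  proof (cases "n \<le> \<lfloor>deg u\<rfloor>")
    case True
    then have "real_of_int n \<le> of_int \<lfloor>deg u\<rfloor>" by simp
    then show ?thesis unfolding \<delta>_def by linarith
  next
    case False
    then have "real_of_int (\<lfloor>deg u\<rfloor> + 1) \<le> of_int n" by (simp only: of_int_le_iff)
    then show ?thesis unfolding \<delta>_def by simp
  qed
  define s where "s = \<delta> / (En u + 1)"
  have s: "s > 0" using \<delta> En_nonneg[of u] by (simp add: s_def)
  have sE: "2 * s * En u \<le> 2 * \<delta>"
    using \<delta> En_nonneg[of u] by (simp add: s_def field_simps)
  have e1: "eventually (\<lambda>N. (\<Sum>k\<in>{- int N<..<int N}. of_int \<bar>k\<bar> * (of_int \<bar>k\<bar> * (cmod (coef u k))\<^sup>2)) / real N < s * \<delta>) sequentially"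
    by (rule order_tendstoD(2)[OF kronecker_int[OF _ S1_map_energy[OF u]]]) (use s \<delta> in auto)
  have e2: "eventually (\<lambda>N. dist (2 * pi * (\<Sum>k\<in>{- int N<..<int N}. of_int k * (cmod (fejer_coef u N k))\<^sup>2)) (2 * pi * deg u) < \<delta>) sequentially"
    by (rule tendstoD[OF fejer_degree_tendsto[OF u] \<delta>])
  have "eventually (\<lambda>N. False) sequentially"
    using e1 e2 fejer_modulus_uniform[OF u] eventually_gt_at_top[of 0]
  proof eventually_elim
    case (elim N)
    obtain n :: int where n: "\<bar>2 * pi * of_int n - 2 * pi * (\<Sum>k\<in>{- int N<..<int N}. of_int k * (cmod (fejer_coef u N k))\<^sup>2)\<bar>
     \<le> 2 * s * En u + (\<Sum>k\<in>{- int N<..<int N}. of_int \<bar>k\<bar> * (of_int \<bar>k\<bar> * (cmod (coef u k))\<^sup>2)) / real N / s"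
      using winding_fejer[OF u _ s] elim by auto
    also have "\<dots> < 2 * \<delta> + \<delta>"
      by (rule add_le_less_mono[OF sE]) (use elim(1) in \<open>simp only: pos_divide_less_eq[OF s] mult.commute\<close>)
    finally have "\<bar>2 * pi * of_int n - 2 * pi * deg u\<bar> < 4 * \<delta>"
      using elim(2) unfolding dist_real_def by linarith
    also have "\<bar>2 * pi * of_int n - 2 * pi * deg u\<bar> = 2 * pi * \<bar>of_int n - deg u\<bar>"
      by (simp add: abs_mult flip: right_diff_distrib)
    finally have "2 * pi * \<bar>of_int n - deg u\<bar> < 4 * \<delta>" .
    moreover have "2 * pi * \<delta> \<le> 2 * pi * \<bar>of_int n - deg u\<bar>" using far[of n] by simp
    moreover have "4 * \<delta> \<le> 2 * pi * \<delta>" using pi_gt3 \<delta> by simp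
    ultimately show False by linarith
  qed
  then show False by simp
qed

section \<open>Energy and degree of products\<close>

lemma seminorm_sq_dominated:
  assumes [measurable]: "w \<in> borel_measurable borel" "u \<in> borel_measurable borel" "v \<in> borel_measurable borel"
    and ab: "0 \<le> a" "0 \<le> b"
    and le: "\<And>x y. (cmod (w x - w y))\<^sup>2 \<le> a * (cmod (u x - u y))\<^sup>2 + b * (cmod (v x - v y))\<^sup>2"
  shows "seminorm_sq w \<le> ennreal a * seminorm_sq u + ennreal b * seminorm_sq v"
proof -
  let ?q = "\<lambda>f z. ennreal ((cmod (f (fst z) - f (snd z :: real)))\<^sup>2 / (fst z - snd z)\<^sup>2)"
  have "seminorm_sq w \<le> (\<integral>\<^sup>+z. ennreal a * ?q u z + ennreal b * ?q v z \<partial>(lborel \<Otimes>\<^sub>M lborel))"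
    unfolding seminorm_sq_pair[OF assms(1)]
  proof (rule nn_integral_mono)
    fix z :: "real \<times> real"
    define p q where "p = (cmod (u (fst z) - u (snd z)))\<^sup>2 / (fst z - snd z)\<^sup>2"
      and "q = (cmod (v (fst z) - v (snd z)))\<^sup>2 / (fst z - snd z)\<^sup>2"
    have pq: "0 \<le> p" "0 \<le> q" by (simp_all add: p_def q_def)
    have "(cmod (w (fst z) - w (snd z)))\<^sup>2 / (fst z - snd z)\<^sup>2
      \<le> (a * (cmod (u (fst z) - u (snd z)))\<^sup>2 + b * (cmod (v (fst z) - v (snd z)))\<^sup>2) / (fst z - snd z)\<^sup>2"
      by (intro divide_right_mono le) auto
    also have "\<dots> = a * p + b * q"
      by (simp add: add_divide_distrib p_def q_def)
    finally have "?q w z \<le> ennreal (a * p + b * q)" by (rule ennreal_leI)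
    also have "\<dots> = ennreal a * ennreal p + ennreal b * ennreal q"
      using ab pq by (simp add: ennreal_plus ennreal_mult)
    finally show "?q w z \<le> ennreal a * ?q u z + ennreal b * ?q v z" unfolding p_def q_def .
  qed
  also have "\<dots> = ennreal a * seminorm_sq u + ennreal b * seminorm_sq v"
    unfolding seminorm_sq_pair[OF assms(2)] seminorm_sq_pair[OF assms(3)]
    by (simp add: nn_integral_add nn_integral_cmult)
  finally show ?thesis .
qed

lemma seminorm_sq_En: "seminorm_sq u < \<infinity> \<Longrightarrow> seminorm_sq u = ennreal (2 * pi * En u)"
  by (simp add: En_def)

lemma En_le: assumes "seminorm_sq u \<le> ennreal (2 * pi * c)" "0 \<le> c" shows "En u \<le> c" "seminorm_sq u < \<infinity>"
proof -
  show f: "seminorm_sq u < \<infinity>" using assms(1) by (metis ennreal_less_top infinity_ennreal_def order.strict_trans1)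
  show "En u \<le> c" using assms seminorm_sq_En[OF f] En_nonneg[of u] by (simp add: mult_le_cancel_left)
qed

lemma En_dominated:
  assumes "w \<in> borel_measurable borel" "u \<in> borel_measurable borel" "v \<in> borel_measurable borel"
    and ab: "0 \<le> a" "0 \<le> b"
    and le: "\<And>x y. (cmod (w x - w y))\<^sup>2 \<le> a * (cmod (u x - u y))\<^sup>2 + b * (cmod (v x - v y))\<^sup>2"
    and fin: "seminorm_sq u < \<infinity>" "seminorm_sq v < \<infinity>"
  shows "En w \<le> a * En u + b * En v" and "seminorm_sq w < \<infinity>"
proof -
  have "ennreal a * seminorm_sq u + ennreal b * seminorm_sq v = ennreal (2 * pi * (a * En u + b * En v))"
    using ab En_nonneg[of u] En_nonneg[of v]
    by (simp add: seminorm_sq_En[OF fin(1)] seminorm_sq_En[OF fin(2)] distrib_left mult_ac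
        flip: ennreal_mult ennreal_plus)
  then have "seminorm_sq w \<le> ennreal (2 * pi * (a * En u + b * En v))"
    using seminorm_sq_dominated[OF assms(1-6)] by simp
  moreover have "0 \<le> a * En u + b * En v" using ab En_nonneg[of u] En_nonneg[of v] by simp
  ultimately show "En w \<le> a * En u + b * En v" and "seminorm_sq w < \<infinity>" using En_le by blast+
qed

lemma norm_add_sq_le: "(cmod (a + b))\<^sup>2 \<le> 2 * (cmod a)\<^sup>2 + 2 * (cmod b)\<^sup>2"
proof -
  have "(cmod (a + b))\<^sup>2 \<le> (cmod a + cmod b)\<^sup>2" by (intro power_mono norm_triangle_ineq) auto
  also have "\<dots> \<le> 2 * (cmod a)\<^sup>2 + 2 * (cmod b)\<^sup>2"
    using zero_le_power2[of "cmod a - cmod b"] by (simp add: power2_eq_square algebra_simps)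
  finally show ?thesis .
qed

lemma prod_diff_sq_le:
  assumes "cmod a = 1" "cmod d' \<le> M"
  shows "(cmod (a * d - a' * d'))\<^sup>2 \<le> 2 * M\<^sup>2 * (cmod (a - a'))\<^sup>2 + 2 * (cmod (d - d'))\<^sup>2"
proof -
  have "a * d - a' * d' = (a - a') * d' + a * (d - d')" by (simp add: algebra_simps)
  then have "(cmod (a * d - a' * d'))\<^sup>2 \<le> 2 * (cmod ((a - a') * d'))\<^sup>2 + 2 * (cmod (a * (d - d')))\<^sup>2"
    using norm_add_sq_le by simp
  moreover have "(cmod ((a - a') * d'))\<^sup>2 \<le> M\<^sup>2 * (cmod (a - a'))\<^sup>2"
    using assms(2) by (simp add: norm_mult power_mult_distrib mult.commute[of "M\<^sup>2"] mult_left_mono power_mono)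
  ultimately show ?thesis using assms(1) by (simp add: norm_mult)
qed

lemma S1_map_mult:
  assumes u: "S1_map u" and v: "S1_map v"
  shows "S1_map (\<lambda>x. u x * v x)" and "En (\<lambda>x. u x * v x) \<le> 2 * En u + 2 * En v"
proof -
  note [measurable] = S1_map_measurable[OF u] S1_map_measurable[OF v]
  have le: "(cmod (u x * v x - u y * v y))\<^sup>2 \<le> 2 * (cmod (u x - u y))\<^sup>2 + 2 * (cmod (v x - v y))\<^sup>2" for x y
    using prod_diff_sq_le[of "u x" "v y" 1 "v x" "u y"] S1_map_cmod[OF u] S1_map_cmod[OF v] by simp
  show "En (\<lambda>x. u x * v x) \<le> 2 * En u + 2 * En v"
    by (rule En_dominated(1)[OF _ _ _ _ _ le]) (use S1_map_fin u v in auto)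
  have "seminorm_sq (\<lambda>x. u x * v x) < \<infinity>"
    by (rule En_dominated(2)[OF _ _ _ _ _ le]) (use S1_map_fin u v in auto)
  then show "S1_map (\<lambda>x. u x * v x)"
    using S1_map_cmod[OF u] S1_map_cmod[OF v] by (simp add: S1_map_def norm_mult)
qed

lemma En_mult_le:
  assumes u: "S1_map u" and [measurable]: "d \<in> borel_measurable borel" and d: "\<And>x. cmod (d x) \<le> M" and fin: "seminorm_sq d < \<infinity>"
  shows "En (\<lambda>x. u x * d x) \<le> 2 * M\<^sup>2 * En u + 2 * En d" "seminorm_sq (\<lambda>x. u x * d x) < \<infinity>"
proof -
  note [measurable] = S1_map_measurable[OF u]
  have le: "(cmod (u x * d x - u y * d y))\<^sup>2 \<le> 2 * M\<^sup>2 * (cmod (u x - u y))\<^sup>2 + 2 * (cmod (d x - d y))\<^sup>2" for x y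
    using prod_diff_sq_le[of "u x" "d y" M "d x" "u y"] S1_map_cmod[OF u] d by simp
  show "En (\<lambda>x. u x * d x) \<le> 2 * M\<^sup>2 * En u + 2 * En d"
    by (rule En_dominated(1)[OF _ _ _ _ _ le]) (use S1_map_fin[OF u] fin in auto)
  show "seminorm_sq (\<lambda>x. u x * d x) < \<infinity>"
    by (rule En_dominated(2)[OF _ _ _ _ _ le]) (use S1_map_fin[OF u] fin in auto)
qed

lemma diff_fin:
  assumes u: "S1_map u" and v: "S1_map v"
  shows "seminorm_sq (\<lambda>x. u x - v x) < \<infinity>" "(\<lambda>x. u x - v x) \<in> borel_measurable borel" "cmod (u x - v x) \<le> 2"
    "En (\<lambda>x. u x - v x) \<le> 2 * En u + 2 * En v"
proof -
  note [measurable] = S1_map_measurable[OF u] S1_map_measurable[OF v]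
  have le: "(cmod ((u x - v x) - (u y - v y)))\<^sup>2 \<le> 2 * (cmod (u x - u y))\<^sup>2 + 2 * (cmod (v x - v y))\<^sup>2" for x y
    using norm_add_sq_le[of "u x - u y" "v y - v x"] by (simp add: norm_minus_commute algebra_simps)
  show "seminorm_sq (\<lambda>x. u x - v x) < \<infinity>"
    by (rule En_dominated(2)[OF _ _ _ _ _ le]) (use S1_map_fin u v in auto)
  show "En (\<lambda>x. u x - v x) \<le> 2 * En u + 2 * En v"
    by (rule En_dominated(1)[OF _ _ _ _ _ le]) (use S1_map_fin u v in auto)
  show "cmod (u x - v x) \<le> 2"
    using norm_triangle_ineq4[of "u x" "v x"] S1_map_cmod[OF u] S1_map_cmod[OF v] by simp
  show "(\<lambda>x. u x - v x) \<in> borel_measurable borel" by measurable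
qed

lemma coef_diff:
  assumes [measurable]: "u \<in> borel_measurable borel" "v \<in> borel_measurable borel"
    and "\<And>x. cmod (u x) \<le> B" "\<And>x. cmod (v x) \<le> C"
  shows "coef (\<lambda>x. u x - v x) k = coef u k - coef v k"
proof -
  have "integrable circ (\<lambda>x. u x * chr (- k) x)"
    by (rule integrable_circ_bounded[where B = B]) (use assms in \<open>auto simp: norm_mult\<close>)
  moreover have "integrable circ (\<lambda>x. v x * chr (- k) x)"
    by (rule integrable_circ_bounded[where B = C]) (use assms in \<open>auto simp: norm_mult\<close>)
  ultimately show ?thesis unfolding coef_def by (simp add: left_diff_distrib right_diff_distrib diff_divide_distrib)
qed

text \<open>
  The difference of the squared moduli of \<open>a\<close> and \<open>b\<close> is at most \<open>\<bar>a - b\<bar> * (\<bar>a\<bar> + \<bar>b\<bar>)\<close>. Summed with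
  the weights \<open>\<bar>k\<bar>\<close> and split by the arithmetic-geometric mean inequality, this bounds \<open>2 \<pi>\<close> times the
  difference of the degrees by \<open>L * En (u - v) + 1\<close>. The constant 5 makes the bound smaller than
  \<open>6 < 2 \<pi>\<close>, and degrees are integers.
\<close>

lemma deg_close:
  assumes u: "S1_map u" and v: "S1_map v" and L: "En u \<le> L" "En v \<le> L" "0 < L"
    and close: "L * En (\<lambda>x. u x - v x) < 5"
  shows "deg u = deg v"
proof -
  let ?w = "\<lambda>x. u x - v x"
  have cw: "coef ?w k = coef u k - coef v k" for k
    by (rule coef_diff[where B = 1 and C = 1]) (use u v in \<open>auto simp: S1_map_def\<close>)
  have hw: "((\<lambda>k. of_int \<bar>k\<bar> * (cmod (coef u k - coef v k))\<^sup>2) has_sum En ?w) UNIV"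
    using energy_fourier[OF diff_fin(2)[OF u v] diff_fin(3)[OF u v] diff_fin(1)[OF u v]] by (simp add: cw)
  have hR: "((\<lambda>k. L * (of_int \<bar>k\<bar> * (cmod (coef u k - coef v k))\<^sup>2)
      + 1 / (2 * L) * (of_int \<bar>k\<bar> * (cmod (coef u k))\<^sup>2 + of_int \<bar>k\<bar> * (cmod (coef v k))\<^sup>2))
      has_sum (L * En ?w + 1 / (2 * L) * (En u + En v))) UNIV"
    by (intro has_sum_add has_sum_cmult_right hw S1_map_energy u v)
  have pt: "\<bar>of_int k * (cmod (coef u k))\<^sup>2 - of_int k * (cmod (coef v k))\<^sup>2\<bar>
     \<le> L * (of_int \<bar>k\<bar> * (cmod (coef u k - coef v k))\<^sup>2)
      + 1 / (2 * L) * (of_int \<bar>k\<bar> * (cmod (coef u k))\<^sup>2 + of_int \<bar>k\<bar> * (cmod (coef v k))\<^sup>2)" for k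
  proof -
    define a b d where "a = cmod (coef u k)" and "b = cmod (coef v k)" and "d = cmod (coef u k - coef v k)"
    have ab: "\<bar>a - b\<bar> \<le> d" "0 \<le> a" "0 \<le> b" "0 \<le> d" unfolding a_def b_def d_def by (auto intro: norm_triangle_ineq3)
    have "\<bar>a\<^sup>2 - b\<^sup>2\<bar> = \<bar>a - b\<bar> * (a + b)" using ab by (simp add: power2_eq_square square_diff_square_factored abs_mult mult.commute)
    also have "\<dots> \<le> d * (a + b)" using ab by (intro mult_right_mono) auto
    also have "\<dots> \<le> L * d\<^sup>2 + 1 / (4 * L) * (a + b)\<^sup>2"
    proof -
      have "0 \<le> (2 * L * d - (a + b))\<^sup>2 / (4 * L)" using L by simp
      also have "\<dots> = L * d\<^sup>2 + 1 / (4 * L) * (a + b)\<^sup>2 - d * (a + b)"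
        using L by (simp add: power2_eq_square field_simps)
      finally show ?thesis by simp
    qed
    also have "1 / (4 * L) * (a + b)\<^sup>2 \<le> 1 / (4 * L) * (2 * a\<^sup>2 + 2 * b\<^sup>2)"
      using L zero_le_power2[of "a - b"] by (intro mult_left_mono) (auto simp: power2_eq_square algebra_simps)
    finally have "\<bar>a\<^sup>2 - b\<^sup>2\<bar> \<le> L * d\<^sup>2 + 1 / (4 * L) * (2 * a\<^sup>2 + 2 * b\<^sup>2)" by simp
    moreover have "1 / (4 * L) * (2 * a\<^sup>2 + 2 * b\<^sup>2) = 1 / (2 * L) * (a\<^sup>2 + b\<^sup>2)"
      using L by (simp add: field_simps)
    ultimately have "\<bar>a\<^sup>2 - b\<^sup>2\<bar> \<le> L * d\<^sup>2 + 1 / (2 * L) * (a\<^sup>2 + b\<^sup>2)" by (simp only:)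
    then have "\<bar>of_int k\<bar> * \<bar>a\<^sup>2 - b\<^sup>2\<bar> \<le> \<bar>of_int k\<bar> * (L * d\<^sup>2 + 1 / (2 * L) * (a\<^sup>2 + b\<^sup>2))"
      by (intro mult_left_mono) auto
    moreover have "\<bar>of_int k * a\<^sup>2 - of_int k * b\<^sup>2\<bar> = \<bar>of_int k\<bar> * \<bar>a\<^sup>2 - b\<^sup>2\<bar>"
      by (simp only: abs_mult right_diff_distrib[symmetric])
    moreover have "\<bar>of_int k\<bar> * (L * d\<^sup>2 + 1 / (2 * L) * (a\<^sup>2 + b\<^sup>2))
       = L * (of_int \<bar>k\<bar> * d\<^sup>2) + 1 / (2 * L) * (of_int \<bar>k\<bar> * a\<^sup>2 + of_int \<bar>k\<bar> * b\<^sup>2)"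
      by (simp add: algebra_simps)
    ultimately show ?thesis unfolding a_def[symmetric] b_def[symmetric] d_def[symmetric] by linarith
  qed
  have hd: "((\<lambda>k. of_int k * (cmod (coef u k))\<^sup>2 - of_int k * (cmod (coef v k))\<^sup>2) has_sum (2 * pi * deg u - 2 * pi * deg v)) UNIV"
    by (rule has_sum_diff_real[OF deg_has_sum[OF u] deg_has_sum[OF v]])
  have 1: "2 * pi * deg u - 2 * pi * deg v \<le> L * En ?w + 1 / (2 * L) * (En u + En v)"
    by (rule has_sum_mono[OF hd hR]) (use pt in \<open>auto simp: abs_le_iff\<close>)
  have 2: "2 * pi * deg v - 2 * pi * deg u \<le> L * En ?w + 1 / (2 * L) * (En u + En v)"
    by (rule has_sum_mono[OF has_sum_diff_real[OF deg_has_sum[OF v] deg_has_sum[OF u]] hR]) (use pt in \<open>auto simp: abs_le_iff\<close>)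
  have "1 / (2 * L) * (En u + En v) \<le> 1" using L by (simp add: field_simps)
  then have "\<bar>2 * pi * deg u - 2 * pi * deg v\<bar> < 6" using 1 2 close by linarith
  moreover have "\<bar>2 * pi * deg u - 2 * pi * deg v\<bar> = 2 * pi * \<bar>deg u - deg v\<bar>" by (simp add: abs_mult flip: right_diff_distrib)
  ultimately have "2 * pi * \<bar>deg u - deg v\<bar> < 2 * pi * 1" using pi_gt3 by linarith
  then have "\<bar>deg u - deg v\<bar> < 1" by simp
  moreover obtain m n :: int where "deg u = of_int m" "deg v = of_int n" using deg_integer u v by metis
  ultimately show ?thesis by simp
qed

section \<open>Bubbles\<close>

text \<open>
  The Blaschke factor of the upper half-plane with zero \<open>\<i> * e\<close>. For small \<open>e\<close> it winds once around the
  circle near 0 and is almost constant elsewhere.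
\<close>

definition bubble :: "real \<Rightarrow> real \<Rightarrow> complex" where
  "bubble e x = (of_real x - \<i> * of_real e) / (of_real x + \<i> * of_real e)"

lemma bubble_denom: "e \<noteq> 0 \<Longrightarrow> of_real x + \<i> * of_real e \<noteq> 0"
  by (simp add: complex_eq_iff)

lemma bubble_measurable [measurable]: "bubble e \<in> borel_measurable borel"
  unfolding bubble_def[abs_def] by measurable

lemma cmod_bubble: "e \<noteq> 0 \<Longrightarrow> cmod (bubble e x) = 1"
proof -
  assume e: "e \<noteq> 0"
  have "cmod (of_real x - \<i> * of_real e) = cmod (of_real x + \<i> * of_real e)"
    by (simp add: cmod_def)
  then show ?thesis using bubble_denom[OF e, of x] by (simp add: bubble_def norm_divide)
qed

lemma bubble_diff_point:
  assumes "e \<noteq> 0" shows "bubble e x - bubble e y = 2 * \<i> * of_real e * of_real (x - y) / ((of_real x + \<i> * of_real e) * (of_real y + \<i> * of_real e))"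
  unfolding bubble_def using bubble_denom[OF assms] by (simp add: field_simps)

lemma bubble_lip:
  assumes "e \<noteq> 0"
  shows "(cmod (bubble e x - bubble e y))\<^sup>2 = 4 * e\<^sup>2 * (x - y)\<^sup>2 / ((x\<^sup>2 + e\<^sup>2) * (y\<^sup>2 + e\<^sup>2))"
  unfolding bubble_diff_point[OF assms] norm_divide norm_mult power_divide power_mult_distrib cmod_real_plus_ii
  by (simp flip: of_real_diff)

lemma nn_integral_lorentz:
  assumes "e > 0" shows "(\<integral>\<^sup>+x. ennreal (1 / (x\<^sup>2 + e\<^sup>2)) \<partial>lborel) = ennreal (pi / e)"
proof -
  have 1: "(\<integral>\<^sup>+x. ennreal (1 / (1 + x\<^sup>2)) \<partial>lborel) = ennreal pi"
  proof -
    have "ennreal (2 * pi) = (\<integral>\<^sup>+x. ennreal (2 / (1 + x\<^sup>2)) \<partial>lborel)"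
      unfolding emeasure_circ_UNIV[symmetric] by (simp add: circ_def emeasure_density)
    also have "\<dots> = (\<integral>\<^sup>+x. ennreal 2 * ennreal (1 / (1 + x\<^sup>2)) \<partial>lborel)"
      by (intro nn_integral_cong) (subst ennreal_mult'[symmetric], auto)
    also have "\<dots> = ennreal 2 * (\<integral>\<^sup>+x. ennreal (1 / (1 + x\<^sup>2)) \<partial>lborel)"
      by (rule nn_integral_cmult) simp
    finally have "ennreal 2 * (\<integral>\<^sup>+x. ennreal (1 / (1 + x\<^sup>2)) \<partial>lborel) = ennreal 2 * ennreal pi"
      by (simp add: ennreal_mult)
    then show ?thesis by (subst (asm) ennreal_mult_cancel_left) auto
  qed
  have "(\<integral>\<^sup>+x. ennreal (1 / (x\<^sup>2 + e\<^sup>2)) \<partial>lborel) = ennreal \<bar>e\<bar> * (\<integral>\<^sup>+x. ennreal (1 / ((0 + e * x)\<^sup>2 + e\<^sup>2)) \<partial>lborel)"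
    by (rule nn_integral_real_affine) (use assms in auto)
  also have "\<dots> = ennreal e * (\<integral>\<^sup>+x. ennreal (1 / e\<^sup>2) * ennreal (1 / (1 + x\<^sup>2)) \<partial>lborel)"
  proof -
    have "ennreal (1 / ((0 + e * x)\<^sup>2 + e\<^sup>2)) = ennreal (1 / e\<^sup>2) * ennreal (1 / (1 + x\<^sup>2))" for x
    proof -
      have "1 / ((0 + e * x)\<^sup>2 + e\<^sup>2) = 1 / e\<^sup>2 * (1 / (1 + x\<^sup>2))"
        using assms by (simp add: power_mult_distrib field_simps)
      then show ?thesis by (simp only: ennreal_mult' zero_le_divide_1_iff zero_le_power2)
    qed
    then show ?thesis using assms by simp
  qed
  also have "\<dots> = ennreal e * (ennreal (1 / e\<^sup>2) * ennreal pi)"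
    by (subst nn_integral_cmult) (auto simp: 1)
  also have "\<dots> = ennreal (pi / e)"
    using assms by (simp add: power2_eq_square flip: ennreal_mult)
  finally show ?thesis .
qed

lemma nn_integral_lorentz_prod:
  assumes c: "0 \<le> c" and ab: "0 < a" "0 < b"
  shows "(\<integral>\<^sup>+x. \<integral>\<^sup>+y. ennreal (c / ((x\<^sup>2 + a\<^sup>2) * (y\<^sup>2 + b\<^sup>2))) \<partial>lborel \<partial>lborel) = ennreal (c * pi\<^sup>2 / (a * b))"
proof -
  have "ennreal (c / ((x\<^sup>2 + a\<^sup>2) * (y\<^sup>2 + b\<^sup>2))) = ennreal c * ennreal (1 / (x\<^sup>2 + a\<^sup>2)) * ennreal (1 / (y\<^sup>2 + b\<^sup>2))" for x y
    using c by (simp flip: ennreal_mult)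
  then have "(\<integral>\<^sup>+x. \<integral>\<^sup>+y. ennreal (c / ((x\<^sup>2 + a\<^sup>2) * (y\<^sup>2 + b\<^sup>2))) \<partial>lborel \<partial>lborel)
     = (\<integral>\<^sup>+x. \<integral>\<^sup>+y. ennreal c * ennreal (1 / (x\<^sup>2 + a\<^sup>2)) * ennreal (1 / (y\<^sup>2 + b\<^sup>2)) \<partial>lborel \<partial>lborel)"
    by (simp only:)
  also have "\<dots> = (\<integral>\<^sup>+x. ennreal c * ennreal (1 / (x\<^sup>2 + a\<^sup>2)) * ennreal (pi / b) \<partial>lborel)"
    by (subst nn_integral_cmult) (simp_all only: nn_integral_lorentz[OF ab(2)], simp)
  also have "\<dots> = (\<integral>\<^sup>+x. ennreal c * ennreal (1 / (x\<^sup>2 + a\<^sup>2)) \<partial>lborel) * ennreal (pi / b)"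
    by (rule nn_integral_multc) simp
  also have "\<dots> = ennreal c * ennreal (pi / a) * ennreal (pi / b)"
    by (subst nn_integral_cmult) (simp_all only: nn_integral_lorentz[OF ab(1)], simp)
  also have "\<dots> = ennreal (c * (pi / a) * (pi / b))"
    using c ab by (simp only: ennreal_mult[symmetric] mult_nonneg_nonneg divide_nonneg_pos pi_ge_zero)
  also have "c * (pi / a) * (pi / b) = c * pi\<^sup>2 / (a * b)" by (simp add: power2_eq_square)
  finally show ?thesis .
qed

lemma seminorm_sq_lorentz_bound:
  assumes c: "0 \<le> c" and ab: "0 < a" "0 < b"
    and le: "\<And>x y. (cmod (w x - w y))\<^sup>2 \<le> c * (x - y)\<^sup>2 / ((x\<^sup>2 + a\<^sup>2) * (y\<^sup>2 + b\<^sup>2))"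
  shows "seminorm_sq w \<le> ennreal (c * pi\<^sup>2 / (a * b))"
  unfolding seminorm_sq_def nn_integral_completion nn_integral_lorentz_prod[OF c ab, symmetric]
proof (intro nn_integral_mono ennreal_leI)
  fix x y :: real
  show "(cmod (w x - w y))\<^sup>2 / (x - y)\<^sup>2 \<le> c / ((x\<^sup>2 + a\<^sup>2) * (y\<^sup>2 + b\<^sup>2))"
    using divide_right_mono[OF le[of x y], of "(x - y)\<^sup>2"] c by (cases "x = y") simp_all
qed

lemma bubble_S1_map: assumes "e > 0" shows "S1_map (bubble e)" "En (bubble e) \<le> 2 * pi"
proof -
  have "seminorm_sq (bubble e) \<le> ennreal (4 * e\<^sup>2 * pi\<^sup>2 / (e * e))"
    by (rule seminorm_sq_lorentz_bound) (use assms in \<open>auto simp: bubble_lip\<close>)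
  also have "4 * e\<^sup>2 * pi\<^sup>2 / (e * e) = 2 * pi * (2 * pi)" using assms by (simp add: power2_eq_square)
  finally have s: "seminorm_sq (bubble e) \<le> ennreal (2 * pi * (2 * pi))" .
  show "En (bubble e) \<le> 2 * pi" by (rule En_le(1)[OF s]) simp
  show "S1_map (bubble e)" unfolding S1_map_def using En_le(2)[OF s] cmod_bubble assms by auto
qed

text \<open>
  Both bounds depend only on the quotient of the scales, so the homotopy in \<open>deg_bubble\<close> may pass through
  all positive scales.
\<close>

lemma bubble_change:
  assumes e: "e > 0" "e' > 0"
  shows "cmod (bubble e x - bubble e' x) \<le> 2 * \<bar>e - e'\<bar> / e'"
    and "En (\<lambda>x. bubble e x - bubble e' x) \<le> 2 * pi * (e - e')\<^sup>2 / (e * e')"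
    and "seminorm_sq (\<lambda>x. bubble e x - bubble e' x) < \<infinity>"
proof -
  have pos: "0 < x\<^sup>2 + e\<^sup>2" "0 < x\<^sup>2 + e'\<^sup>2" for x using e by (simp_all add: add_nonneg_pos)
  have nz: "of_real x + \<i> * of_real e \<noteq> 0" "of_real x + \<i> * of_real e' \<noteq> 0" for x
    using bubble_denom e by auto
  have "bubble e x - bubble e' x = - 2 * \<i> * of_real x * of_real (e - e') / ((of_real x + \<i> * of_real e) * (of_real x + \<i> * of_real e'))"
    unfolding bubble_def using nz by (simp add: field_simps)
  then have sq: "(cmod (bubble e x - bubble e' x))\<^sup>2 = 4 * x\<^sup>2 * (e - e')\<^sup>2 / ((x\<^sup>2 + e\<^sup>2) * (x\<^sup>2 + e'\<^sup>2))"
    by (simp add: norm_divide norm_mult power_divide power_mult_distrib cmod_real_plus_ii flip: of_real_diff)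
  also have "\<dots> = 4 * (e - e')\<^sup>2 * (x\<^sup>2 / (x\<^sup>2 + e\<^sup>2)) * (1 / (x\<^sup>2 + e'\<^sup>2))" by simp
  also have "\<dots> \<le> 4 * (e - e')\<^sup>2 * 1 * (1 / e'\<^sup>2)"
    using pos[of x] e by (intro mult_mono mult_left_mono) (auto simp: divide_simps)
  also have "\<dots> = (2 * \<bar>e - e'\<bar> / e')\<^sup>2" by (simp add: power_mult_distrib power_divide)
  finally show "cmod (bubble e x - bubble e' x) \<le> 2 * \<bar>e - e'\<bar> / e'"
    using e by (simp add: power2_le_iff_abs_le divide_nonneg_pos abs_le_square_iff[symmetric])
  have "(cmod ((bubble e x - bubble e' x) - (bubble e y - bubble e' y)))\<^sup>2 \<le> 4 * (e - e')\<^sup>2 * (x - y)\<^sup>2 / ((x\<^sup>2 + e'\<^sup>2) * (y\<^sup>2 + e\<^sup>2))" for x y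
  proof -
    have "(bubble e x - bubble e' x) - (bubble e y - bubble e' y) = (bubble e x - bubble e y) - (bubble e' x - bubble e' y)" by simp
    also have "\<dots> = 2 * \<i> * of_real (x - y) * of_real (e - e') * of_real (x * y + e * e')
       / ((of_real x + \<i> * of_real e) * (of_real y + \<i> * of_real e) * ((of_real x + \<i> * of_real e') * (of_real y + \<i> * of_real e')))"
    proof -
      define X Y X' Y' where "X = of_real x + \<i> * of_real e" and "Y = of_real y + \<i> * of_real e"
        and "X' = of_real x + \<i> * of_real e'" and "Y' = of_real y + \<i> * of_real e'"
      have n: "X \<noteq> 0" "Y \<noteq> 0" "X' \<noteq> 0" "Y' \<noteq> 0" using nz by (auto simp: X_def Y_def X'_def Y'_def)
      have id: "of_real e * (X' * Y') - of_real e' * (X * Y) = of_real (e - e') * of_real (x * y + e * e')"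
        unfolding X_def Y_def X'_def Y'_def by (simp add: algebra_simps)
      have "2 * \<i> * of_real e * of_real (x - y) / (X * Y) - 2 * \<i> * of_real e' * of_real (x - y) / (X' * Y')
         = 2 * \<i> * of_real (x - y) * (of_real e * (X' * Y') - of_real e' * (X * Y)) / (X * Y * (X' * Y'))"
        using n by (simp add: field_simps)
      moreover have "bubble e x - bubble e y = 2 * \<i> * of_real e * of_real (x - y) / (X * Y)"
        unfolding X_def Y_def by (rule bubble_diff_point) (use e in simp)
      moreover have "bubble e' x - bubble e' y = 2 * \<i> * of_real e' * of_real (x - y) / (X' * Y')"
        unfolding X'_def Y'_def by (rule bubble_diff_point) (use e in simp)
      ultimately have "(bubble e x - bubble e y) - (bubble e' x - bubble e' y) = 2 * \<i> * of_real (x - y) * (of_real (e - e') * of_real (x * y + e * e')) / (X * Y * (X' * Y'))"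
        unfolding id by simp
      then show ?thesis unfolding X_def Y_def X'_def Y'_def by (simp only: mult.assoc)
    qed
    also have "(cmod \<dots>)\<^sup>2 = 4 * (x - y)\<^sup>2 * (e - e')\<^sup>2 * (x * y + e * e')\<^sup>2 / ((x\<^sup>2 + e\<^sup>2) * (y\<^sup>2 + e\<^sup>2) * ((x\<^sup>2 + e'\<^sup>2) * (y\<^sup>2 + e'\<^sup>2)))"
      unfolding norm_divide norm_mult power_divide power_mult_distrib cmod_real_plus_ii norm_of_real power2_abs by simp
    also have "\<dots> \<le> 4 * (x - y)\<^sup>2 * (e - e')\<^sup>2 * ((x\<^sup>2 + e\<^sup>2) * (y\<^sup>2 + e'\<^sup>2)) / ((x\<^sup>2 + e\<^sup>2) * (y\<^sup>2 + e\<^sup>2) * ((x\<^sup>2 + e'\<^sup>2) * (y\<^sup>2 + e'\<^sup>2)))"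
    proof (intro divide_right_mono mult_left_mono)
      show "(x * y + e * e')\<^sup>2 \<le> (x\<^sup>2 + e\<^sup>2) * (y\<^sup>2 + e'\<^sup>2)"
        using zero_le_power2[of "x * e' - e * y"] by (simp add: power2_eq_square algebra_simps)
    qed (use pos in \<open>auto intro!: mult_nonneg_nonneg less_imp_le\<close>)
    also have "\<dots> = 4 * (e - e')\<^sup>2 * (x - y)\<^sup>2 / ((x\<^sup>2 + e'\<^sup>2) * (y\<^sup>2 + e\<^sup>2))"
    proof -
      have "k * (A * D) / (A * B * (C * D)) = k / (C * B)" if "0 < A" "0 < D" for A B C D k :: real
        using that by (simp add: field_simps)
      from this[OF pos(1)[of x] pos(2)[of y], of "4 * (x - y)\<^sup>2 * (e - e')\<^sup>2" "y\<^sup>2 + e\<^sup>2" "x\<^sup>2 + e'\<^sup>2"]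
      show ?thesis by (simp only: mult.assoc mult.commute[of "(x - y)\<^sup>2"])
    qed
    finally show ?thesis .
  qed
  then have "seminorm_sq (\<lambda>x. bubble e x - bubble e' x) \<le> ennreal (4 * (e - e')\<^sup>2 * pi\<^sup>2 / (e' * e))"
    by (intro seminorm_sq_lorentz_bound) (use e in auto)
  also have "4 * (e - e')\<^sup>2 * pi\<^sup>2 / (e' * e) = 2 * pi * (2 * pi * (e - e')\<^sup>2 / (e * e'))"
    by (simp add: power2_eq_square mult_ac)
  finally have s: "seminorm_sq (\<lambda>x. bubble e x - bubble e' x) \<le> ennreal (2 * pi * (2 * pi * (e - e')\<^sup>2 / (e * e')))" .
  have "0 \<le> 2 * pi * (e - e')\<^sup>2 / (e * e')" using e by simp
  from En_le[OF s this] show "En (\<lambda>x. bubble e x - bubble e' x) \<le> 2 * pi * (e - e')\<^sup>2 / (e * e')"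
    and "seminorm_sq (\<lambda>x. bubble e x - bubble e' x) < \<infinity>" by auto
qed

lemma coef_shift: "coef (\<lambda>x. u x * chr 1 x) k = coef u (k - 1)"
proof -
  have e: "u x * chr 1 x * chr (- k) x = u x * chr (- (k - 1)) x" for x
    using chr_add[of 1 "- k" x] by (simp add: mult.assoc)
  show ?thesis by (simp only: coef_def e)
qed

text \<open>
  Multiplication by the first character shifts the indices by one; the additional 1 is Parseval's
  identity.
\<close>

lemma deg_shift:
  assumes u: "S1_map u" and u': "S1_map (\<lambda>x. u x * chr 1 x)" shows "deg (\<lambda>x. u x * chr 1 x) = deg u + 1"
proof -
  have "((\<lambda>k. of_int k * (cmod (coef u k))\<^sup>2 + (cmod (coef u k))\<^sup>2) has_sum (2 * pi * deg u + 2 * pi)) UNIV"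
    by (intro has_sum_add deg_has_sum S1_map_parseval u)
  moreover have "bij_betw (\<lambda>k. k - 1) UNIV (UNIV :: int set)"
    by (rule bij_betwI[where g = "\<lambda>k. k + 1"]) auto
  ultimately have "((\<lambda>k. of_int (k - 1) * (cmod (coef u (k - 1)))\<^sup>2 + (cmod (coef u (k - 1)))\<^sup>2) has_sum (2 * pi * deg u + 2 * pi)) UNIV"
    using has_sum_reindex_bij_betw[of "\<lambda>k. k - 1" UNIV UNIV "\<lambda>k. of_int k * (cmod (coef u k))\<^sup>2 + (cmod (coef u k))\<^sup>2"] by fastforce
  then have "((\<lambda>k. of_int k * (cmod (coef (\<lambda>x. u x * chr 1 x) k))\<^sup>2) has_sum (2 * pi * deg u + 2 * pi)) UNIV"
    by (simp add: coef_shift algebra_simps)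
  from has_sum_unique[OF this deg_has_sum[OF u']] have "2 * pi * (deg u + 1) = 2 * pi * deg (\<lambda>x. u x * chr 1 x)"
    by (simp add: algebra_simps)
  then show ?thesis by simp
qed

lemma chr_1_bubble: "chr 1 x = \<i> * bubble 1 x"
  by (simp add: chr_1 bubble_def)

lemma deg_const_mult: "cmod c = 1 \<Longrightarrow> deg (\<lambda>x. c * u x) = deg u"
proof -
  assume c: "cmod c = 1"
  have "coef (\<lambda>x. c * u x) k = c * coef u k" for k by (simp add: coef_def mult.assoc)
  then show ?thesis unfolding deg_def using c by (simp add: norm_mult)
qed

lemma seminorm_sq_const_mult: "cmod c = 1 \<Longrightarrow> seminorm_sq (\<lambda>x. c * u x) = seminorm_sq u"
  unfolding seminorm_sq_def by (simp add: norm_mult flip: right_diff_distrib)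

lemma S1_map_const_mult: assumes "S1_map u" "cmod c = 1" shows "S1_map (\<lambda>x. c * u x)"
  using assms seminorm_sq_const_mult[of c u] by (auto simp: S1_map_def norm_mult)

lemma En_const_mult: "cmod c = 1 \<Longrightarrow> En (\<lambda>x. c * u x) = En u"
  by (simp add: En_def seminorm_sq_const_mult)

text \<open>
  The degree of \<open>u\<close> times the bubble of scale \<open>t\<close> is locally constant in \<open>t\<close> by \<open>deg_close\<close>, and the
  bubble of scale 1 is the first character up to a constant factor.
\<close>

theorem deg_bubble:
  assumes u: "S1_map u" and e: "e > 0" shows "deg (\<lambda>x. u x * bubble e x) = deg u + 1"
proof -
  let ?v = "\<lambda>t x. u x * bubble t x"
  (* L bounds the energies of all products. Q is chosen so that a relative change of the scale by
     1 / (2 * Q) satisfies the hypothesis of deg_close. *)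
  define L where "L = 2 * En u + 4 * pi + 1"
  define Q where "Q = L * (8 * En u + 8 * pi) + 1"
  have L: "0 < L" using En_nonneg[of u] by (simp add: L_def add_nonneg_pos)
  have Q: "1 \<le> Q" using En_nonneg[of u] L by (simp add: Q_def)
  have nv: "S1_map (?v t)" "En (?v t) \<le> L" if "t > 0" for t
    using S1_map_mult[OF u bubble_S1_map(1)[OF that]] bubble_S1_map(2)[OF that] by (auto simp: L_def)
  have loc: "deg (?v t') = deg (?v t)" if t: "t > 0" "t' > 0" "\<bar>t' - t\<bar> < t / (2 * Q)" for t t'
  proof (rule deg_close[OF nv(1) nv(1) nv(2) nv(2) L])
    have "t / (2 * Q) \<le> t / 2" using t Q by (simp add: divide_simps)
    then have t2: "t / 2 \<le> t'" using t by linarith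
    define q where "q = (\<bar>t' - t\<bar> / t)\<^sup>2"
    have "En (\<lambda>x. u x * (bubble t' x - bubble t x)) \<le> 2 * (2 * \<bar>t' - t\<bar> / t)\<^sup>2 * En u + 2 * En (\<lambda>x. bubble t' x - bubble t x)"
      by (rule En_mult_le[OF u]) (use bubble_change[OF t(2,1)] in auto)
    moreover have "2 * (2 * \<bar>t' - t\<bar> / t)\<^sup>2 * En u = 8 * En u * q"
      by (simp add: q_def power_divide power_mult_distrib)
    moreover have "En (\<lambda>x. bubble t' x - bubble t x) \<le> 4 * pi * q"
    proof -
      have "En (\<lambda>x. bubble t' x - bubble t x) \<le> 2 * pi * (t' - t)\<^sup>2 / (t' * t)" by (rule bubble_change[OF t(2,1)])
      also have "\<dots> \<le> 2 * pi * (t' - t)\<^sup>2 / (t / 2 * t)" using t t2 by (intro divide_left_mono mult_right_mono) auto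
      also have "\<dots> = 4 * pi * q" by (simp add: q_def power_divide power2_eq_square)
      finally show ?thesis .
    qed
    ultimately have "En (\<lambda>x. u x * (bubble t' x - bubble t x)) \<le> (8 * En u + 8 * pi) * (\<bar>t' - t\<bar> / t)\<^sup>2"
      unfolding q_def[symmetric] by (simp add: distrib_right)
    then have "L * En (\<lambda>x. u x * (bubble t' x - bubble t x)) \<le> L * ((8 * En u + 8 * pi) * (\<bar>t' - t\<bar> / t)\<^sup>2)"
      using L by (intro mult_left_mono) auto
    also have "\<dots> \<le> Q * (\<bar>t' - t\<bar> / t)\<^sup>2" by (simp add: Q_def algebra_simps)
    also have "\<dots> \<le> Q * (1 / (2 * Q))\<^sup>2"
    proof (intro mult_left_mono power_mono)
      show "\<bar>t' - t\<bar> / t \<le> 1 / (2 * Q)" using t Q by (simp add: field_simps)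
    qed (use t Q in auto)
    also have "\<dots> < 5" using Q by (simp add: power2_eq_square divide_simps)
    finally show "L * En (\<lambda>x. u x * bubble t' x - u x * bubble t x) < 5" by (simp add: right_diff_distrib)
  qed (use t in auto)
  have "\<exists>c. \<forall>t\<in>{0<..}. deg (?v t) = c"
  proof (rule has_field_derivative_zero_constant)
    fix t :: real assume t: "t \<in> {0<..}"
    have "((\<lambda>_. deg (?v t)) has_field_derivative 0) (at t within {0<..})" by simp
    then show "((\<lambda>t. deg (?v t)) has_field_derivative 0) (at t within {0<..})"
    proof (rule has_field_derivative_transform_within[where d = "t / (2 * Q)"])
      show "0 < t / (2 * Q)" using t Q by simp
      show "deg (?v t) = deg (?v t')" if "t' \<in> {0<..}" "dist t' t < t / (2 * Q)" for t'
        using loc[of t t'] that t by (simp add: dist_real_def)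
    qed (use t in auto)
  qed auto
  then have "deg (?v e) = deg (?v 1)" using e by (metis greaterThan_iff zero_less_one)
  also have "\<dots> = deg (\<lambda>x. \<i> * (u x * bubble 1 x))" by (rule deg_const_mult[symmetric]) simp
  also have "(\<lambda>x. \<i> * (u x * bubble 1 x)) = (\<lambda>x. u x * chr 1 x)" by (simp add: chr_1_bubble fun_eq_iff)
  also have "deg \<dots> = deg u + 1"
  proof (rule deg_shift[OF u])
    have "S1_map (\<lambda>x. \<i> * (u x * bubble 1 x))" by (rule S1_map_const_mult[OF nv(1)]) auto
    then show "S1_map (\<lambda>x. u x * chr 1 x)" by (simp add: chr_1_bubble mult_ac)
  qed
  finally show ?thesis .
qed

section \<open>Unique continuation\<close>

text \<open>
  For \<open>G\<close> supported in \<open>{-1..1}\<close> these are, up to factorials, the derivatives of the Cauchy transform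
  of \<open>G\<close> with respect to \<open>circ\<close>.
\<close>

definition cauchy_tr :: "(real \<Rightarrow> complex) \<Rightarrow> nat \<Rightarrow> complex \<Rightarrow> complex" where
  "cauchy_tr G m \<zeta> = (\<integral>x. G x * (1 / (of_real x - \<zeta>)) ^ Suc m \<partial>circ)"

abbreviation slit :: "complex set" where "slit \<equiv> closed_segment (- 1) 1"

lemma of_real_in_slit: "x \<in> {-1..1} \<Longrightarrow> of_real x \<in> slit"
  using of_real_closed_segment[where 'a = complex, of x "-1" 1] by (simp add: closed_segment_eq_real_ivl)

lemma slit_dist:
  assumes "\<zeta> \<notin> slit"
  obtains d where "d > 0" "\<And>x. x \<in> {-1..1} \<Longrightarrow> d \<le> cmod (of_real x - \<zeta>)"
proof -
  have "open (- slit)" by (simp add: open_Compl)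
  then obtain d where d: "d > 0" "ball \<zeta> d \<subseteq> - slit" using assms by (meson ComplI openE)
  have "d \<le> cmod (of_real x - \<zeta>)" if "x \<in> {-1..1}" for x
  proof (rule ccontr)
    assume "\<not> d \<le> cmod (of_real x - \<zeta>)"
    then have "of_real x \<in> ball \<zeta> d" by (simp add: dist_norm norm_minus_commute)
    then show False using d(2) of_real_in_slit[OF that] by auto
  qed
  then show thesis using d(1) that by blast
qed

lemma cauchy_tr_deriv:
  assumes [measurable]: "G \<in> borel_measurable borel" and b: "\<And>x. cmod (G x) \<le> C"
    and supp: "\<And>x. x \<notin> {-1..1} \<Longrightarrow> G x = 0" and z: "\<zeta> \<notin> slit"
  shows "(cauchy_tr G m has_field_derivative of_nat (Suc m) * cauchy_tr G (Suc m) \<zeta>) (at \<zeta>)"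
proof -
  have C: "0 \<le> C" using b[of 0] norm_ge_zero order_trans by blast
  obtain d where d: "d > 0" "\<And>x. x \<in> {-1..1} \<Longrightarrow> d \<le> cmod (of_real x - \<zeta>)" using slit_dist[OF z] by blast
  have near: "d / 2 \<le> cmod (of_real x - (\<zeta> + h))" if "x \<in> {-1..1}" "cmod h < d / 2" for x h
    using norm_triangle_ineq2[of "of_real x - \<zeta>" h] d(2)[OF that(1)] that(2) by (simp add: algebra_simps)
  have inv: "cmod (1 / (of_real x - (\<zeta> + h))) \<le> 2 / d" if "x \<in> {-1..1}" "cmod h < d / 2" for x h
    using near[OF that] d(1) by (simp add: norm_divide divide_simps)
  define F where "F h m x = G x * (1 / (of_real x - (\<zeta> + h))) ^ Suc m" for h m x
  have Fb: "cmod (F h m x) \<le> C * (2 / d) ^ Suc m" if "cmod h < d / 2" for h m x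
  proof (cases "x \<in> {-1..1}")
    case True
    show ?thesis unfolding F_def norm_mult norm_power
      by (intro mult_mono power_mono b inv True that) (use C in auto)
  qed (use supp C d in \<open>simp add: F_def\<close>)
  have [measurable]: "F h m \<in> borel_measurable borel" for h m unfolding F_def by measurable
  have Fi: "integrable circ (F h m)" if "cmod h < d / 2" for h m
    by (rule integrable_circ_bounded[where B = "C * (2 / d) ^ Suc m"]) (use Fb that in auto)
  have tr: "cauchy_tr G m (\<zeta> + h) = (\<integral>x. F h m x \<partial>circ)" for h m by (simp add: cauchy_tr_def F_def)
  have quot: "cmod ((F h m x - F 0 m x) / h) \<le> C * (real (Suc m) * (2 / d) ^ Suc (Suc m))" if h: "cmod h < d / 2" "h \<noteq> 0" for h x
  proof (cases "x \<in> {-1..1}")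
    case True
    let ?a = "1 / (of_real x - (\<zeta> + h))" and ?b = "1 / (of_real x - (\<zeta> + 0))"
    have nz: "of_real x - (\<zeta> + h) \<noteq> 0" "of_real x - \<zeta> \<noteq> 0"
      using near[OF True h(1)] near[OF True, of 0] d(1) by auto
    have ab: "cmod ?a \<le> 2 / d" "cmod ?b \<le> 2 / d" using inv[OF True h(1)] inv[OF True, of 0] d(1) by auto
    have "?a - ?b = h * (?a * ?b)" using nz by (simp add: field_simps)
    moreover have "?a ^ Suc m - ?b ^ Suc m = (?a - ?b) * (\<Sum>i<Suc m. ?b ^ (m - i) * ?a ^ i)"
      using power_diff_sumr2[of ?a "Suc m" ?b] by (simp only: diff_Suc_Suc)
    moreover have "F h m x - F 0 m x = G x * (?a ^ Suc m - ?b ^ Suc m)" by (simp only: F_def right_diff_distrib)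
    ultimately have "F h m x - F 0 m x = h * (G x * (?a * ?b * (\<Sum>i<Suc m. ?b ^ (m - i) * ?a ^ i)))"
      by (simp only: mult_ac)
    then have "(F h m x - F 0 m x) / h = G x * (?a * ?b * (\<Sum>i<Suc m. ?b ^ (m - i) * ?a ^ i))"
      using h(2) by simp
    also have "cmod \<dots> \<le> C * ((2 / d * (2 / d)) * (real (Suc m) * (2 / d) ^ m))"
      unfolding norm_mult
    proof (intro mult_mono b ab)
      have "cmod (\<Sum>i<Suc m. ?b ^ (m - i) * ?a ^ i) \<le> (\<Sum>i<Suc m. (2 / d) ^ m)"
      proof (rule sum_norm_le)
        fix i assume "i \<in> {..<Suc m}"
        then have i: "m = (m - i) + i" by simp
        have "cmod (?b ^ (m - i) * ?a ^ i) \<le> (2 / d) ^ (m - i) * (2 / d) ^ i"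
          unfolding norm_mult norm_power by (intro mult_mono power_mono ab) (use d in auto)
        also have "\<dots> = (2 / d) ^ m" using i by (metis power_add)
        finally show "cmod (?b ^ (m - i) * ?a ^ i) \<le> (2 / d) ^ m" .
      qed
      then show "cmod (\<Sum>i<Suc m. ?b ^ (m - i) * ?a ^ i) \<le> real (Suc m) * (2 / d) ^ m" by simp
    qed (use C d in auto)
    finally show ?thesis by (simp add: mult_ac)
  qed (use supp C d in \<open>simp add: F_def\<close>)
  have lim: "(\<lambda>n. (cauchy_tr G m (\<zeta> + h n) - cauchy_tr G m \<zeta>) / h n) \<longlonglongrightarrow> of_nat (Suc m) * cauchy_tr G (Suc m) \<zeta>"
    if h: "\<And>n. h n \<noteq> 0" "h \<longlonglongrightarrow> 0" "\<And>n. cmod (h n) < d / 2" for h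
  proof -
    have "(\<lambda>n. \<integral>x. (F (h n) m x - F 0 m x) / h n \<partial>circ) \<longlonglongrightarrow> (\<integral>x. of_nat (Suc m) * F 0 (Suc m) x \<partial>circ)"
    proof (rule integral_dominated_convergence[where w = "\<lambda>x. C * (real (Suc m) * (2 / d) ^ Suc (Suc m))"])
      show "AE x in circ. (\<lambda>n. (F (h n) m x - F 0 m x) / h n) \<longlonglongrightarrow> of_nat (Suc m) * F 0 (Suc m) x"
      proof (rule AE_I2)
        fix x
        show "(\<lambda>n. (F (h n) m x - F 0 m x) / h n) \<longlonglongrightarrow> of_nat (Suc m) * F 0 (Suc m) x"
        proof (cases "x \<in> {-1..1}")
          case True
          then have nz: "of_real x - \<zeta> \<noteq> 0" using d by force
          have "((\<lambda>h. G x * (1 / (of_real x - (\<zeta> + h))) ^ Suc m) has_field_derivative of_nat (Suc m) * F 0 (Suc m) x) (at 0)"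
            unfolding F_def using nz
            by (auto intro!: derivative_eq_intros simp: field_simps power2_eq_square simp del: power_Suc)
              (simp add: field_simps)
          then have "((\<lambda>k. (F k m x - F 0 m x) / k) \<longlongrightarrow> of_nat (Suc m) * F 0 (Suc m) x) (at 0)"
            unfolding has_field_derivative_iff F_def by simp
          from filterlim_compose[OF this, of h sequentially] h show ?thesis
            by (simp add: filterlim_at)
        qed (use supp in \<open>simp add: F_def\<close>)
      qed
      show "AE x in circ. norm ((F (h n) m x - F 0 m x) / h n) \<le> C * (real (Suc m) * (2 / d) ^ Suc (Suc m))" for n
        using quot h by auto
    qed auto
    moreover have e1: "(\<integral>x. (F (h n) m x - F 0 m x) / h n \<partial>circ) = (cauchy_tr G m (\<zeta> + h n) - cauchy_tr G m \<zeta>) / h n" for n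
      using tr[of m "h n"] tr[of m 0] Fi[of "h n" m] Fi[of 0 m] h d(1) by simp
    moreover have e2: "(\<integral>x. of_nat (Suc m) * F 0 (Suc m) x \<partial>circ) = of_nat (Suc m) * cauchy_tr G (Suc m) \<zeta>"
      using tr[of "Suc m" 0] by simp
    ultimately show ?thesis unfolding e1 e2 by blast
  qed
  have "((\<lambda>h. (cauchy_tr G m (\<zeta> + h) - cauchy_tr G m \<zeta>) / h) \<longlongrightarrow> of_nat (Suc m) * cauchy_tr G (Suc m) \<zeta>) (at 0 within ball 0 (d / 2))"
    unfolding tendsto_at_iff_sequentially o_def
  proof (intro allI impI)
    fix h :: "nat \<Rightarrow> complex" assume h: "\<forall>i. h i \<in> ball 0 (d / 2) - {0}" "h \<longlonglongrightarrow> 0"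
    show "(\<lambda>n. (cauchy_tr G m (\<zeta> + h n) - cauchy_tr G m \<zeta>) / h n) \<longlonglongrightarrow> of_nat (Suc m) * cauchy_tr G (Suc m) \<zeta>"
    proof (rule lim)
      show "h n \<noteq> 0" "cmod (h n) < d / 2" for n using h(1)[THEN spec, of n] by simp_all
    qed (rule h(2))
  qed
  moreover have "at 0 within ball 0 (d / 2) = at (0 :: complex)"
    by (rule at_within_open) (use d(1) in auto)
  ultimately show ?thesis unfolding DERIV_def by (simp only:)
qed

lemma cauchy_tr_continuation:
  assumes G: "G \<in> borel_measurable borel" "\<And>x. cmod (G x) \<le> C" "\<And>x. x \<notin> {-1..1} \<Longrightarrow> G x = 0"
    and z: "\<zeta>0 \<notin> slit" and zero: "\<And>m. cauchy_tr G m \<zeta>0 = 0" and w: "\<zeta> \<notin> slit"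
  shows "cauchy_tr G m \<zeta> = 0"
proof -
  let ?U = "- slit"
  have U: "open ?U" by (simp add: open_Compl)
  have conn: "connected ?U"
    by (rule connected_complement_bounded_convex) (auto simp: bounded_closed_segment)
  note der = cauchy_tr_deriv[OF G]
  have hol: "cauchy_tr G 0 holomorphic_on ?U"
    unfolding holomorphic_on_open[OF U] using der[of _ 0] by blast
  have hd: "(deriv ^^ n) (cauchy_tr G 0) \<xi> = of_nat (fact n) * cauchy_tr G n \<xi>" if "\<xi> \<in> ?U" for n \<xi>
    using that
  proof (induction n arbitrary: \<xi>)
    case (Suc n)
    have "((\<lambda>\<xi>. of_nat (fact n) * cauchy_tr G n \<xi>) has_field_derivative of_nat (fact n) * (of_nat (Suc n) * cauchy_tr G (Suc n) \<xi>)) (at \<xi>)"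
      by (rule DERIV_cmult[OF der]) (use Suc.prems in auto)
    then have "((deriv ^^ n) (cauchy_tr G 0) has_field_derivative of_nat (fact n) * (of_nat (Suc n) * cauchy_tr G (Suc n) \<xi>)) (at \<xi>)"
      by (rule has_field_derivative_transform_within_open[OF _ U]) (use Suc in auto)
    then show ?case by (simp add: DERIV_imp_deriv algebra_simps)
  qed simp
  have z0: "cauchy_tr G 0 \<xi> = 0" if "\<xi> \<in> ?U" for \<xi>
    by (rule holomorphic_fun_eq_0_on_connected[OF hol U conn _ _ that, of \<zeta>0]) (use hd zero z in auto)
  have "cauchy_tr G n \<xi> = 0" if "\<xi> \<in> ?U" for n \<xi>
    using that
  proof (induction n arbitrary: \<xi>)
    case (Suc n)
    have "((\<lambda>_. 0) has_field_derivative of_nat (Suc n) * cauchy_tr G (Suc n) \<xi>) (at \<xi>)"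
      by (rule has_field_derivative_transform_within_open[OF der U]) (use Suc in auto)
    then have "of_nat (Suc n) * cauchy_tr G (Suc n) \<xi> = 0"
      using DERIV_unique[OF _ DERIV_const] by blast
    then show ?case by (simp del: of_nat_Suc)
  qed (use z0 in auto)
  then show ?thesis using w by auto
qed

lemma chr_bubble_power: "chr (int n) x = \<i> ^ n * bubble 1 x ^ n"
  using chr_1_power(1)[of x n] by (simp add: chr_1_bubble power_mult_distrib)

text \<open>
  A function without negative frequencies is the boundary value of a holomorphic function and cannot
  vanish on an arc unless it is zero. In terms of Cauchy transforms: the vanishing of the negative
  coefficients says that all derivatives of one such transform vanish at \<open>- \<i>\<close>. As the support lies in
  the slit, the transform is holomorphic on the connected complement of the slit, hence zero there. Its
  derivatives at \<open>\<i>\<close> give the other coefficients, and Parseval's identity concludes.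
\<close>

theorem hardy_vanishing:
  assumes wm [measurable]: "w \<in> borel_measurable borel" and b: "\<And>x. cmod (w x) \<le> C" and fin: "seminorm_sq w < \<infinity>"
    and supp: "\<And>x. x \<notin> {-1..1} \<Longrightarrow> w x = 0"
    and neg: "\<And>k. k < 0 \<Longrightarrow> coef w k = 0"
  shows "AE x in lborel. w x = 0"
proof -
  have C: "0 \<le> C" using b[of 0] norm_ge_zero order_trans by blast
  (* The factor x - \<i> supplies a bubble in the kernel at - \<i> and cancels one power of the kernel at \<i>,
     so one transform yields the moments of w against both families of functions. *)
  define G where "G x = w x * (of_real x - \<i>)" for x
  have Gm: "G \<in> borel_measurable borel" unfolding G_def by measurable
  have Gs: "G x = 0" if "x \<notin> {-1..1}" for x using supp[OF that] by (simp add: G_def)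
  have Gb: "cmod (G x) \<le> C * 2" for x
  proof (cases "x \<in> {-1..1}")
    case True
    have "cmod (of_real x - \<i>) \<le> \<bar>x\<bar> + 1" using norm_triangle_ineq4[of "of_real x" \<i>] by simp
    also have "\<dots> \<le> 2" using True by auto
    finally show ?thesis unfolding G_def norm_mult using b[of x] C by (intro mult_mono) auto
  qed (use Gs C in simp)
  have nz: "of_real x + \<i> \<noteq> 0" "of_real x - \<i> \<noteq> 0" for x by (auto simp: complex_eq_iff)
  (* The coefficients of index -1, -2, ... are the moments against positive powers of the bubble. *)
  have up: "(\<integral>x. w x * (bubble 1 x) ^ Suc n \<partial>circ) = 0" for n
  proof -
    have "(\<integral>x. w x * chr (- (- int (Suc n))) x \<partial>circ) = 0"
      unfolding coef_integral by (simp add: neg)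
    then have "(\<integral>x. \<i> ^ Suc n * (w x * bubble 1 x ^ Suc n) \<partial>circ) = 0"
      unfolding minus_minus chr_bubble_power by (simp only: mult.left_commute)
    then show ?thesis by (simp del: power_Suc)
  qed
  have im0: "Im \<xi> = 0" if "\<xi> \<in> slit" for \<xi>
    using that by (auto simp: in_segment)
  have im: "\<i> \<notin> slit" "- \<i> \<notin> slit" using im0[of \<i>] im0[of "- \<i>"] by auto
  have ib: "integrable circ (\<lambda>x. w x * bubble 1 x ^ n)" for n
    by (rule integrable_circ_bounded[where B = C]) (use b in \<open>auto simp: norm_mult norm_power cmod_bubble\<close>)
  have "cauchy_tr G m (- \<i>) = 0" for m
  proof -
    (* The kernel at - \<i> is affine in the bubble, so its powers are polynomials in the bubble. *)
    have p: "1 / (of_real x + \<i>) = (1 - bubble 1 x) / (2 * \<i>)" for x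
      using nz[of x] by (simp add: bubble_def field_simps)
    have "G x * (1 / (of_real x - - \<i>)) ^ Suc m = (\<Sum>j\<le>m. (of_nat (m choose j) * (- 1) ^ j / (2 * \<i>) ^ m) * (w x * bubble 1 x ^ Suc j))" for x
    proof -
      have "G x * (1 / (of_real x - - \<i>)) ^ Suc m = w x * bubble 1 x * (1 / (of_real x + \<i>)) ^ m"
        using nz[of x] by (simp add: G_def bubble_def)
      also have "\<dots> = w x * bubble 1 x * ((- bubble 1 x + 1) ^ m / (2 * \<i>) ^ m)" unfolding p power_divide by simp
      also have "(- bubble 1 x + 1) ^ m = (\<Sum>j\<le>m. of_nat (m choose j) * (- bubble 1 x) ^ j * 1 ^ (m - j))" by (rule binomial_ring)
      also have "w x * bubble 1 x * (\<dots> / (2 * \<i>) ^ m) = (\<Sum>j\<le>m. (of_nat (m choose j) * (- 1) ^ j / (2 * \<i>) ^ m) * (w x * bubble 1 x ^ Suc j))"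
        unfolding sum_divide_distrib sum_distrib_left
        by (intro sum.cong refl) (simp add: power_minus[of "bubble 1 x"] mult_ac)
      finally show ?thesis .
    qed
    then have "cauchy_tr G m (- \<i>) = (\<Sum>j\<le>m. (of_nat (m choose j) * (- 1) ^ j / (2 * \<i>) ^ m) * (\<integral>x. w x * bubble 1 x ^ Suc j \<partial>circ))"
      unfolding cauchy_tr_def using ib
      by (simp only: Bochner_Integration.integral_sum integrable_mult_right Bochner_Integration.integral_mult_right_zero)
    then show ?thesis by (simp only: up) simp
  qed
  from cauchy_tr_continuation[OF Gm Gb Gs im(2) this im(1)] have ci: "cauchy_tr G m \<i> = 0" for m by blast
  define t where "t x = 1 / (of_real x - \<i>)" for x :: real
  have [measurable]: "t \<in> borel_measurable borel" unfolding t_def by measurable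
  have tb: "cmod (t x) \<le> 1" for x
  proof -
    have "1 \<le> cmod (of_real x - \<i>)" using abs_Im_le_cmod[of "of_real x - \<i>"] by simp
    then show ?thesis by (simp add: t_def norm_divide divide_simps split: if_splits)
  qed
  have it: "integrable circ (\<lambda>x. w x * t x ^ n)" for n
  proof (rule integrable_circ_bounded[where B = "C * 1"])
    show "norm (w x * t x ^ n) \<le> C * 1" for x
      unfolding norm_mult norm_power by (intro mult_mono power_le_one b tb C) auto
  qed simp
  have wt: "(\<integral>x. w x * t x ^ n \<partial>circ) = 0" for n
  proof -
    have "w x * t x ^ n = G x * (1 / (of_real x - \<i>)) ^ Suc n" for x
      using nz[of x] by (simp add: G_def t_def)
    then show ?thesis using ci[of n] by (simp only: cauchy_tr_def)
  qed
  have pos: "coef w (int n) = 0" for n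
  proof -
    have "w x * chr (- int n) x = (\<Sum>j\<le>n. (of_nat (n choose j) * (2 * \<i>) ^ j / \<i> ^ n) * (w x * t x ^ j))" for x
    proof -
      (* In the same way, characters of negative index are polynomials in the kernel at \<i>. *)
      have c: "chr (- 1) x = (2 * \<i> * t x + 1) / \<i>"
      proof -
        have "chr 1 x * chr (- 1) x = 1" by (simp flip: chr_add)
        moreover have "chr 1 x = \<i> * (of_real x - \<i>) / (of_real x + \<i>)" by (rule chr_1)
        moreover have "\<i> * (of_real x - \<i>) / (of_real x + \<i>) * ((2 * \<i> * t x + 1) / \<i>) = 1"
        proof -
          have "2 * \<i> * t x + 1 = (of_real x + \<i>) / (of_real x - \<i>)"
            using nz(2)[of x] by (simp add: t_def divide_simps)
          then show ?thesis using nz[of x] by simp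
        qed
        ultimately show ?thesis by (metis mult_cancel_left one_neq_zero mult_zero_left)
      qed
      have "chr (- int n) x = (2 * \<i> * t x + 1) ^ n / \<i> ^ n"
        using chr_1_power(2)[of x n] unfolding c power_divide by simp
      also have "(2 * \<i> * t x + 1) ^ n = (\<Sum>j\<le>n. of_nat (n choose j) * (2 * \<i> * t x) ^ j * 1 ^ (n - j))" by (rule binomial_ring)
      finally have e: "chr (- int n) x = (\<Sum>j\<le>n. of_nat (n choose j) * (2 * \<i> * t x) ^ j * 1 ^ (n - j)) / \<i> ^ n" .
      show ?thesis unfolding e sum_divide_distrib sum_distrib_left
        by (intro sum.cong refl) (simp add: power_mult_distrib mult_ac)
    qed
    then have "(\<integral>x. w x * chr (- int n) x \<partial>circ) = (\<Sum>j\<le>n. (of_nat (n choose j) * (2 * \<i>) ^ j / \<i> ^ n) * (\<integral>x. w x * t x ^ j \<partial>circ))"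
      using it by (simp only: Bochner_Integration.integral_sum integrable_mult_right Bochner_Integration.integral_mult_right_zero)
    then have "(\<integral>x. w x * chr (- int n) x \<partial>circ) = 0" by (simp only: wt mult_zero_right sum.neutral_const)
    then show ?thesis unfolding coef_def by simp
  qed
  have "coef w k = 0" for k
    using neg[of k] pos[of "nat k"] by (cases "k < 0") auto
  then have "((\<lambda>k::int. 0) has_sum (\<integral>x. (cmod (w x))\<^sup>2 \<partial>circ)) UNIV"
    using parseval[OF wm b fin] by simp
  then have "(\<integral>x. (cmod (w x))\<^sup>2 \<partial>circ) = 0"
    by (rule has_sum_unique) (rule has_sum_0, simp)
  moreover have "integrable circ (\<lambda>x. (cmod (w x))\<^sup>2)"
    by (rule integrable_circ_bounded[where B = "C\<^sup>2"]) (use b in \<open>auto intro: power_mono\<close>)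
  ultimately have "AE x in circ. (cmod (w x))\<^sup>2 = 0"
    by (subst (asm) integral_nonneg_eq_0_iff_AE) auto
  then show ?thesis unfolding AE_circ by simp
qed

section \<open>The energy cost of a small bubble\<close>

abbreviation plane :: "(real \<times> real) measure" where "plane \<equiv> lborel \<Otimes>\<^sub>M lborel"

definition gagliardo :: "(real \<Rightarrow> complex) \<Rightarrow> real \<times> real \<Rightarrow> real" where
  "gagliardo u z = (cmod (u (fst z) - u (snd z)))\<^sup>2 / (fst z - snd z)\<^sup>2"

lemma gagliardo_nonneg: "0 \<le> gagliardo u z" by (simp add: gagliardo_def)

lemma gagliardo_measurable [measurable]:
  assumes [measurable]: "u \<in> borel_measurable borel" shows "gagliardo u \<in> borel_measurable (borel \<Otimes>\<^sub>M borel)"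
  unfolding gagliardo_def[abs_def] by measurable

lemma gagliardo_integrable:
  assumes [measurable]: "u \<in> borel_measurable borel" and fin: "seminorm_sq u < \<infinity>"
  shows "integrable plane (gagliardo u)" and "(\<integral>z. gagliardo u z \<partial>plane) = 2 * pi * En u"
proof -
  have s: "(\<integral>\<^sup>+z. ennreal (gagliardo u z) \<partial>plane) = seminorm_sq u"
    unfolding seminorm_sq_pair[OF assms(1)] gagliardo_def ..
  show "integrable plane (gagliardo u)"
    by (rule integrableI_nonneg) (use gagliardo_nonneg s fin in auto)
  show "(\<integral>z. gagliardo u z \<partial>plane) = 2 * pi * En u"
    by (subst integral_eq_nn_integral) (use gagliardo_nonneg s in \<open>auto simp: En_def\<close>)
qed

lemma En_integral_bound:
  assumes [measurable]: "u \<in> borel_measurable borel" and R: "integrable plane R" and le: "\<And>z. gagliardo u z \<le> R z"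
  shows "2 * pi * En u \<le> (\<integral>z. R z \<partial>plane)" and "seminorm_sq u < \<infinity>"
proof -
  have i: "integrable plane (gagliardo u)"
  proof (rule Bochner_Integration.integrable_bound[OF R])
    have "norm (gagliardo u z) \<le> norm (R z)" for z using le[of z] gagliardo_nonneg[of u z] by simp
    then show "AE z in plane. norm (gagliardo u z) \<le> norm (R z)" by (intro AE_I2)
  qed simp
  have "(\<integral>\<^sup>+z. ennreal (gagliardo u z) \<partial>plane) = seminorm_sq u"
    unfolding seminorm_sq_pair[OF assms(1)] gagliardo_def ..
  moreover have "(\<integral>\<^sup>+z. ennreal (gagliardo u z) \<partial>plane) < \<infinity>"
    using i gagliardo_nonneg by (subst nn_integral_eq_integral) auto
  ultimately show f: "seminorm_sq u < \<infinity>" by simp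
  show "2 * pi * En u \<le> (\<integral>z. R z \<partial>plane)"
    using integral_mono[OF i R le] gagliardo_integrable(2)[OF assms(1) f] by simp
qed

lemma lorentz_plane:
  assumes c: "0 \<le> c" and ab: "0 < a" "0 < b"
  shows "integrable plane (\<lambda>z. c / (((fst z)\<^sup>2 + a\<^sup>2) * ((snd z)\<^sup>2 + b\<^sup>2)))"
    and "(\<integral>z. c / (((fst z)\<^sup>2 + a\<^sup>2) * ((snd z)\<^sup>2 + b\<^sup>2)) \<partial>plane) = c * pi\<^sup>2 / (a * b)"
proof -
  let ?f = "\<lambda>z::real \<times> real. c / (((fst z)\<^sup>2 + a\<^sup>2) * ((snd z)\<^sup>2 + b\<^sup>2))"
  have f0: "0 \<le> ?f z" for z using c by simp
  have s: "(\<integral>\<^sup>+z. ennreal (?f z) \<partial>plane) = ennreal (c * pi\<^sup>2 / (a * b))"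
    using nn_integral_lorentz_prod[OF c ab] by (subst lborel.nn_integral_fst[symmetric]) auto
  show "integrable plane ?f" by (rule integrableI_nonneg) (use f0 s in auto)
  show "(\<integral>z. ?f z \<partial>plane) = c * pi\<^sup>2 / (a * b)"
    by (subst integral_eq_nn_integral) (use f0 s c ab in auto)
qed

lemma AE_plane_nonzero: "AE z in plane. fst z \<noteq> 0 \<and> snd z \<noteq> 0"
proof (rule AE_I')
  have "emeasure plane ({0} \<times> UNIV) = 0" "emeasure plane (UNIV \<times> {0}) = 0"
    by (subst lborel.emeasure_pair_measure_Times; simp)+
  then have "{0} \<times> UNIV \<in> null_sets plane" "UNIV \<times> {0} \<in> null_sets plane" by (auto simp: null_sets_def)
  then show "{0} \<times> UNIV \<union> UNIV \<times> {0} \<in> null_sets plane" by (rule null_sets.Un)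
qed auto

lemma cmod_add_weighted:
  assumes "0 < (t::real)" shows "(cmod (a + b))\<^sup>2 \<le> (1 + t) * (cmod a)\<^sup>2 + (1 + 1 / t) * (cmod b)\<^sup>2"
proof -
  have "(cmod (a + b))\<^sup>2 \<le> (cmod a + cmod b)\<^sup>2" by (intro power_mono norm_triangle_ineq) auto
  also have "\<dots> = (cmod a)\<^sup>2 + (cmod b)\<^sup>2 + cmod b * cmod a * 2" by (simp add: power2_eq_square algebra_simps)
  also have "\<dots> \<le> (1 + t) * (cmod a)\<^sup>2 + (1 + 1 / t) * (cmod b)\<^sup>2"
    using weighted_am_gm[OF assms, of "cmod b" "cmod a"] by (simp add: algebra_simps)
  finally show ?thesis .
qed

text \<open>
  The map \<open>u\<close> and a small bubble oscillate in different regions of the plane of pairs \<open>(x, y)\<close>. Near the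
  axes \<open>u\<close> has little energy, away from them the bubble of scale \<open>e\<close> has energy of order \<open>e\<^sup>2\<close>. In the
  square of the sum of the two increments the mixed term is therefore absorbed, with the large factor
  \<open>1 / \<tau>\<close> falling on the small energy in each region.
\<close>

lemma En_times_bubble_le:
  assumes u: "S1_map u" and \<epsilon>: "\<epsilon> > 0"
  shows "\<exists>e0>0. \<forall>e. 0 < e \<and> e < e0 \<longrightarrow> En (\<lambda>x. u x * bubble e x) \<le> En u + 2 * pi + \<epsilon>"
proof -
  note [measurable] = S1_map_measurable[OF u]
  define \<tau> where "\<tau> = \<epsilon> / (3 * (En u + 2 * pi))"
  have E0: "0 < En u + 2 * pi" using En_nonneg[of u] pi_gt_zero by linarith
  have "a / (3 * b) * b = a / 3" if "0 < b" for a b :: real using that by simp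
  from this[OF E0, of \<epsilon>] have \<tau>2: "\<tau> * (En u + 2 * pi) = \<epsilon> / 3" unfolding \<tau>_def .
  have "0 < \<tau>" unfolding \<tau>_def using E0 \<epsilon> by (intro divide_pos_pos) auto
  note \<tau> = this \<tau>2
  (* The pairs close to the axes, where one of the two points sees the bubble. *)
  define near where "near d = {z::real \<times> real. \<bar>fst z\<bar> \<le> d \<or> \<bar>snd z\<bar> \<le> d}" for d :: real
  have [measurable]: "near d \<in> sets (borel \<Otimes>\<^sub>M borel)" for d unfolding near_def borel_prod
    by (intro borel_closed closed_Collect_disj closed_Collect_le continuous_intros)
  have [measurable]: "gagliardo u \<in> borel_measurable (borel \<Otimes>\<^sub>M borel)" by measurable
  have gi: "integrable plane (gagliardo u)" by (rule gagliardo_integrable) (use u in \<open>auto simp: S1_map_def\<close>)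
  have "(\<lambda>j. \<integral>z. indicator (near (1 / (real j + 1))) z * gagliardo u z \<partial>plane) \<longlonglongrightarrow> (\<integral>z. 0 \<partial>plane)"
  proof (rule integral_dominated_convergence[where w = "gagliardo u"])
    show "AE z in plane. (\<lambda>j. indicator (near (1 / (real j + 1))) z * gagliardo u z) \<longlonglongrightarrow> 0"
      using AE_plane_nonzero
    proof eventually_elim
      case (elim z)
      then have "0 < min \<bar>fst z\<bar> \<bar>snd z\<bar>" by auto
      moreover have "(\<lambda>j. 1 / (real j + 1)) \<longlonglongrightarrow> 0" by real_asymp
      ultimately have "eventually (\<lambda>j. 1 / (real j + 1) < min \<bar>fst z\<bar> \<bar>snd z\<bar>) sequentially" by (rule order_tendstoD(2)[rotated])
      then have "eventually (\<lambda>j. indicator (near (1 / (real j + 1))) z * gagliardo u z = 0) sequentially"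
        by eventually_elim (auto simp: near_def indicator_def)
      then show ?case by (simp add: tendsto_eventually)
    qed
    show "AE z in plane. norm (indicator (near (1 / (real j + 1))) z * gagliardo u z) \<le> gagliardo u z" for j
      using gagliardo_nonneg[of u] by (auto simp: indicator_def)
  qed (use gi in auto)
  then have "(\<lambda>j. \<integral>z. indicator (near (1 / (real j + 1))) z * gagliardo u z \<partial>plane) \<longlonglongrightarrow> 0" by simp
  then have "eventually (\<lambda>j. (\<integral>z. indicator (near (1 / (real j + 1))) z * gagliardo u z \<partial>plane) < 2 * pi * \<tau> * (\<epsilon> / 3)) sequentially"
    by (rule order_tendstoD(2)) (use \<tau> \<epsilon> in simp)
  then obtain j where j: "(\<integral>z. indicator (near (1 / (real j + 1))) z * gagliardo u z \<partial>plane) < 2 * pi * \<tau> * (\<epsilon> / 3)"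
    by (auto simp: eventually_sequentially)
  define \<delta> where "\<delta> = 1 / (real j + 1)"
  have \<delta>: "0 < \<delta>" by (simp add: \<delta>_def)
  define J where "J = (\<integral>z. indicator (near \<delta>) z * gagliardo u z \<partial>plane)"
  have J: "J < 2 * pi * \<tau> * (\<epsilon> / 3)" using j by (simp add: J_def \<delta>_def)
  (* Chosen so that the energy of a bubble of smaller scale far from the axes is at most the bound for J. *)
  define e0 where "e0 = sqrt (\<delta>\<^sup>2 * (2 * pi * \<tau> * (\<epsilon> / 3)) / (16 * pi\<^sup>2))"
  have "En (\<lambda>x. u x * bubble e x) \<le> En u + 2 * pi + \<epsilon>" if e: "0 < e" "e < e0" for e
  proof -
    let ?b = "bubble e"
    have "e\<^sup>2 \<le> e0\<^sup>2" using e by (intro power_mono) auto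
    also have "e0\<^sup>2 = \<delta>\<^sup>2 * (2 * pi * \<tau> * (\<epsilon> / 3)) / (16 * pi\<^sup>2)"
      unfolding e0_def using \<tau> \<epsilon> by (intro real_sqrt_pow2) simp
    finally have eb: "16 * e\<^sup>2 * pi\<^sup>2 / (\<delta> * \<delta>) \<le> 2 * pi * \<tau> * (\<epsilon> / 3)"
      using \<delta> by (simp add: field_simps power2_eq_square)
    have nb: "S1_map ?b" by (rule bubble_S1_map[OF e(1)])
    note [measurable] = S1_map_measurable[OF nb]
    have bi: "integrable plane (gagliardo ?b)" by (rule gagliardo_integrable) (use nb in \<open>auto simp: S1_map_def\<close>)
    let ?L = "\<lambda>z::real \<times> real. 16 * e\<^sup>2 / (((fst z)\<^sup>2 + \<delta>\<^sup>2) * ((snd z)\<^sup>2 + \<delta>\<^sup>2))"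
    have Li: "integrable plane ?L" "(\<integral>z. ?L z \<partial>plane) = 16 * e\<^sup>2 * pi\<^sup>2 / (\<delta> * \<delta>)"
      using lorentz_plane[of "16 * e\<^sup>2" \<delta> \<delta>] \<delta> by auto
    have ni: "integrable plane (\<lambda>z. indicator (near \<delta>) z * gagliardo u z)"
      by (rule Bochner_Integration.integrable_bound[OF gi]) (use gagliardo_nonneg[of u] in \<open>auto simp: indicator_def\<close>)
    have pt: "gagliardo (\<lambda>x. u x * ?b x) z \<le> (1 + \<tau>) * (gagliardo u z + gagliardo ?b z) + 1 / \<tau> * (indicator (near \<delta>) z * gagliardo u z + ?L z)" for z
    proof -
      define x y where "x = fst z" and "y = snd z"
      define q where "q = (x - y)\<^sup>2"
      define p where "p = cmod (u x - u y)"
      define r where "r = cmod (?b x - ?b y)"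
      have q: "0 \<le> q" by (simp add: q_def)
      have "cmod (u x * ?b x - u y * ?b y) = cmod ((u x - u y) * ?b x + u y * (?b x - ?b y))" by (simp add: algebra_simps)
      also have "\<dots> \<le> p + r"
        using norm_triangle_ineq[of "(u x - u y) * ?b x" "u y * (?b x - ?b y)"] S1_map_cmod[OF u] S1_map_cmod[OF nb]
        by (simp add: norm_mult p_def r_def)
      finally have le: "(cmod (u x * ?b x - u y * ?b y))\<^sup>2 \<le> (p + r)\<^sup>2" by (intro power_mono) auto
      have main: "(p + r)\<^sup>2 \<le> (1 + \<tau>) * (p\<^sup>2 + r\<^sup>2) + 1 / \<tau> * (indicator (near \<delta>) z * p\<^sup>2 + (1 - indicator (near \<delta>) z) * r\<^sup>2)"
      proof (cases "z \<in> near \<delta>")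
        case True
        have "(p + r)\<^sup>2 = p\<^sup>2 + r\<^sup>2 + p * r * 2" by (simp add: power2_eq_square algebra_simps)
        also have "\<dots> \<le> p\<^sup>2 + r\<^sup>2 + (\<tau> * r\<^sup>2 + 1 / \<tau> * p\<^sup>2)" using weighted_am_gm[OF \<tau>(1), of p r] by simp
        also have "\<dots> \<le> (1 + \<tau>) * (p\<^sup>2 + r\<^sup>2) + 1 / \<tau> * p\<^sup>2" using \<tau> by (simp add: algebra_simps)
        finally show ?thesis using True by simp
      next
        case False
        have "(p + r)\<^sup>2 = p\<^sup>2 + r\<^sup>2 + r * p * 2" by (simp add: power2_eq_square algebra_simps)
        also have "\<dots> \<le> p\<^sup>2 + r\<^sup>2 + (\<tau> * p\<^sup>2 + 1 / \<tau> * r\<^sup>2)" using weighted_am_gm[OF \<tau>(1), of r p] by simp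
        also have "\<dots> \<le> (1 + \<tau>) * (p\<^sup>2 + r\<^sup>2) + 1 / \<tau> * r\<^sup>2" using \<tau> by (simp add: algebra_simps)
        finally show ?thesis using False by simp
      qed
      have far: "(1 - indicator (near \<delta>) z) * gagliardo ?b z \<le> ?L z"
      proof (cases "z \<in> near \<delta>")
        case False
        then have xy: "\<delta> \<le> \<bar>x\<bar>" "\<delta> \<le> \<bar>y\<bar>" by (auto simp: near_def x_def y_def)
        then have "\<delta>\<^sup>2 \<le> x\<^sup>2" "\<delta>\<^sup>2 \<le> y\<^sup>2" using \<delta> by (auto simp: abs_le_square_iff[symmetric])
        then have h: "(x\<^sup>2 + \<delta>\<^sup>2) / 2 \<le> x\<^sup>2 + e\<^sup>2" "(y\<^sup>2 + \<delta>\<^sup>2) / 2 \<le> y\<^sup>2 + e\<^sup>2"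
          by (auto simp: add_increasing2)
        have pos: "0 < x\<^sup>2 + \<delta>\<^sup>2" "0 < y\<^sup>2 + \<delta>\<^sup>2" using \<delta> by (auto simp: add_nonneg_pos)
        have "gagliardo ?b z \<le> 4 * e\<^sup>2 / ((x\<^sup>2 + e\<^sup>2) * (y\<^sup>2 + e\<^sup>2))"
          using e(1) by (cases "x = y") (simp_all add: gagliardo_def bubble_lip x_def y_def)
        also have "\<dots> \<le> 4 * e\<^sup>2 / ((x\<^sup>2 + \<delta>\<^sup>2) / 2 * ((y\<^sup>2 + \<delta>\<^sup>2) / 2))"
          using h pos e(1) by (intro divide_left_mono mult_mono mult_pos_pos) (auto simp: add_nonneg_pos)
        also have "\<dots> = ?L z" by (simp add: x_def y_def)
        finally show ?thesis using False by simp
      qed simp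
      have "gagliardo (\<lambda>x. u x * ?b x) z \<le> ((1 + \<tau>) * (p\<^sup>2 + r\<^sup>2) + 1 / \<tau> * (indicator (near \<delta>) z * p\<^sup>2 + (1 - indicator (near \<delta>) z) * r\<^sup>2)) / q"
        using order_trans[OF le main] q unfolding gagliardo_def x_def[symmetric] y_def[symmetric] q_def by (rule divide_right_mono)
      also have "\<dots> = (1 + \<tau>) * (p\<^sup>2 / q + r\<^sup>2 / q) + 1 / \<tau> * (indicator (near \<delta>) z * (p\<^sup>2 / q) + (1 - indicator (near \<delta>) z) * (r\<^sup>2 / q))"
        by (simp add: add_divide_distrib distrib_left)
      also have "p\<^sup>2 / q = gagliardo u z" by (simp add: gagliardo_def p_def q_def x_def y_def)
      also have "r\<^sup>2 / q = gagliardo ?b z" by (simp add: gagliardo_def r_def q_def x_def y_def)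
      also have "(1 + \<tau>) * (gagliardo u z + gagliardo ?b z) + 1 / \<tau> * (indicator (near \<delta>) z * gagliardo u z + (1 - indicator (near \<delta>) z) * gagliardo ?b z)
         \<le> (1 + \<tau>) * (gagliardo u z + gagliardo ?b z) + 1 / \<tau> * (indicator (near \<delta>) z * gagliardo u z + ?L z)"
        using far \<tau> by (intro add_left_mono mult_left_mono) auto
      finally show ?thesis .
    qed
    have "2 * pi * En (\<lambda>x. u x * ?b x) \<le> (\<integral>z. (1 + \<tau>) * (gagliardo u z + gagliardo ?b z) + 1 / \<tau> * (indicator (near \<delta>) z * gagliardo u z + ?L z) \<partial>plane)"
      by (rule En_integral_bound(1)[OF _ _ pt]) (use gi bi ni Li in auto)
    also have "\<dots> = (1 + \<tau>) * (2 * pi * En u + 2 * pi * En ?b) + 1 / \<tau> * (J + 16 * e\<^sup>2 * pi\<^sup>2 / (\<delta> * \<delta>))"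
      using gi bi ni Li gagliardo_integrable(2)[OF S1_map_measurable[OF u] S1_map_fin[OF u]] gagliardo_integrable(2)[OF S1_map_measurable[OF nb] S1_map_fin[OF nb]]
      by (simp add: J_def)
    also have "\<dots> \<le> (1 + \<tau>) * (2 * pi * En u + 2 * pi * (2 * pi)) + 1 / \<tau> * (2 * pi * \<tau> * (\<epsilon> / 3) + 2 * pi * \<tau> * (\<epsilon> / 3))"
      using \<tau> J eb bubble_S1_map(2)[OF e(1)] by (intro add_mono mult_left_mono) auto
    also have "\<dots> = 2 * pi * ((En u + 2 * pi) + \<tau> * (En u + 2 * pi) + 2 * (\<epsilon> / 3))"
      using \<tau>(1) by (simp add: field_simps)
    also have "\<dots> = 2 * pi * (En u + 2 * pi + \<epsilon>)" unfolding \<tau>(2) by (simp add: field_simps)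
    finally show ?thesis by simp
  qed
  moreover have "0 < e0" unfolding e0_def using \<tau> \<epsilon> \<delta> by simp
  ultimately show ?thesis by blast
qed

section \<open>Bubbles supported in the interval\<close>

lemma seminorm_sq_scale:
  assumes [measurable]: "u \<in> borel_measurable borel" and c: "0 < c"
  shows "seminorm_sq (\<lambda>x. u (c * x)) = seminorm_sq u"
proof -
  let ?q = "\<lambda>x y. ennreal ((cmod (u x - u y))\<^sup>2 / (x - y)\<^sup>2)"
  have "seminorm_sq u = (\<integral>\<^sup>+x. (\<integral>\<^sup>+y. ?q x y \<partial>lborel) \<partial>lborel)"
    by (simp add: seminorm_sq_def nn_integral_completion)
  also have "\<dots> = ennreal \<bar>c\<bar> * (\<integral>\<^sup>+x. (\<integral>\<^sup>+y. ?q (0 + c * x) y \<partial>lborel) \<partial>lborel)"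
    by (rule nn_integral_real_affine) (use c in auto)
  also have "\<dots> = ennreal \<bar>c\<bar> * (\<integral>\<^sup>+x. (ennreal \<bar>c\<bar> * (\<integral>\<^sup>+y. ?q (0 + c * x) (0 + c * y) \<partial>lborel)) \<partial>lborel)"
    by (subst (2) nn_integral_real_affine[where c = c and t = 0]) (use c in auto)
  also have "\<dots> = (\<integral>\<^sup>+x. (\<integral>\<^sup>+y. ennreal c * (ennreal c * ?q (c * x) (c * y)) \<partial>lborel) \<partial>lborel)"
    using c by (simp add: nn_integral_cmult)
  also have "\<dots> = seminorm_sq (\<lambda>x. u (c * x))"
  proof -
    have "ennreal c * (ennreal c * ?q (c * x) (c * y)) = ennreal ((cmod (u (c * x) - u (c * y)))\<^sup>2 / (x - y)\<^sup>2)" for x y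
    proof -
      have "c * (c * ((cmod (u (c * x) - u (c * y)))\<^sup>2 / (c * x - c * y)\<^sup>2)) = (cmod (u (c * x) - u (c * y)))\<^sup>2 / (x - y)\<^sup>2"
      proof -
        have "(c * x - c * y)\<^sup>2 = c * (c * (x - y)\<^sup>2)" by (simp add: power2_eq_square algebra_simps)
        then show ?thesis using c by simp
      qed
      then show ?thesis using c by (simp flip: ennreal_mult)
    qed
    then show ?thesis by (simp add: seminorm_sq_def nn_integral_completion)
  qed
  finally show ?thesis ..
qed

definition tent :: "real \<Rightarrow> real" where "tent x = max 0 (1 - x\<^sup>2)"

text \<open>
  A bubble whose scale decreases to zero at \<open>\<plusminus> 1\<close>. The bubble of scale 0 is 1 away from the origin, so
  this map is 1 off the interval.
\<close>

definition cut_bubble :: "real \<Rightarrow> real \<Rightarrow> complex" where "cut_bubble e x = bubble (e * tent x) x"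

lemma tent_outside: "x \<notin> {-1<..<1} \<Longrightarrow> tent x = 0"
  using abs_square_less_1[of x] by (auto simp: tent_def max_def abs_less_iff)

lemma bubble_0: "x \<noteq> 0 \<Longrightarrow> bubble 0 x = 1" by (simp add: bubble_def)

lemma cut_bubble_outside: "x \<notin> {-1<..<1} \<Longrightarrow> cut_bubble e x = 1"
  by (auto simp: cut_bubble_def tent_outside intro!: bubble_0)

lemma cut_bubble_measurable [measurable]: "cut_bubble e \<in> borel_measurable borel"
  unfolding cut_bubble_def[abs_def] bubble_def tent_def by measurable

lemma cut_bubble_denom: "0 < e \<Longrightarrow> x\<^sup>2 + (e * tent x)\<^sup>2 \<noteq> 0"
  by (cases "x = 0") (auto simp: tent_def sum_power2_eq_zero_iff)

lemma bubble_diff2: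
  assumes "x\<^sup>2 + a\<^sup>2 \<noteq> 0" "y\<^sup>2 + b\<^sup>2 \<noteq> 0"
  shows "(cmod (bubble a x - bubble b y))\<^sup>2 = 4 * (x * b - y * a)\<^sup>2 / ((x\<^sup>2 + a\<^sup>2) * (y\<^sup>2 + b\<^sup>2))"
proof -
  have nz: "of_real x + \<i> * of_real a \<noteq> 0" "of_real y + \<i> * of_real b \<noteq> 0"
    using assms cmod_real_plus_ii[of x a] cmod_real_plus_ii[of y b] by auto
  have "bubble a x - bubble b y = 2 * \<i> * of_real (x * b - y * a) / ((of_real x + \<i> * of_real a) * (of_real y + \<i> * of_real b))"
    unfolding bubble_def using nz by (simp add: divide_simps) (simp add: algebra_simps)
  then show ?thesis
    by (simp only: norm_divide norm_mult power_divide power_mult_distrib cmod_real_plus_ii norm_of_real power2_abs) simp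
qed

lemma cmod_hcut: assumes "0 < e" shows "cmod (cut_bubble e x) = 1"
proof (cases "tent x = 0")
  case True
  then have "x \<noteq> 0" by (auto simp: tent_def)
  then show ?thesis using True by (simp add: cut_bubble_def bubble_0)
qed (use assms in \<open>simp add: cut_bubble_def cmod_bubble\<close>)

text \<open>
  For \<open>x\<close> and \<open>y\<close> in the interval the difference is \<open>(x - y) * (1 + x * y)\<close>; this factorisation is the
  advantage of a quadratic profile.
\<close>

lemma tent_lip: "\<bar>x * tent y - y * tent x\<bar> \<le> 2 * \<bar>x - y\<bar>"
proof -
  have one_out: "\<bar>y\<bar> * (1 - x\<^sup>2) \<le> 2 * \<bar>x - y\<bar>" if "\<bar>x\<bar> \<le> 1" "1 \<le> \<bar>y\<bar>" for x y :: real
  proof -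
    define X where "X = \<bar>x\<bar>"
    have "x\<^sup>2 = X\<^sup>2" by (simp add: X_def)
    then have "\<bar>y\<bar> * (1 - x\<^sup>2) = \<bar>y\<bar> * (1 - X) * (1 + X)" by (simp add: power2_eq_square algebra_simps)
    then have "\<bar>y\<bar> * (1 - x\<^sup>2) = \<bar>y\<bar> * (1 - \<bar>x\<bar>) * (1 + \<bar>x\<bar>)" unfolding X_def .
    also have "\<dots> \<le> \<bar>y\<bar> * (1 - \<bar>x\<bar>) * 2" using that by (intro mult_left_mono) auto
    also have "\<bar>y\<bar> * (1 - \<bar>x\<bar>) \<le> \<bar>y\<bar> - \<bar>x\<bar>"
      using mult_right_mono[of 1 "\<bar>y\<bar>" "\<bar>x\<bar>"] that by (simp add: algebra_simps)
    also have "\<bar>y\<bar> - \<bar>x\<bar> \<le> \<bar>x - y\<bar>" by linarith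
    finally show ?thesis by simp
  qed
  have sq: "\<bar>z\<bar> \<le> 1 \<Longrightarrow> tent z = 1 - z\<^sup>2" "1 \<le> \<bar>z\<bar> \<Longrightarrow> tent z = 0" for z :: real
    using abs_square_le_1[of z] abs_square_less_1[of z] by (auto simp: tent_def max_def)
  consider "\<bar>x\<bar> \<le> 1" "\<bar>y\<bar> \<le> 1" | "\<bar>x\<bar> \<le> 1" "1 \<le> \<bar>y\<bar>" | "1 \<le> \<bar>x\<bar>" "\<bar>y\<bar> \<le> 1" | "1 \<le> \<bar>x\<bar>" "1 \<le> \<bar>y\<bar>" by linarith
  then show ?thesis
  proof cases
    case 1
    have "x * tent y - y * tent x = (x - y) * (1 + x * y)"
      unfolding sq(1)[OF 1(1)] sq(1)[OF 1(2)] by (simp add: power2_eq_square algebra_simps)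
    moreover have "\<bar>1 + x * y\<bar> \<le> 2"
      using mult_mono[OF 1] abs_triangle_ineq[of 1 "x * y"] by (simp add: abs_mult)
    ultimately show ?thesis using mult_right_mono[of "\<bar>1 + x * y\<bar>" 2 "\<bar>x - y\<bar>"] by (simp add: abs_mult mult.commute)
  next
    case 2
    have "x\<^sup>2 \<le> 1" using 2(1) by (simp only: abs_square_le_1)
    then have "\<bar>x * 0 - y * (1 - x\<^sup>2)\<bar> = \<bar>y\<bar> * (1 - x\<^sup>2)" by (simp add: abs_mult)
    then show ?thesis using one_out[OF 2] unfolding sq(1)[OF 2(1)] sq(2)[OF 2(2)] by linarith
  next
    case 3
    have "y\<^sup>2 \<le> 1" using 3(2) by (simp only: abs_square_le_1)
    then have "\<bar>x * (1 - y\<^sup>2) - y * 0\<bar> = \<bar>x\<bar> * (1 - y\<^sup>2)" by (simp add: abs_mult)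
    then show ?thesis using one_out[OF 3(2,1)] unfolding sq(2)[OF 3(1)] sq(1)[OF 3(2)] by (metis abs_minus_commute)
  next
    case 4
    then show ?thesis by (simp add: sq)
  qed
qed

lemma tent_denom:
  assumes "0 < e" "e \<le> 1" shows "(x\<^sup>2 + e\<^sup>2) / 5 \<le> x\<^sup>2 + (e * tent x)\<^sup>2"
proof (cases "x\<^sup>2 \<le> 1 / 4")
  case True
  then have "3 / 4 \<le> tent x" by (auto simp: tent_def max_def)
  then have "(3 / 4)\<^sup>2 \<le> (tent x)\<^sup>2" by (intro power_mono) auto
  then have "e\<^sup>2 * (9 / 16) \<le> e\<^sup>2 * (tent x)\<^sup>2" by (intro mult_left_mono) (auto simp: power2_eq_square)
  moreover have "e\<^sup>2 / 5 \<le> e\<^sup>2 * (9 / 16)" by simp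
  moreover have "x\<^sup>2 / 5 \<le> x\<^sup>2" by simp
  ultimately have "x\<^sup>2 / 5 + e\<^sup>2 / 5 \<le> x\<^sup>2 + e\<^sup>2 * (tent x)\<^sup>2" by linarith
  then show ?thesis by (simp add: power_mult_distrib add_divide_distrib)
next
  case False
  have "e\<^sup>2 \<le> 1" using assms by (simp add: power_le_one)
  then have "(x\<^sup>2 + e\<^sup>2) / 5 \<le> x\<^sup>2" using False by (simp add: field_simps)
  then show ?thesis by (simp add: add_increasing2)
qed

text \<open>
  The bound has the form of \<open>bubble_lip\<close>, with the factor 2 of \<open>tent_lip\<close> squared and the factor 5 of
  \<open>tent_denom\<close> for each variable: \<open>4 * 2\<^sup>2 * 5\<^sup>2 = 400\<close>.
\<close>

lemma cut_bubble_lip: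
  assumes e: "0 < e" "e \<le> 1"
  shows "(cmod (cut_bubble e x - cut_bubble e y))\<^sup>2 \<le> (400 * e\<^sup>2) * (x - y)\<^sup>2 / ((x\<^sup>2 + e\<^sup>2) * (y\<^sup>2 + e\<^sup>2))"
proof -
  have pos: "0 < x\<^sup>2 + e\<^sup>2" "0 < y\<^sup>2 + e\<^sup>2" using e by (auto simp: add_nonneg_pos)
  have "(cmod (cut_bubble e x - cut_bubble e y))\<^sup>2 = 4 * (x * (e * tent y) - y * (e * tent x))\<^sup>2 / ((x\<^sup>2 + (e * tent x)\<^sup>2) * (y\<^sup>2 + (e * tent y)\<^sup>2))"
    unfolding cut_bubble_def by (rule bubble_diff2) (use cut_bubble_denom e in auto)
  also have "\<dots> \<le> 4 * (x * (e * tent y) - y * (e * tent x))\<^sup>2 / ((x\<^sup>2 + e\<^sup>2) / 5 * ((y\<^sup>2 + e\<^sup>2) / 5))"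
  proof (rule divide_left_mono)
    show "(x\<^sup>2 + e\<^sup>2) / 5 * ((y\<^sup>2 + e\<^sup>2) / 5) \<le> (x\<^sup>2 + (e * tent x)\<^sup>2) * (y\<^sup>2 + (e * tent y)\<^sup>2)"
      using pos by (intro mult_mono tent_denom e) auto
    have "0 < x\<^sup>2 + (e * tent x)\<^sup>2" "0 < y\<^sup>2 + (e * tent y)\<^sup>2"
      using cut_bubble_denom[OF e(1)] by (auto simp: less_le)
    then show "0 < (x\<^sup>2 + (e * tent x)\<^sup>2) * (y\<^sup>2 + (e * tent y)\<^sup>2) * ((x\<^sup>2 + e\<^sup>2) / 5 * ((y\<^sup>2 + e\<^sup>2) / 5))"
      using pos by (intro mult_pos_pos) auto
  qed auto
  also have "\<dots> \<le> 4 * (e * (2 * \<bar>x - y\<bar>))\<^sup>2 / ((x\<^sup>2 + e\<^sup>2) / 5 * ((y\<^sup>2 + e\<^sup>2) / 5))"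
  proof (intro divide_right_mono mult_left_mono)
    have "\<bar>x * (e * tent y) - y * (e * tent x)\<bar> = e * \<bar>x * tent y - y * tent x\<bar>"
    proof -
      have "x * (e * tent y) - y * (e * tent x) = e * (x * tent y - y * tent x)" by (simp add: algebra_simps)
      then show ?thesis using e by (simp add: abs_mult)
    qed
    also have "\<dots> \<le> e * (2 * \<bar>x - y\<bar>)" using e by (intro mult_left_mono tent_lip) auto
    finally show "(x * (e * tent y) - y * (e * tent x))\<^sup>2 \<le> (e * (2 * \<bar>x - y\<bar>))\<^sup>2"
      by (subst power2_abs[symmetric]) (intro power_mono, auto)
  qed (use pos in auto)
  also have "\<dots> = (400 * e\<^sup>2) * (x - y)\<^sup>2 / ((x\<^sup>2 + e\<^sup>2) * (y\<^sup>2 + e\<^sup>2))" by (simp add: power_mult_distrib)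
  finally show ?thesis .
qed

lemma cut_bubble_S1_map: assumes e: "0 < e" "e \<le> 1" shows "S1_map (cut_bubble e)"
proof -
  have "seminorm_sq (cut_bubble e) \<le> ennreal (400 * e\<^sup>2 * pi\<^sup>2 / (e * e))"
    by (rule seminorm_sq_lorentz_bound[OF _ e(1) e(1) cut_bubble_lip[OF e]]) simp
  then have "seminorm_sq (cut_bubble e) < \<infinity>" by (metis ennreal_less_top infinity_ennreal_def order.strict_trans1)
  then show ?thesis unfolding S1_map_def using cmod_hcut[OF e(1)] by auto
qed

lemma cut_bubble_diff_sup: assumes e: "0 < e" shows "cmod (cut_bubble e x - bubble e x) \<le> 2 * e"
proof (cases "x = 0")
  case True
  then show ?thesis using e by (simp add: cut_bubble_def tent_def)
next
  case False
  define a where "a = e * tent x"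
  have x2: "0 < x\<^sup>2" using False by simp
  have "(cmod (cut_bubble e x - bubble e x))\<^sup>2 = 4 * (x * e - x * a)\<^sup>2 / ((x\<^sup>2 + a\<^sup>2) * (x\<^sup>2 + e\<^sup>2))"
    unfolding cut_bubble_def a_def[symmetric] by (rule bubble_diff2) (use x2 zero_le_power2[of a] zero_le_power2[of e] in linarith)+
  also have "(x * e - x * a)\<^sup>2 = x\<^sup>2 * (e\<^sup>2 * (1 - tent x)\<^sup>2)"
    by (simp add: a_def power2_eq_square algebra_simps)
  also have "4 * (x\<^sup>2 * (e\<^sup>2 * (1 - tent x)\<^sup>2)) / ((x\<^sup>2 + a\<^sup>2) * (x\<^sup>2 + e\<^sup>2))
     = 4 * e\<^sup>2 * ((x\<^sup>2 / (x\<^sup>2 + a\<^sup>2)) * ((1 - tent x)\<^sup>2 / (x\<^sup>2 + e\<^sup>2)))" by simp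
  also have "\<dots> \<le> 4 * e\<^sup>2 * (1 * 1)"
  proof (intro mult_left_mono mult_mono)
    show "x\<^sup>2 / (x\<^sup>2 + a\<^sup>2) \<le> 1" using x2 by (simp add: divide_le_eq_1 add_pos_nonneg)
    have "(1 - tent x)\<^sup>2 \<le> x\<^sup>2"
    proof (cases "x\<^sup>2 \<le> 1")
      case True
      then have "1 - tent x = x\<^sup>2" by (simp add: tent_def max_def)
      then have "(1 - tent x)\<^sup>2 = x\<^sup>2 * x\<^sup>2" by (simp add: power2_eq_square)
      also have "\<dots> \<le> x\<^sup>2 * 1" using True by (intro mult_left_mono) auto
      finally show ?thesis by simp
    next
      case F: False
      then have "1 - tent x = 1" by (simp add: tent_def max_def)
      then show ?thesis using F by simp
    qed
    then show "(1 - tent x)\<^sup>2 / (x\<^sup>2 + e\<^sup>2) \<le> 1" using x2 by (simp add: divide_le_eq_1 add_pos_nonneg add_increasing2)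
  qed (use x2 in auto)
  also have "\<dots> = (2 * e)\<^sup>2" by (simp add: power_mult_distrib)
  finally have "(cmod (cut_bubble e x - bubble e x))\<^sup>2 \<le> (2 * e)\<^sup>2" .
  then show ?thesis by (rule power2_le_imp_le) (use e in simp)
qed

text \<open>
  The seminorm is invariant under the rescaling of the line by \<open>e\<close>. After it, the scale of the tapered
  bubble at \<open>x\<close> is \<open>tent (e * x)\<close>, which tends to 1, the scale of the other bubble; the energy densities
  have the common majorant given by \<open>cut_bubble_lip\<close> and \<open>bubble_lip\<close>.
\<close>

lemma cut_bubble_diff_energy: "(\<lambda>n. En (\<lambda>x. cut_bubble (1 / (real n + 1)) x - bubble (1 / (real n + 1)) x)) \<longlonglongrightarrow> 0"
proof -
  define e where "e n = 1 / (real n + 1)" for n :: nat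
  have e: "0 < e n" "e n \<le> 1" for n by (auto simp: e_def divide_simps)
  define D where "D n x = cut_bubble (e n) x - bubble (e n) x" for n x
  define R where "R n x = D n (e n * x)" for n x
  have Dm [measurable]: "D n \<in> borel_measurable borel" for n unfolding D_def by measurable
  have [measurable]: "R n \<in> borel_measurable borel" for n unfolding R_def by measurable
  have Dfin: "seminorm_sq (D n) < \<infinity>" for n
    unfolding D_def by (rule diff_fin(1)[OF cut_bubble_S1_map[OF e] bubble_S1_map(1)[OF e(1)]])
  have SR: "seminorm_sq (R n) = seminorm_sq (D n)" for n
    unfolding R_def by (rule seminorm_sq_scale[OF Dm e(1)])
  then have ER: "En (R n) = En (D n)" for n by (simp add: En_def)
  have Rfin: "seminorm_sq (R n) < \<infinity>" for n using SR Dfin by simp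
  (* 808 = 2 * 400 + 2 * 4, from cut_bubble_lip and bubble_lip. *)
  let ?w = "\<lambda>z::real \<times> real. 808 / (((fst z)\<^sup>2 + 1\<^sup>2) * ((snd z)\<^sup>2 + 1\<^sup>2))"
  have Reval: "R n x = bubble (tent (e n * x)) x - bubble 1 x" for n x
  proof -
    have "bubble (e n * a) (e n * x) = bubble a x" for a
    proof -
      have "bubble (e n * a) (e n * x) = (of_real (e n) * (of_real x - \<i> * of_real a)) / (of_real (e n) * (of_real x + \<i> * of_real a))"
        by (simp add: bubble_def algebra_simps)
      then show ?thesis using e(1)[of n] by (simp add: bubble_def)
    qed
    from this[of "tent (e n * x)"] this[of 1] show ?thesis by (simp add: R_def D_def cut_bubble_def)
  qed
  have bound: "gagliardo (R n) z \<le> ?w z" for n z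
  proof -
    define x y where "x = fst z" and "y = snd z"
    define E where "E = e n"
    have E: "0 < E" "E \<le> 1" using e by (auto simp: E_def)
    have dn: "(E * t)\<^sup>2 + E\<^sup>2 = E\<^sup>2 * (t\<^sup>2 + 1)" for t by (simp add: power_mult_distrib algebra_simps)
    have key: "c * E\<^sup>2 * (E * x - E * y)\<^sup>2 / (((E * x)\<^sup>2 + E\<^sup>2) * ((E * y)\<^sup>2 + E\<^sup>2)) = c * (x - y)\<^sup>2 / ((x\<^sup>2 + 1) * (y\<^sup>2 + 1))" for c
    proof -
      have "(E * x - E * y)\<^sup>2 = E\<^sup>2 * (x - y)\<^sup>2" by (simp add: power2_eq_square algebra_simps)
      then show ?thesis unfolding dn using E by simp
    qed
    have "R n x - R n y = (cut_bubble E (E * x) - cut_bubble E (E * y)) + (bubble E (E * y) - bubble E (E * x))"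
      by (simp add: R_def D_def E_def)
    then have "(cmod (R n x - R n y))\<^sup>2 \<le> 2 * (cmod (cut_bubble E (E * x) - cut_bubble E (E * y)))\<^sup>2 + 2 * (cmod (bubble E (E * x) - bubble E (E * y)))\<^sup>2"
      using norm_add_sq_le by (metis norm_minus_commute)
    also have "\<dots> \<le> 2 * (400 * (x - y)\<^sup>2 / ((x\<^sup>2 + 1) * (y\<^sup>2 + 1))) + 2 * (4 * (x - y)\<^sup>2 / ((x\<^sup>2 + 1) * (y\<^sup>2 + 1)))"
      using cut_bubble_lip[OF E, of "E * x" "E * y"] bubble_lip[of E "E * x" "E * y"] E(1) unfolding key by simp
    also have "\<dots> = 808 * (x - y)\<^sup>2 / ((x\<^sup>2 + 1) * (y\<^sup>2 + 1))" by (simp add: add_divide_distrib[symmetric] distrib_right[symmetric])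
    finally have "gagliardo (R n) z \<le> 808 * (x - y)\<^sup>2 / ((x\<^sup>2 + 1) * (y\<^sup>2 + 1)) / (x - y)\<^sup>2"
      unfolding gagliardo_def x_def y_def by (intro divide_right_mono) auto
    also have "\<dots> \<le> 808 / ((x\<^sup>2 + 1) * (y\<^sup>2 + 1))" by (cases "x = y") auto
    finally show ?thesis by (simp add: x_def y_def)
  qed
  have Rlim: "(\<lambda>n. R n x) \<longlonglongrightarrow> 0" for x
  proof -
    have e0: "e \<longlonglongrightarrow> 0" unfolding e_def by real_asymp
    have "(\<lambda>n. tent (e n * x)) \<longlonglongrightarrow> max 0 (1 - (0 * x)\<^sup>2)"
      unfolding tent_def by (intro tendsto_intros tendsto_max e0)
    then have t1: "(\<lambda>n. tent (e n * x)) \<longlonglongrightarrow> 1" by simp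
    have "(\<lambda>n. bubble (tent (e n * x)) x) \<longlonglongrightarrow> bubble 1 x"
      unfolding bubble_def by (intro tendsto_intros t1) (use bubble_denom[of 1 x] in simp)
    from tendsto_diff[OF this tendsto_const[of "bubble 1 x"]] show ?thesis unfolding Reval by simp
  qed
  have "(\<lambda>n. \<integral>z. gagliardo (R n) z \<partial>plane) \<longlonglongrightarrow> (\<integral>z. 0 \<partial>plane)"
  proof (rule integral_dominated_convergence[where w = ?w])
    show "integrable plane ?w" by (rule lorentz_plane(1)) auto
    show "AE z in plane. norm (gagliardo (R n) z) \<le> ?w z" for n using bound gagliardo_nonneg[of "R n"] by (intro AE_I2) simp
    have "(\<lambda>n. gagliardo (R n) z) \<longlonglongrightarrow> 0" for z
    proof -
      have "(\<lambda>n. (cmod (R n (fst z) - R n (snd z)))\<^sup>2 * (1 / (fst z - snd z)\<^sup>2)) \<longlonglongrightarrow> (cmod (0 - 0))\<^sup>2 * (1 / (fst z - snd z)\<^sup>2)"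
        by (intro tendsto_intros Rlim)
      then show ?thesis by (simp add: gagliardo_def)
    qed
    then show "AE z in plane. (\<lambda>n. gagliardo (R n) z) \<longlonglongrightarrow> 0" by (intro AE_I2)
  qed auto
  then have "(\<lambda>n. 2 * pi * En (D n)) \<longlonglongrightarrow> 0"
    using gagliardo_integrable(2)[of "R _", OF _ Rfin] by (simp add: ER)
  from tendsto_mult_left[OF this, of "1 / (2 * pi)"] show ?thesis by (simp add: D_def[abs_def] e_def)
qed

text \<open>
  Multiplying \<open>u\<close> by a small tapered bubble differs from multiplying by the bubble itself by a term of
  small energy. Degree and energy are therefore those found in \<open>deg_bubble\<close> and \<open>En_times_bubble_le\<close>.
\<close>

theorem bubble_competitor:
  assumes u: "S1_map u" and \<epsilon>: "\<epsilon> > 0"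
  obtains v where "S1_map v" "\<And>x. x \<notin> {-1<..<1} \<Longrightarrow> v x = u x" "deg v = deg u + 1" "En v \<le> En u + 2 * pi + \<epsilon>"
proof -
  note [measurable] = S1_map_measurable[OF u]
  define e where "e n = 1 / (real n + 1)" for n :: nat
  have e: "0 < e n" "e n \<le> 1" for n by (auto simp: e_def divide_simps)
  have e0: "e \<longlonglongrightarrow> 0" unfolding e_def by real_asymp
  define D where "D n x = cut_bubble (e n) x - bubble (e n) x" for n x
  have [measurable]: "D n \<in> borel_measurable borel" for n unfolding D_def by measurable
  have Dfin: "seminorm_sq (D n) < \<infinity>" for n
    unfolding D_def by (rule diff_fin(1)[OF cut_bubble_S1_map[OF e] bubble_S1_map(1)[OF e(1)]])
  have ED: "(\<lambda>n. En (D n)) \<longlonglongrightarrow> 0" using cut_bubble_diff_energy by (simp add: D_def[abs_def] e_def)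
  define \<eta> where "\<eta> n = En (\<lambda>x. u x * D n x)" for n
  have uD: "\<eta> n \<le> 2 * (2 * e n)\<^sup>2 * En u + 2 * En (D n)" "seminorm_sq (\<lambda>x. u x * D n x) < \<infinity>" for n
    unfolding \<eta>_def using En_mult_le[OF u _ _ Dfin, of n "2 * e n"] cut_bubble_diff_sup[OF e(1)] by (auto simp: D_def)
  have "(\<lambda>n. 2 * (2 * e n)\<^sup>2 * En u + 2 * En (D n)) \<longlonglongrightarrow> 2 * (2 * 0)\<^sup>2 * En u + 2 * 0"
    by (intro tendsto_intros e0 ED)
  then have up0: "(\<lambda>n. 2 * (2 * e n)\<^sup>2 * En u + 2 * En (D n)) \<longlonglongrightarrow> 0" by simp
  have \<eta>0: "\<eta> \<longlonglongrightarrow> 0"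
  proof (rule tendsto_sandwich[OF _ _ tendsto_const up0])
    show "\<forall>\<^sub>F n in sequentially. 0 \<le> \<eta> n" by (intro always_eventually allI) (simp only: \<eta>_def En_nonneg)
    show "\<forall>\<^sub>F n in sequentially. \<eta> n \<le> 2 * (2 * e n)\<^sup>2 * En u + 2 * En (D n)" by (intro always_eventually allI uD(1))
  qed
  (* L bounds both energies in deg_close as soon as the error \<eta> is at most 1. *)
  define L where "L = 2 * (2 * En u + 4 * pi) + 2"
  have L: "0 < L" using En_nonneg[of u] by (simp add: L_def add_nonneg_pos)
  define K where "K = En u + 2 * pi + \<epsilon> / 4"
  have K: "0 < K" using En_nonneg[of u] \<epsilon> pi_gt_zero unfolding K_def by linarith
  define \<tau> where "\<tau> = \<epsilon> / (4 * K)"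
  have \<tau>: "0 < \<tau>" "\<tau> * K = \<epsilon> / 4" unfolding \<tau>_def using K \<epsilon> by simp_all
  obtain e1 where e1: "e1 > 0" "\<And>e. 0 < e \<Longrightarrow> e < e1 \<Longrightarrow> En (\<lambda>x. u x * bubble e x) \<le> K"
    using En_times_bubble_le[OF u, of "\<epsilon> / 4"] \<epsilon> unfolding K_def by auto
  have "eventually (\<lambda>n. e n < e1) sequentially" using order_tendstoD(2)[OF e0 e1(1)] .
  moreover have "eventually (\<lambda>n. \<eta> n < 1) sequentially" using order_tendstoD(2)[OF \<eta>0, of 1] by simp
  moreover have "eventually (\<lambda>n. \<eta> n < 5 / L) sequentially" using order_tendstoD(2)[OF \<eta>0, of "5 / L"] L by simp
  moreover have "eventually (\<lambda>n. \<eta> n < \<epsilon> / 4 / (1 + 1 / \<tau>)) sequentially"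
    using order_tendstoD(2)[OF \<eta>0, of "\<epsilon> / 4 / (1 + 1 / \<tau>)"] \<tau> \<epsilon> by (simp add: add_pos_pos)
  ultimately have "eventually (\<lambda>n. e n < e1 \<and> \<eta> n < 1 \<and> \<eta> n < 5 / L \<and> \<eta> n < \<epsilon> / 4 / (1 + 1 / \<tau>)) sequentially"
    by eventually_elim simp
  then obtain n where n: "e n < e1" "\<eta> n < 1" "\<eta> n < 5 / L" "\<eta> n < \<epsilon> / 4 / (1 + 1 / \<tau>)"
    by (auto simp: eventually_sequentially)
  define b where "b x = u x * bubble (e n) x" for x
  define v where "v x = u x * cut_bubble (e n) x" for x
  define d where "d x = u x * D n x" for x
  have nb: "S1_map b" unfolding b_def by (rule S1_map_mult(1)[OF u bubble_S1_map(1)[OF e(1)]])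
  have nv: "S1_map v" unfolding v_def by (rule S1_map_mult(1)[OF u cut_bubble_S1_map[OF e]])
  note [measurable] = S1_map_measurable[OF nb] S1_map_measurable[OF nv]
  have [measurable]: "d \<in> borel_measurable borel" unfolding d_def by measurable
  have vbd: "v x - b x = d x" for x by (simp add: v_def b_def d_def D_def algebra_simps)
  have dfin: "seminorm_sq d < \<infinity>" "En d = \<eta> n" unfolding d_def using uD(2) by (simp_all add: \<eta>_def)
  have vdiff: "v x - v y = (b x - b y) + (d x - d y)" for x y using vbd[of x] vbd[of y] by (simp add: algebra_simps)
  have bL: "En b \<le> 2 * En u + 4 * pi" unfolding b_def
    using S1_map_mult(2)[OF u bubble_S1_map(1)[OF e(1)[of n]]] bubble_S1_map(2)[OF e(1)[of n]] by simp
  have "En v \<le> 2 * En b + 2 * En d"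
    by (rule En_dominated(1)) (use dfin S1_map_fin[OF nb] in \<open>auto simp: vdiff norm_add_sq_le\<close>)
  then have vL: "En v \<le> L" using bL n(2) dfin(2) by (simp add: L_def)
  have dgv: "deg v = deg b"
  proof (rule deg_close[OF nv nb vL _ L])
    show "En b \<le> L" using bL En_nonneg[of u] pi_gt_zero unfolding L_def by argo
    show "L * En (\<lambda>x. v x - b x) < 5"
      unfolding vbd using n(3) L dfin(2) by (simp add: field_simps)
  qed
  have dgb: "deg b = deg u + 1" unfolding b_def by (rule deg_bubble[OF u e(1)])
  have "En v \<le> (1 + \<tau>) * En b + (1 + 1 / \<tau>) * En d"
    by (rule En_dominated(1)) (use dfin S1_map_fin[OF nb] \<tau> in \<open>auto simp: vdiff intro: cmod_add_weighted\<close>)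
  also have "\<dots> \<le> (1 + \<tau>) * K + \<epsilon> / 4"
  proof (rule add_mono)
    show "(1 + \<tau>) * En b \<le> (1 + \<tau>) * K" using e1(2)[OF e(1) n(1)] \<tau> by (intro mult_left_mono) (auto simp: b_def[abs_def])
    have "0 < 1 + 1 / \<tau>" using \<tau> by (simp add: add_pos_pos)
    from n(4)[unfolded pos_less_divide_eq[OF this]] have "(1 + 1 / \<tau>) * \<eta> n < \<epsilon> / 4" by (subst mult.commute)
    then show "(1 + 1 / \<tau>) * En d \<le> \<epsilon> / 4" unfolding dfin(2) by (rule less_imp_le)
  qed
  also have "\<dots> = K + \<epsilon> / 4 + \<epsilon> / 4" using \<tau>(2) by (simp add: algebra_simps)
  also have "\<dots> \<le> En u + 2 * pi + \<epsilon>" using \<epsilon> by (simp add: K_def)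
  finally have Ev: "En v \<le> En u + 2 * pi + \<epsilon>" .
  show thesis
    by (rule that[of v]) (use nv dgv dgb Ev in \<open>auto simp: v_def cut_bubble_outside\<close>)
qed

section \<open>Competitors, degree one and higher degrees\<close>

lemma g_map_bubble: assumes "lam > 0" shows "g_map lam x = \<i> * bubble lam x"
proof -
  have "g_map lam x = \<i> * bubble 1 (x / lam)"
    by (simp add: g_map_def chr_1_Pi_plus_inv[symmetric] chr_1_bubble)
  also have "bubble 1 (x / lam) = bubble lam x"
  proof -
    have "bubble lam x = (of_real lam * (of_real (x / lam) - \<i> * of_real 1)) / (of_real lam * (of_real (x / lam) + \<i> * of_real 1))"
      using assms by (simp add: bubble_def algebra_simps)
    then show ?thesis using assms by (simp add: bubble_def)
  qed
  finally show ?thesis .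
qed

lemma S1_map_one: "S1_map (\<lambda>_. 1)" and deg_one: "deg (\<lambda>_. 1) = 0"
proof -
  show "S1_map (\<lambda>_. 1)" by (simp add: S1_map_def seminorm_sq_def)
  have "of_int k * (cmod (coef (\<lambda>_. 1) k))\<^sup>2 = 0" for k
    by (simp add: coef_def integral_chr)
  then show "deg (\<lambda>_. 1) = 0" by (simp only: deg_def) simp
qed

lemma g_map_props:
  assumes "lam > 0"
  shows "S1_map (g_map lam)" "deg (g_map lam) = 1" "En (g_map lam) = 2 * pi"
proof -
  have e: "g_map lam = (\<lambda>x. \<i> * bubble lam x)" using g_map_bubble[OF assms] by auto
  show n: "S1_map (g_map lam)" unfolding e by (rule S1_map_const_mult[OF bubble_S1_map(1)[OF assms]]) simp
  have "deg (g_map lam) = deg (bubble lam)" unfolding e by (rule deg_const_mult) simp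
  also have "\<dots> = 1" using deg_bubble[OF S1_map_one assms] deg_one by simp
  finally show d: "deg (g_map lam) = 1" .
  have "En (g_map lam) \<le> 2 * pi" unfolding e using En_const_mult[of \<i> "bubble lam"] bubble_S1_map(2)[OF assms] by simp
  then show "En (g_map lam) = 2 * pi" using En_ge_deg[OF n] d by simp
qed

definition competitors :: "(real \<Rightarrow> complex) \<Rightarrow> (real \<Rightarrow> complex) set" where
  "competitors g = {v. S1_map v \<and> (\<forall>x. x \<notin> {-1<..<1} \<longrightarrow> v x = g x)}"

abbreviation (input) unit_ivl :: "real set" where "unit_ivl \<equiv> {-1<..<1}"

lemma competitors_adm:
  assumes "v \<in> competitors g"
  shows "v \<in> adm unit_ivl g" "energy v = ennreal (En v)" "degree_line v = deg v"
proof -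
  have v: "S1_map v" "\<And>x. x \<notin> unit_ivl \<Longrightarrow> v x = g x" using assms by (auto simp: competitors_def)
  show "v \<in> adm unit_ivl g" using S1_map_Hdot_S1[OF v(1)] v(2) by (simp add: adm_def)
  show "energy v = ennreal (En v)" "degree_line v = deg v"
    using energy_En[OF v(1)] degree_line_deg[OF v(1)] by auto
qed

lemma adm_competitors:
  assumes g: "S1_map g" and u: "u \<in> adm unit_ivl g"
  obtains v where "v \<in> competitors g" "AE x in lborel. v x = u x" "energy u = ennreal (En v)" "degree_line u = deg v"
proof -
  have u': "u \<in> Hdot_S1" "AE x in lborel. x \<notin> unit_ivl \<longrightarrow> u x = g x"
    using u by (auto simp: adm_def AE_completion_iff)
  obtain v0 where v0: "S1_map v0" "AE x in lborel. v0 x = u x" using Hdot_S1_representative[OF u'(1)] by blast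
  note [measurable] = S1_map_measurable[OF g] S1_map_measurable[OF v0(1)]
  define v where "v x = (if x \<in> unit_ivl then v0 x else g x)" for x
  have [measurable]: "v \<in> borel_measurable borel" unfolding v_def by measurable
  have ae: "AE x in lborel. v x = u x" using u'(2) v0(2) by eventually_elim (auto simp: v_def)
  have ae0: "AE x in lborel. v x = v0 x" using ae v0(2) by eventually_elim simp
  have "seminorm_sq v < \<infinity>" using seminorm_sq_cong_AE[OF ae0] S1_map_fin[OF v0(1)] by simp
  moreover have "cmod (v x) = 1" for x using S1_map_cmod[OF g] S1_map_cmod[OF v0(1)] by (simp add: v_def)
  ultimately have "S1_map v" unfolding S1_map_def by simp
  then have "v \<in> competitors g" by (simp add: competitors_def v_def)
  then show thesis using ae energy_En[OF \<open>S1_map v\<close> ae] degree_line_deg[OF \<open>S1_map v\<close> ae] that by blast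
qed

lemma deg_cong_AE:
  assumes "S1_map u" "S1_map v" "AE x in lborel. u x = v x" shows "deg u = deg v"
proof -
  note [measurable] = S1_map_measurable[OF assms(1)] S1_map_measurable[OF assms(2)]
  have "coef u k = coef v k" for k
  proof -
    have "(\<integral>x. u x * chr (- k) x \<partial>circ) = (\<integral>x. v x * chr (- k) x \<partial>circ)"
      by (rule integral_cong_AE) (use assms(3) in \<open>auto simp: AE_circ elim!: eventually_mono\<close>)
    then show ?thesis by (simp add: coef_def)
  qed
  then show ?thesis by (simp add: deg_def)
qed

text \<open>
  Both maps have no negative frequencies, and their difference vanishes off the interval.
\<close>

lemma rigidity:
  assumes lam: "lam > 0" and v: "v \<in> competitors (g_map lam)" and eq: "En v = 2 * pi * deg v"
  shows "AE x in lborel. v x = g_map lam x"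
proof -
  have nv: "S1_map v" "\<And>x. x \<notin> unit_ivl \<Longrightarrow> v x = g_map lam x" using v by (auto simp: competitors_def)
  note g = g_map_props[OF lam]
  have "AE x in lborel. v x - g_map lam x = 0"
  proof (rule hardy_vanishing[OF diff_fin(2)[OF nv(1) g(1)] diff_fin(3)[OF nv(1) g(1)] diff_fin(1)[OF nv(1) g(1)]])
    show "v x - g_map lam x = 0" if "x \<notin> {-1..1}" for x using nv(2)[of x] that by auto
    show "coef (\<lambda>x. v x - g_map lam x) k = 0" if "k < 0" for k
    proof -
      have "coef (\<lambda>x. v x - g_map lam x) k = coef v k - coef (g_map lam) k"
        by (rule coef_diff[where B = 1 and C = 1]) (use nv g in \<open>auto simp: S1_map_def\<close>)
      then show ?thesis using coef_neg_zero[OF nv(1) eq that] coef_neg_zero[OF g(1) _ that] g by simp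
    qed
  qed
  then show ?thesis by simp
qed

lemma minimizes_admI:
  assumes g: "S1_map g" and v: "v \<in> competitors g" and le: "\<And>w. w \<in> competitors g \<Longrightarrow> En v \<le> En w"
  shows "minimizes v (adm unit_ivl g)"
  unfolding minimizes_def
proof (intro conjI ballI)
  show "v \<in> adm unit_ivl g" by (rule competitors_adm(1)[OF v])
  fix u assume "u \<in> adm unit_ivl g"
  from adm_competitors[OF g this] obtain w where "w \<in> competitors g" "energy u = ennreal (En w)" by blast
  then show "energy v \<le> energy u" using le competitors_adm(2)[OF v] by (simp add: ennreal_leI)
qed

lemma minimizes_adm_degI:
  assumes g: "S1_map g" and v: "v \<in> competitors g" "deg v = of_int k"
    and le: "\<And>w. w \<in> competitors g \<Longrightarrow> deg w = of_int k \<Longrightarrow> En v \<le> En w"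
  shows "minimizes v (adm_deg unit_ivl g k)"
  unfolding minimizes_def
proof (intro conjI ballI)
  show "v \<in> adm_deg unit_ivl g k" using competitors_adm[OF v(1)] v(2) by (simp add: adm_deg_def)
  fix u assume "u \<in> adm_deg unit_ivl g k"
  then have u: "u \<in> adm unit_ivl g" "degree_line u = of_int k" by (auto simp: adm_deg_def)
  from adm_competitors[OF g u(1)] obtain w where "w \<in> competitors g" "energy u = ennreal (En w)" "degree_line u = deg w" by blast
  then show "energy v \<le> energy u" using le u(2) competitors_adm(2)[OF v(1)] by (simp add: ennreal_leI)
qed

lemma minimizer_competitor:
  assumes g: "S1_map g" and min: "minimizes u (adm_deg unit_ivl g k)"
  obtains v where "v \<in> competitors g" "AE x in lborel. v x = u x" "deg v = of_int k"
    "\<And>w. w \<in> competitors g \<Longrightarrow> deg w = of_int k \<Longrightarrow> En v \<le> En w"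
proof -
  have u: "u \<in> adm unit_ivl g" "degree_line u = of_int k" "\<And>w. w \<in> adm_deg unit_ivl g k \<Longrightarrow> energy u \<le> energy w"
    using min by (auto simp: minimizes_def adm_deg_def)
  obtain v where v: "v \<in> competitors g" "AE x in lborel. v x = u x" "energy u = ennreal (En v)" "degree_line u = deg v"
    using adm_competitors[OF g u(1)] by blast
  have "En v \<le> En w" if "w \<in> competitors g" "deg w = of_int k" for w
  proof -
    have "energy u \<le> energy w" using competitors_adm[OF that(1)] that(2) by (intro u(3)) (simp add: adm_deg_def)
    then show ?thesis using v(3) competitors_adm(2)[OF that(1)] En_nonneg[of w] by simp
  qed
  then show thesis using that v u(2) by auto
qed

text \<open>
  The datum attains the lower bound \<open>2 \<pi>\<close> valid in degree one, and any map attaining it is rigid.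
\<close>

theorem degree_one_unique_minimizer: assumes lam: "lam > 0" shows "unique_minimizer (g_map lam) (adm_deg unit_ivl (g_map lam) 1)"
  unfolding unique_minimizer_def
proof (intro conjI allI impI)
  note g = g_map_props[OF lam]
  have gc: "g_map lam \<in> competitors (g_map lam)" using g by (simp add: competitors_def)
  show "minimizes (g_map lam) (adm_deg unit_ivl (g_map lam) 1)"
  proof (rule minimizes_adm_degI[OF g(1) gc])
    show "En (g_map lam) \<le> En w" if "w \<in> competitors (g_map lam)" "deg w = of_int 1" for w
      using En_ge_deg[of w] that g(3) by (simp add: competitors_def)
  qed (use g in simp)
  fix u assume "minimizes u (adm_deg unit_ivl (g_map lam) 1)"
  from minimizer_competitor[OF g(1) this] obtain v where v: "v \<in> competitors (g_map lam)" "AE x in lborel. v x = u x" "deg v = 1"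
    "\<And>w. w \<in> competitors (g_map lam) \<Longrightarrow> deg w = 1 \<Longrightarrow> En v \<le> En w" by auto
  have "En v \<le> 2 * pi" using v(4)[OF gc] g by simp
  moreover have "2 * pi \<le> En v" using En_ge_deg[of v] v by (simp add: competitors_def)
  ultimately have "AE x in lborel. v x = g_map lam x" using v(3) by (intro rigidity[OF lam v(1)]) simp
  then have "AE x in lborel. u x = g_map lam x" using v(2) by eventually_elim simp
  then show "AE x in lebesgue. u x = g_map lam x" by (simp add: AE_completion_iff)
qed

text \<open>
  Starting from the datum, each further degree costs at most \<open>2 \<pi>\<close> and half of the remaining error.
\<close>

lemma ex_high_degree:
  assumes lam: "lam > 0" and e: "\<epsilon> > 0"
  shows "\<exists>v\<in>competitors (g_map lam). deg v = 1 + real m \<and> En v \<le> 2 * pi * (1 + real m) + \<epsilon>"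
  using e
proof (induction m arbitrary: \<epsilon>)
  case 0
  then show ?case using g_map_props[OF lam] by (intro bexI[of _ "g_map lam"]) (auto simp: competitors_def)
next
  case (Suc m)
  have e2: "\<epsilon> / 2 > 0" using Suc.prems by simp
  from Suc.IH[OF e2] obtain u where u: "u \<in> competitors (g_map lam)" "deg u = 1 + real m" "En u \<le> 2 * pi * (1 + real m) + \<epsilon> / 2" by blast
  have nu: "S1_map u" using u(1) by (simp add: competitors_def)
  obtain v where v: "S1_map v" "\<And>x. x \<notin> {-1<..<1} \<Longrightarrow> v x = u x" "deg v = deg u + 1" "En v \<le> En u + 2 * pi + \<epsilon> / 2"
    using bubble_competitor[OF nu e2] by blast
  have "v \<in> competitors (g_map lam)" using u(1) v(1,2) by (auto simp: competitors_def)
  moreover have "En v \<le> 2 * pi * (1 + real (Suc m)) + \<epsilon>" using v(4) u(3) by (simp add: algebra_simps)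
  ultimately show ?case using v(3) u(2) by (intro bexI[of _ v]) auto
qed

text \<open>
  Bubbling shows that the infimum is the lower bound \<open>2 \<pi> k\<close>. A minimizer would attain it and coincide
  with the datum by rigidity, but the datum has degree one.
\<close>

theorem no_minimizer_of_higher_degree: assumes lam: "lam > 0" and k: "k > 1" shows "\<not> (\<exists>u. minimizes u (adm_deg unit_ivl (g_map lam) k))"
proof
  assume "\<exists>u. minimizes u (adm_deg unit_ivl (g_map lam) k)"
  then obtain u where "minimizes u (adm_deg unit_ivl (g_map lam) k)" by blast
  note g = g_map_props[OF lam]
  from minimizer_competitor[OF g(1) \<open>minimizes u _\<close>] obtain v where v: "v \<in> competitors (g_map lam)" "deg v = of_int k"
    "\<And>w. w \<in> competitors (g_map lam) \<Longrightarrow> deg w = of_int k \<Longrightarrow> En v \<le> En w" by blast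
  have nv: "S1_map v" using v(1) by (simp add: competitors_def)
  have km: "1 + real (nat (k - 1)) = of_int k" using k by simp
  have "En v \<le> 2 * pi * of_int k"
  proof (rule field_le_epsilon)
    fix \<epsilon> :: real assume "\<epsilon> > 0"
    from ex_high_degree[OF lam this, of "nat (k - 1)"] obtain w
      where "w \<in> competitors (g_map lam)" "deg w = of_int k" "En w \<le> 2 * pi * of_int k + \<epsilon>" unfolding km by blast
    then show "En v \<le> 2 * pi * of_int k + \<epsilon>" using v(3) by fastforce
  qed
  moreover have "2 * pi * of_int k \<le> En v" using En_ge_deg[OF nv] v(2) k by simp
  ultimately have "AE x in lborel. v x = g_map lam x" using v(2) by (intro rigidity[OF lam v(1)]) simp
  then have "deg v = 1" using deg_cong_AE[OF nv g(1)] g(2) by simp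
  then show False using v(2) k by simp
qed

section \<open>Large scales\<close>

lemma coef_chr_1: "coef (chr 1) k = (if k = 1 then of_real (sqrt (2 * pi)) else 0)"
proof -
  have "chr 1 x * chr (- k) x = chr (1 - k) x" for x using chr_add[of 1 "- k" x] by simp
  then have "coef (chr 1) k = of_real (1 / sqrt (2 * pi)) * (if k = 1 then of_real (2 * pi) else 0)"
    by (simp add: coef_def integral_chr)
  also have "\<dots> = (if k = 1 then of_real (1 / sqrt (2 * pi) * (2 * pi)) else 0)" by (simp only: of_real_mult) simp
  also have "1 / sqrt (2 * pi) * (2 * pi) = sqrt (2 * pi)" by (simp add: real_div_sqrt)
  finally show ?thesis .
qed

lemma S1_map_chr_1: "S1_map (chr 1)"
proof -
  have "chr 1 = (\<lambda>x. \<i> * bubble 1 x)" by (auto simp: chr_1_bubble)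
  then show ?thesis using S1_map_const_mult[OF bubble_S1_map(1), of 1 \<i>] by simp
qed

lemma cmod_add_sq: "(cmod (a + b))\<^sup>2 = (cmod a)\<^sup>2 + 2 * Re (a * cnj b) + (cmod b)\<^sup>2"
  unfolding cmod_power2 by (simp add: power2_eq_square algebra_simps)

text \<open>
  The energies of \<open>f\<close> and of \<open>w = f - chr 1\<close> differ only in the coefficient of index 1, which contributes
  a term linear in \<open>w\<close>. Unimodularity of \<open>f\<close> makes this term quadratic: \<open>2 * Re (w * cnj (chr 1))\<close> is
  \<open>- \<bar>w\<bar>\<^sup>2\<close>.
\<close>

lemma energy_expansion:
  assumes f: "S1_map f"
  shows "En f = 2 * pi + En (\<lambda>x. f x - chr 1 x) - (\<integral>x. (cmod (f x - chr 1 x))\<^sup>2 \<partial>circ)"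
proof -
  note [measurable] = S1_map_measurable[OF f]
  define w where "w x = f x - chr 1 x" for x
  have [measurable]: "w \<in> borel_measurable borel" unfolding w_def by measurable
  have wb: "cmod (w x) \<le> 2" for x unfolding w_def by (rule diff_fin(3)[OF f S1_map_chr_1])
  have cw: "coef w k = coef f k - coef (chr 1) k" for k
    unfolding w_def by (rule coef_diff[where B = 1 and C = 1]) (use f in \<open>auto simp: S1_map_def\<close>)
  have hw: "((\<lambda>k. of_int \<bar>k\<bar> * (cmod (coef w k))\<^sup>2) has_sum En w) UNIV"
    unfolding w_def by (rule energy_fourier[OF diff_fin(2)[OF f S1_map_chr_1] diff_fin(3)[OF f S1_map_chr_1] diff_fin(1)[OF f S1_map_chr_1]])
  have "((\<lambda>k. of_int \<bar>k\<bar> * (cmod (coef f k))\<^sup>2 - of_int \<bar>k\<bar> * (cmod (coef w k))\<^sup>2) has_sum (En f - En w)) UNIV"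
    by (rule has_sum_diff_real[OF S1_map_energy[OF f] hw])
  moreover have "((\<lambda>k. of_int \<bar>k\<bar> * (cmod (coef f k))\<^sup>2 - of_int \<bar>k\<bar> * (cmod (coef w k))\<^sup>2) has_sum ((cmod (coef f 1))\<^sup>2 - (cmod (coef w 1))\<^sup>2)) UNIV"
    by (rule has_sum_finite_neutralI[of "{1}"]) (auto simp: cw coef_chr_1)
  ultimately have 1: "En f - En w = (cmod (coef f 1))\<^sup>2 - (cmod (coef w 1))\<^sup>2" by (rule has_sum_unique)
  have "coef f 1 = coef w 1 + of_real (sqrt (2 * pi))" by (simp add: cw coef_chr_1)
  then have "(cmod (coef f 1))\<^sup>2 = (cmod (coef w 1))\<^sup>2 + 2 * (sqrt (2 * pi) * Re (coef w 1)) + (sqrt (2 * pi))\<^sup>2"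
    unfolding cmod_power2 by (simp add: power2_eq_square algebra_simps)
  moreover have "2 * (sqrt (2 * pi) * Re (coef w 1)) = - (\<integral>x. (cmod (w x))\<^sup>2 \<partial>circ)"
  proof -
    have i: "integrable circ (\<lambda>x. w x * chr (- 1) x)"
      by (rule integrable_circ_bounded[where B = 2]) (use wb in \<open>auto simp: norm_mult\<close>)
    have pt: "Re (w x * chr (- 1) x) = - 1 / 2 * (cmod (w x))\<^sup>2" for x
    proof -
      have "chr (- 1) x = cnj (chr 1 x)" by simp
      have "(cmod (w x + chr 1 x))\<^sup>2 = 1" using S1_map_cmod[OF f, of x] by (simp add: w_def)
      moreover have "(cmod (w x + chr 1 x))\<^sup>2 = (cmod (w x))\<^sup>2 + 2 * Re (w x * cnj (chr 1 x)) + (cmod (chr 1 x))\<^sup>2"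
        by (rule cmod_add_sq)
      ultimately show ?thesis by simp
    qed
    have "sqrt (2 * pi) * Re (coef w 1) = Re (of_real (sqrt (2 * pi)) * coef w 1)" by (simp only: Re_complex_of_real Im_complex_of_real times_complex.simps)
    also have "\<dots> = Re (\<integral>x. w x * chr (- 1) x \<partial>circ)" by (simp only: coef_integral)
    also have "\<dots> = (\<integral>x. - 1 / 2 * (cmod (w x))\<^sup>2 \<partial>circ)"
      unfolding integral_Re[OF i, symmetric] pt ..
    finally show ?thesis by simp
  qed
  ultimately show ?thesis using 1 unfolding w_def[symmetric] by simp
qed

text \<open>
  The function vanishes on \<open>{r..2 * r}\<close>, whose points are within \<open>3 * r\<close> of the support, so these pairs
  alone bound the mass of \<open>w\<close> by the energy.
\<close>

lemma poincare_small_support: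
  assumes [measurable]: "w \<in> borel_measurable borel" and fin: "seminorm_sq w < \<infinity>" and b: "\<And>x. cmod (w x) \<le> C"
    and r: "r > 0" and supp: "\<And>x. r \<le> \<bar>x\<bar> \<Longrightarrow> w x = 0"
  shows "(\<integral>x. (cmod (w x))\<^sup>2 \<partial>circ) \<le> 36 * pi * r * En w"
proof -
  have i: "integrable circ (\<lambda>x. (cmod (w x))\<^sup>2)"
    by (rule integrable_circ_bounded[where B = "C\<^sup>2"]) (use b in \<open>auto intro: power_mono\<close>)
  have "ennreal (\<integral>x. (cmod (w x))\<^sup>2 \<partial>circ) = (\<integral>\<^sup>+x. ennreal ((cmod (w x))\<^sup>2) \<partial>circ)"
    by (rule nn_integral_eq_integral[OF i, symmetric]) simp
  also have "\<dots> = (\<integral>\<^sup>+x. ennreal (2 / (1 + x\<^sup>2)) * ennreal ((cmod (w x))\<^sup>2) \<partial>lborel)"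
    unfolding circ_def by (rule nn_integral_density) auto
  also have "\<dots> \<le> (\<integral>\<^sup>+x. (\<integral>\<^sup>+y. ennreal (18 * r) * ennreal ((cmod (w x - w y))\<^sup>2 / (x - y)\<^sup>2) \<partial>lborel) \<partial>lborel)"
  proof (rule nn_integral_mono)
    fix x
    have "ennreal (2 / (1 + x\<^sup>2)) * ennreal ((cmod (w x))\<^sup>2) \<le> ennreal 2 * ennreal ((cmod (w x))\<^sup>2)"
      by (intro mult_right_mono ennreal_leI) (auto simp: divide_le_eq)
    also have "\<dots> = ennreal (2 * (cmod (w x))\<^sup>2)" by (rule ennreal_mult[symmetric]) auto
    also have "\<dots> = ennreal (2 * (cmod (w x))\<^sup>2 / r * r)" using r by simp
    also have "\<dots> = ennreal (2 * (cmod (w x))\<^sup>2 / r) * ennreal r" by (rule ennreal_mult) (use r in auto)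
    also have "\<dots> = (\<integral>\<^sup>+y. ennreal (2 * (cmod (w x))\<^sup>2 / r) * indicator {r..2 * r} y \<partial>lborel)"
      using r by (simp add: nn_integral_cmult_indicator)
    also have "\<dots> \<le> (\<integral>\<^sup>+y. ennreal (18 * r) * ennreal ((cmod (w x - w y))\<^sup>2 / (x - y)\<^sup>2) \<partial>lborel)"
    proof (rule nn_integral_mono)
      fix y
      show "ennreal (2 * (cmod (w x))\<^sup>2 / r) * indicator {r..2 * r} y \<le> ennreal (18 * r) * ennreal ((cmod (w x - w y))\<^sup>2 / (x - y)\<^sup>2)"
      proof (cases "y \<in> {r..2 * r} \<and> w x \<noteq> 0")
        case True
        then have x: "\<bar>x\<bar> < r" using supp[of x] by force
        have wy: "w y = 0" using supp[of y] True by auto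
        have "\<bar>x - y\<bar> \<le> 3 * r" using x True by auto
        then have "(x - y)\<^sup>2 \<le> (3 * r)\<^sup>2" by (subst power2_abs[symmetric]) (intro power_mono, auto)
        moreover have "0 < (x - y)\<^sup>2" using x True by auto
        ultimately have "(cmod (w x))\<^sup>2 / (3 * r)\<^sup>2 \<le> (cmod (w x))\<^sup>2 / (x - y)\<^sup>2"
          using r by (intro divide_left_mono) auto
        then have "18 * r * ((cmod (w x))\<^sup>2 / (3 * r)\<^sup>2) \<le> 18 * r * ((cmod (w x))\<^sup>2 / (x - y)\<^sup>2)"
          using r by (intro mult_left_mono) auto
        also have "18 * r * ((cmod (w x))\<^sup>2 / (3 * r)\<^sup>2) = 2 * (cmod (w x))\<^sup>2 / r"
          using r by (simp add: power2_eq_square)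
        finally have "ennreal (2 * (cmod (w x))\<^sup>2 / r) \<le> ennreal (18 * r * ((cmod (w x - w y))\<^sup>2 / (x - y)\<^sup>2))"
          unfolding wy by (intro ennreal_leI) simp
        also have "\<dots> = ennreal (18 * r) * ennreal ((cmod (w x - w y))\<^sup>2 / (x - y)\<^sup>2)"
          by (rule ennreal_mult) (use r in auto)
        finally have le: "ennreal (2 * (cmod (w x))\<^sup>2 / r) \<le> \<dots>" .
        have "indicator {r..2 * r} y = (1 :: ennreal)" using True by simp
        then show ?thesis using le by (simp only: mult_1_right)
      qed auto
    qed
    finally show "ennreal (2 / (1 + x\<^sup>2)) * ennreal ((cmod (w x))\<^sup>2) \<le> (\<integral>\<^sup>+y. ennreal (18 * r) * ennreal ((cmod (w x - w y))\<^sup>2 / (x - y)\<^sup>2) \<partial>lborel)" .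
  qed
  also have "\<dots> = ennreal (18 * r) * seminorm_sq w"
    unfolding seminorm_sq_def nn_integral_completion by (simp add: nn_integral_cmult)
  also have "\<dots> = ennreal (36 * pi * r * En w)"
    unfolding seminorm_sq_En[OF fin] using r En_nonneg[of w] by (simp add: mult_ac flip: ennreal_mult)
  finally show ?thesis using r En_nonneg[of w] by (simp add: ennreal_le_iff)
qed

text \<open>
  Rescaling by \<open>lam\<close> turns the datum into the first character and the interval into one of half-length
  \<open>1 / lam\<close>. There the Poincare constant is at most \<open>1 / 2\<close>, and \<open>energy_expansion\<close> exceeds \<open>2 \<pi>\<close> by
  at least half the energy of the perturbation.
\<close>

theorem large_scale_unique_minimizer: assumes lam: "lam \<ge> 72 * pi" shows "unique_minimizer (g_map lam) (adm unit_ivl (g_map lam))"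
proof -
  have lp: "lam > 0" using lam pi_gt_zero by linarith
  note g = g_map_props[OF lp]
  have gc: "g_map lam \<in> competitors (g_map lam)" using g by (simp add: competitors_def)
  have key: "2 * pi \<le> En v \<and> (En v \<le> 2 * pi \<longrightarrow> (AE x in lborel. v x = g_map lam x))" if v: "v \<in> competitors (g_map lam)" for v
  proof -
    have nv: "S1_map v" "\<And>x. x \<notin> unit_ivl \<Longrightarrow> v x = g_map lam x" using v by (auto simp: competitors_def)
    note [measurable] = S1_map_measurable[OF nv(1)] S1_map_measurable[OF g(1)]
    define f where "f x = v (lam * x)" for x
    have [measurable]: "f \<in> borel_measurable borel" unfolding f_def by measurable
    have Sf: "seminorm_sq f = seminorm_sq v" unfolding f_def by (rule seminorm_sq_scale) (use lp in auto)
    have nf: "S1_map f" unfolding S1_map_def using Sf S1_map_fin[OF nv(1)] S1_map_cmod[OF nv(1)] by (simp add: f_def)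
    have Ef: "En f = En v" by (simp add: En_def Sf)
    have gs: "g_map lam (lam * x) = chr 1 x" for x
      using lp by (simp add: g_map_def chr_1_Pi_plus_inv)
    define w where "w x = f x - chr 1 x" for x
    define N where "N = (\<integral>x. (cmod (w x))\<^sup>2 \<partial>circ)"
    have wm [measurable]: "w \<in> borel_measurable borel" unfolding w_def by measurable
    have wb: "cmod (w x) \<le> 2" for x unfolding w_def by (rule diff_fin(3)[OF nf S1_map_chr_1])
    have wfin: "seminorm_sq w < \<infinity>" unfolding w_def by (rule diff_fin(1)[OF nf S1_map_chr_1])
    have supp: "w x = 0" if "1 / lam \<le> \<bar>x\<bar>" for x
    proof -
      have "1 \<le> \<bar>lam * x\<bar>" using that lp by (simp add: abs_mult field_simps)
      then have "lam * x \<notin> unit_ivl" by auto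
      then show ?thesis using nv(2) gs by (simp add: w_def f_def)
    qed
    have N0: "0 \<le> N" unfolding N_def by simp
    have "N \<le> 36 * pi * (1 / lam) * En w"
      unfolding N_def by (rule poincare_small_support[OF wm wfin wb _ supp]) (use lp in auto)
    also have "\<dots> \<le> 1 / 2 * En w"
      by (rule mult_right_mono[OF _ En_nonneg]) (use lam lp in \<open>simp add: divide_le_eq\<close>)
    finally have NE: "N \<le> 1 / 2 * En w" .
    have ex: "En v = 2 * pi + En w - N"
      using energy_expansion[OF nf] unfolding Ef N_def w_def .
    have "AE x in lborel. v x = g_map lam x" if "En v \<le> 2 * pi"
    proof -
      have "N = 0" using that ex NE N0 En_nonneg[of w] by linarith
      moreover have "integrable circ (\<lambda>x. (cmod (w x))\<^sup>2)"
        by (rule integrable_circ_bounded[where B = "2\<^sup>2"]) (use power_mono[OF wb, of _ 2] in auto)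
      ultimately have "AE x in circ. (cmod (w x))\<^sup>2 = 0"
        unfolding N_def by (subst (asm) integral_nonneg_eq_0_iff_AE) auto
      then have "AE x in lborel. v (lam * x) = g_map lam (lam * x)"
        unfolding AE_circ by (simp add: w_def f_def gs)
      then have "AE x in lborel. v (lam * (0 + (1 / lam) * x)) = g_map lam (lam * (0 + (1 / lam) * x))"
        by (intro AE_borel_affine) (use lp in auto)
      then show ?thesis using lp by simp
    qed
    then show ?thesis using ex NE N0 En_nonneg[of w] by linarith
  qed
  have min: "minimizes (g_map lam) (adm unit_ivl (g_map lam))"
    by (rule minimizes_admI[OF g(1) gc]) (use key g(3) in simp)
  show ?thesis unfolding unique_minimizer_def
  proof (intro conjI allI impI min)
    fix u assume u: "minimizes u (adm unit_ivl (g_map lam))"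
    then have "u \<in> adm unit_ivl (g_map lam)" by (simp add: minimizes_def)
    from adm_competitors[OF g(1) this] obtain v where v: "v \<in> competitors (g_map lam)" "AE x in lborel. v x = u x" "energy u = ennreal (En v)" by blast
    have "energy u \<le> energy (g_map lam)" using u competitors_adm(1)[OF gc] by (simp add: minimizes_def)
    then have "En v \<le> 2 * pi" using v(3) competitors_adm(2)[OF gc] g(3) by simp
    then have "AE x in lborel. v x = g_map lam x" using key[OF v(1)] by blast
    then have "AE x in lborel. u x = g_map lam x" using v(2) by eventually_elim simp
    then show "AE x in lebesgue. u x = g_map lam x" by (simp add: AE_completion_iff)
  qed
qed

section \<open>The reflected competitor\<close>

text \<open>
  On the circle, \<open>x \<mapsto> 1 / x\<close> is complex conjugation. Since \<open>1 / 0 = 0\<close>, the point 0 is exceptional.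
\<close>

lemma circ_inverse: "distr circ borel (\<lambda>x. 1 / x) = circ"
proof (rule measure_eqI_lessThan[symmetric])
  fix a :: real
  show "emeasure circ {a<..} < \<infinity>" by (simp add: emeasure_circ_greaterThan)
  define A where "A = (\<lambda>x::real. 1 / x) -` {a<..}"
  have A [measurable]: "A \<in> sets borel"
  proof -
    have "(\<lambda>x::real. 1 / x) \<in> borel_measurable borel" by simp
    from measurable_sets[OF this, of "{a<..}"] show ?thesis by (simp add: A_def)
  qed
  have m: "measure circ {b<..} = pi - 2 * arctan b" for b
    using emeasure_circ_greaterThan[of b] arctan_ubound[of b] by (simp add: measure_def)
  have ii: "integrable circ (indicator B :: real \<Rightarrow> real)" if "B \<in> sets borel" for B
    by (rule integrable_circ_bounded[where B = 1]) (use that in \<open>auto simp: indicator_def\<close>)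
  have AE0: "AE x in circ. x \<noteq> 0 \<and> x \<noteq> 1 / a"
    unfolding AE_circ using AE_lborel_singleton[of 0] AE_lborel_singleton[of "1 / a"] by eventually_elim simp
  have "measure circ A = pi - 2 * arctan a"
  proof (cases a "0 :: real" rule: linorder_cases)
    case equal
    then have "A = {0<..}" by (auto simp: A_def)
    then show ?thesis using m[of 0] equal by simp
  next
    case greater
    have "(\<integral>x. indicator A x + indicator {1 / a<..} x \<partial>circ) = (\<integral>x. indicator {0<..} x \<partial>circ :: real)"
    proof (rule integral_cong_AE)
      show "AE x in circ. indicator A x + indicator {1 / a<..} x = (indicator {0<..} x :: real)"
        using AE0
      proof eventually_elim
        case (elim x)
        consider "x > 0" | "x < 0" using elim by linarith
        then show ?case
        proof cases
          case 1
          have "a < 1 / x \<longleftrightarrow> x < 1 / a" using 1 greater by (simp add: field_simps)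
          then show ?thesis using 1 elim by (auto simp: A_def indicator_def)
        next
          case 2
          have "0 < 1 / a" "1 / x < 0" using 2 greater by auto
          then have "\<not> a < 1 / x" "\<not> 1 / a < x" "\<not> 0 < x" using 2 greater by linarith+
          then have "x \<notin> A" "x \<notin> {1 / a<..}" "x \<notin> {0<..}" by (simp_all only: A_def vimage_eq greaterThan_iff) auto
          then show ?thesis by (simp add: indicator_def)
        qed
      qed
    qed auto
    then have "measure circ A + measure circ {1 / a<..} = measure circ {0<..}"
      using ii[OF A] ii[of "{1 / a<..}"] by simp
    then show ?thesis using m[of "1 / a"] m[of 0] Transcendental.arctan_inverse[of a] greater by (simp add: sgn_if field_simps)
  next
    case less
    have "(\<integral>x. indicator A x + indicator {1 / a<..} x \<partial>circ) = (\<integral>x. 1 + indicator {0<..} x \<partial>circ :: real)"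
    proof (rule integral_cong_AE)
      show "AE x in circ. indicator A x + indicator {1 / a<..} x = (1 + indicator {0<..} x :: real)"
        using AE0
      proof eventually_elim
        case (elim x)
        consider "x > 0" | "x < 0" using elim by linarith
        then show ?case
        proof cases
          case 1
          have "1 / a < 0" using less by simp
          moreover have "0 < 1 / x" using 1 by simp
          ultimately have "a < 1 / x" "1 / a < x" using 1 less by linarith+
          then have "x \<in> A" "x \<in> {1 / a<..}" "x \<in> {0<..}" using 1 by (simp_all only: A_def vimage_eq greaterThan_iff)
          then show ?thesis by (simp add: indicator_def)
        next
          case 2
          have "a < 1 / x \<longleftrightarrow> x < 1 / a" using 2 less by (simp add: field_simps)
          then show ?thesis using 2 elim by (auto simp: A_def indicator_def)
        qed
      qed
    qed auto
    then have "measure circ A + measure circ {1 / a<..} = 2 * pi + measure circ {0<..}"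
      using ii[OF A] ii[of "{1 / a<..}"] ii[of "{0<..}"] by simp
    moreover have "arctan (1 / a) = - (pi / 2) - arctan a" using Transcendental.arctan_inverse[of a] less by simp
    ultimately show ?thesis using m[of "1 / a"] m[of 0] by simp
  qed
  then have "emeasure circ A = ennreal (pi - 2 * arctan a)" by (simp add: circ.emeasure_eq_measure)
  then show "emeasure circ {a<..} = emeasure (distr circ borel (\<lambda>x. 1 / x)) {a<..}"
    by (simp add: emeasure_circ_greaterThan emeasure_distr A_def)
qed auto

lemma chr_inverse: "x \<noteq> 0 \<Longrightarrow> chr k (1 / x) = chr (- k) x"
proof -
  assume x: "x \<noteq> 0"
  have nz: "of_real x + \<i> \<noteq> 0" "of_real x - \<i> \<noteq> 0" "of_real (1 / x) + \<i> \<noteq> 0" by (auto simp: complex_eq_iff)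
  have "chr 1 (1 / x) * chr 1 x = 1"
  proof -
    have "chr 1 (1 / x) = \<i> * (of_real x * (of_real (1 / x) - \<i>)) / (of_real x * (of_real (1 / x) + \<i>))"
      unfolding chr_1 using x by simp
    also have "of_real x * (of_real (1 / x) - \<i>) = - \<i> * (of_real x + \<i>)" using x by (simp add: algebra_simps)
    also have "of_real x * (of_real (1 / x) + \<i>) = \<i> * (of_real x - \<i>)" using x by (simp add: algebra_simps)
    finally show ?thesis unfolding chr_1[of x] using nz by (simp add: divide_simps)
  qed
  moreover have "chr (- 1) x * chr 1 x = 1" by (simp flip: chr_add)
  ultimately have "chr 1 (1 / x) = chr (- 1) x" by (metis mult_cancel_right mult_zero_right one_neq_zero)
  then have "cis (angle (1 / x)) = cis (- angle x)" by (simp add: chr_def)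
  from cis_cong_mult[OF this, of k] show ?thesis by (simp add: chr_def)
qed

text \<open>
  Conjugation of the circle exchanges the coefficients of index \<open>k\<close> and \<open>- k\<close>.
\<close>

lemma deg_symmetric:
  assumes u: "S1_map u" and sym: "\<And>x. u (1 / x) = u x" shows "deg u = 0"
proof -
  note [measurable] = S1_map_measurable[OF u]
  have AE0: "AE x in circ. x \<noteq> 0" unfolding AE_circ by (rule AE_lborel_singleton)
  have c: "coef u (- k) = coef u k" for k
  proof -
    have "(\<integral>x. u x * chr k x \<partial>circ) = (\<integral>x. u x * chr k x \<partial>distr circ borel (\<lambda>x. 1 / x))"
      by (simp only: circ_inverse)
    also have "\<dots> = (\<integral>x. u (1 / x) * chr k (1 / x) \<partial>circ)"
      by (rule integral_distr) auto
    also have "\<dots> = (\<integral>x. u x * chr (- k) x \<partial>circ)"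
      by (rule integral_cong_AE) (use AE0 in \<open>auto simp: sym chr_inverse elim!: eventually_mono\<close>)
    finally show ?thesis by (simp add: coef_def)
  qed
  have "bij_betw uminus (UNIV :: int set) UNIV" by (rule bij_betwI[where g = uminus]) auto
  from has_sum_reindex_bij_betw[OF this, of "\<lambda>k. of_int k * (cmod (coef u k))\<^sup>2" "2 * pi * deg u"] deg_has_sum[OF u]
  have "((\<lambda>k. - (of_int k * (cmod (coef u k))\<^sup>2)) has_sum (2 * pi * deg u)) UNIV" by (simp add: c)
  moreover have "((\<lambda>k. - (of_int k * (cmod (coef u k))\<^sup>2)) has_sum - (2 * pi * deg u)) UNIV"
    using deg_has_sum[OF u] by (simp add: has_sum_uminus)
  ultimately have "2 * pi * deg u = - (2 * pi * deg u)" by (rule has_sum_unique)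
  then show ?thesis by simp
qed

text \<open>
  The datum outside the interval, continued inside by reflection. It is invariant under \<open>x \<mapsto> 1 / x\<close>,
  hence of degree zero, and retraces the arc covered by the datum outside the interval.
\<close>

definition folded :: "real \<Rightarrow> real \<Rightarrow> complex" where
  "folded lam x = (if x \<in> unit_ivl then g_map lam (1 / x) else g_map lam x)"

lemma folded_inverse: "folded lam (1 / x) = folded lam x"
proof (cases "x = 0")
  case False
  consider "\<bar>x\<bar> < 1" | "\<bar>x\<bar> = 1" | "\<bar>x\<bar> > 1" by linarith
  then show ?thesis
  proof cases
    case 1
    then have "1 / x \<notin> unit_ivl" using False by (auto simp: divide_simps abs_if split: if_splits)
    moreover have "x \<in> unit_ivl" using 1 by auto
    ultimately show ?thesis by (simp only: folded_def if_True if_False)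
  next
    case 2
    then have "1 / x = x" by (auto simp: abs_if split: if_splits)
    then show ?thesis by simp
  next
    case 3
    then have "1 / x \<in> unit_ivl" by (auto simp: divide_simps abs_if split: if_splits)
    moreover have "x \<notin> unit_ivl" using 3 by auto
    moreover have "1 / (1 / x) = x" by simp
    ultimately show ?thesis by (simp only: folded_def if_True if_False)
  qed
qed simp

lemma folded_inside:
  assumes "\<bar>x\<bar> \<le> 1" "x \<noteq> 0" shows "folded lam x = g_map lam (1 / x)"
proof (cases "\<bar>x\<bar> = 1")
  case True
  then have "1 / x = x" by (auto simp: abs_if split: if_splits)
  then show ?thesis by (simp add: folded_def)
next
  case False
  then have "x \<in> unit_ivl" using assms by auto
  then show ?thesis by (simp add: folded_def)
qed

lemma g_map_lip:
  assumes "lam > 0"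
  shows "(cmod (g_map lam x - g_map lam y))\<^sup>2 = 4 * lam\<^sup>2 * (x - y)\<^sup>2 / ((x\<^sup>2 + lam\<^sup>2) * (y\<^sup>2 + lam\<^sup>2))"
proof -
  have "g_map lam x - g_map lam y = \<i> * (bubble lam x - bubble lam y)"
    using g_map_bubble[OF assms] by (simp add: right_diff_distrib)
  then show ?thesis using bubble_lip[of lam x y] assms by (simp add: norm_mult)
qed

lemma nn_integral_circ_fold:
  assumes [measurable]: "F \<in> borel_measurable borel"
  shows "(\<integral>\<^sup>+x. F x \<partial>circ) \<le> (\<integral>\<^sup>+x. indicator {-1..1} x * (F x + F (1 / x)) \<partial>circ)"
proof -
  have "(\<integral>\<^sup>+x. F x \<partial>circ) = (\<integral>\<^sup>+x. indicator unit_ivl x * F x + indicator (- unit_ivl) x * F x \<partial>circ)"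
    by (intro nn_integral_cong) (auto simp: indicator_def)
  also have "\<dots> = (\<integral>\<^sup>+x. indicator unit_ivl x * F x \<partial>circ) + (\<integral>\<^sup>+x. indicator (- unit_ivl) x * F x \<partial>circ)"
    by (rule nn_integral_add) auto
  also have "(\<integral>\<^sup>+x. indicator (- unit_ivl) x * F x \<partial>circ) = (\<integral>\<^sup>+x. indicator (- unit_ivl) x * F x \<partial>distr circ borel (\<lambda>x. 1 / x))"
    by (simp only: circ_inverse)
  also have "\<dots> = (\<integral>\<^sup>+x. indicator (- unit_ivl) (1 / x) * F (1 / x) \<partial>circ)"
    by (rule nn_integral_distr) auto
  also have "\<dots> \<le> (\<integral>\<^sup>+x. indicator {-1..1} x * F (1 / x) \<partial>circ)"
  proof (rule nn_integral_mono)
    fix x :: real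
    have "x \<in> {-1..1}" if "1 / x \<notin> unit_ivl"
      using that by (cases "x = 0") (auto simp: divide_simps split: if_splits)
    then show "indicator (- unit_ivl) (1 / x) * F (1 / x) \<le> indicator {-1..1} x * F (1 / x)"
      by (auto simp: indicator_def)
  qed
  also have "(\<integral>\<^sup>+x. indicator unit_ivl x * F x \<partial>circ) \<le> (\<integral>\<^sup>+x. indicator {-1..1} x * F x \<partial>circ)"
    by (rule nn_integral_mono) (auto simp: indicator_def)
  finally have "(\<integral>\<^sup>+x. F x \<partial>circ) \<le> (\<integral>\<^sup>+x. indicator {-1..1} x * F x \<partial>circ) + (\<integral>\<^sup>+x. indicator {-1..1} x * F (1 / x) \<partial>circ)"
    by (simp add: add_mono)
  also have "\<dots> = (\<integral>\<^sup>+x. indicator {-1..1} x * (F x + F (1 / x)) \<partial>circ)"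
    by (subst nn_integral_add[symmetric]) (auto simp: distrib_left)
  finally show ?thesis .
qed

text \<open>
  For \<open>x\<close> and \<open>y\<close> in the interval, the quotient of \<open>\<bar>folded x - folded y\<bar>\<^sup>2\<close> by the squared chordal
  distance is \<open>4 * fold_weight x * fold_weight y\<close>.
\<close>

definition fold_weight :: "real \<Rightarrow> real \<Rightarrow> real" where
  "fold_weight lam x = indicator {-1..1} x * (lam * (1 + x\<^sup>2) / (2 * (1 + lam\<^sup>2 * x\<^sup>2)))"

text \<open>
  With \<open>z = x * y\<close> the numerator is \<open>(1 - z)\<^sup>2 - (1 - x\<^sup>2) * (1 - y\<^sup>2)\<close>, and \<open>1 / (1 - z)\<^sup>2 \<ge> 1 + 2 * z\<close>
  for \<open>z < 1\<close>. The point of this minorant is that its terms separate the variables.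
\<close>

lemma fold_ratio:
  fixes x y :: real
  assumes "\<bar>x\<bar> \<le> 1" "\<bar>y\<bar> \<le> 1" "x * y \<noteq> 1"
  shows "((x - y) / (1 - x * y))\<^sup>2 \<le> 1 - (1 - x\<^sup>2) * (1 - y\<^sup>2) * (1 + 2 * (x * y))"
proof -
  define z where "z = x * y"
  have "\<bar>x * y\<bar> \<le> 1" using mult_mono[OF assms(1,2)] by (simp add: abs_mult)
  then have z: "z < 1" using assms(3) unfolding z_def by linarith
  have nn: "0 \<le> (1 - x\<^sup>2) * (1 - y\<^sup>2)" using assms by (simp add: abs_square_le_1)
  have pos: "0 < (1 - z)\<^sup>2" using z by simp
  have "(1 + 2 * z) * (1 - z)\<^sup>2 = 1 - z\<^sup>2 * (3 - 2 * z)" by (simp add: power2_eq_square algebra_simps)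
  also have "\<dots> \<le> 1" using z by simp
  finally have "(1 - x\<^sup>2) * (1 - y\<^sup>2) * ((1 + 2 * z) * (1 - z)\<^sup>2) \<le> (1 - x\<^sup>2) * (1 - y\<^sup>2) * 1"
    using nn by (rule mult_left_mono)
  moreover have "(x - y)\<^sup>2 = (1 - z)\<^sup>2 - (1 - x\<^sup>2) * (1 - y\<^sup>2)" by (simp add: z_def power2_eq_square algebra_simps)
  ultimately have "(x - y)\<^sup>2 \<le> (1 - (1 - x\<^sup>2) * (1 - y\<^sup>2) * (1 + 2 * z)) * (1 - z)\<^sup>2"
    by (simp add: algebra_simps)
  then show ?thesis unfolding power_divide z_def[symmetric] using pos by (simp add: pos_divide_le_eq)
qed

lemma fold_weight_props:
  assumes lam: "lam > 0"
  shows "fold_weight lam \<in> borel_measurable borel" "0 \<le> fold_weight lam x" "fold_weight lam x \<le> lam"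
proof -
  show "fold_weight lam \<in> borel_measurable borel" unfolding fold_weight_def[abs_def] by measurable
  have p: "0 < 1 + lam\<^sup>2 * x\<^sup>2" by (simp add: add_pos_nonneg)
  show "0 \<le> fold_weight lam x" unfolding fold_weight_def using lam p by (simp add: indicator_def)
  show "fold_weight lam x \<le> lam"
  proof (cases "x \<in> {-1..1}")
    case True
    then have "x\<^sup>2 \<le> 1" by (simp add: abs_square_le_1 abs_le_iff)
    then have "lam * (1 + x\<^sup>2) \<le> lam * 2" using lam by (intro mult_left_mono) auto
    also have "\<dots> \<le> lam * (2 * (1 + lam\<^sup>2 * x\<^sup>2))" using lam by (intro mult_left_mono) auto
    finally have "lam * (1 + x\<^sup>2) / (2 * (1 + lam\<^sup>2 * x\<^sup>2)) \<le> lam" using p by (simp add: divide_le_eq mult.assoc)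
    then show ?thesis using True by (simp add: fold_weight_def)
  qed (use lam in \<open>simp add: fold_weight_def\<close>)
qed

lemma folded_measurable [measurable]: assumes "lam > 0" shows "folded lam \<in> borel_measurable borel"
proof -
  note [measurable] = S1_map_measurable[OF g_map_props(1)[OF assms]]
  show ?thesis unfolding folded_def[abs_def] by measurable
qed

text \<open>
  The left side collects the energy density at the four pairs obtained from \<open>(x, y)\<close> by reflecting the
  entries.
\<close>

lemma folded_pointwise:
  assumes lam: "lam > 0" and xy: "\<bar>x\<bar> \<le> 1" "\<bar>y\<bar> \<le> 1" "x \<noteq> 0" "y \<noteq> 0"
  shows "2 * ((cmod (folded lam x - folded lam y))\<^sup>2 / (cmod (chr 1 x - chr 1 y))\<^sup>2
        + (cmod (folded lam x - folded lam y))\<^sup>2 / (cmod (chr 1 (1 / x) - chr 1 y))\<^sup>2)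
     \<le> 8 * fold_weight lam x * fold_weight lam y * (2 - (1 - x\<^sup>2) * (1 - y\<^sup>2) * (1 + 2 * (x * y)))"
proof -
  define M where "M = fold_weight lam x * fold_weight lam y"
  have M0: "0 \<le> M" unfolding M_def using fold_weight_props(2)[OF lam] by simp
  define B where "B = 1 - (1 - x\<^sup>2) * (1 - y\<^sup>2) * (1 + 2 * (x * y))"
  have p: "0 < 1 + x\<^sup>2" "0 < 1 + y\<^sup>2" "0 < 1 + lam\<^sup>2 * x\<^sup>2" "0 < 1 + lam\<^sup>2 * y\<^sup>2"
    by (auto simp: add_pos_nonneg)
  have Mval: "4 * M = lam\<^sup>2 * ((1 + x\<^sup>2) * (1 + y\<^sup>2)) / ((1 + lam\<^sup>2 * x\<^sup>2) * (1 + lam\<^sup>2 * y\<^sup>2))"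
  proof -
    have m: "fold_weight lam t = lam * (1 + t\<^sup>2) / (2 * (1 + lam\<^sup>2 * t\<^sup>2))" if "\<bar>t\<bar> \<le> 1" for t
      using that by (simp add: fold_weight_def abs_le_iff)
    have "4 * (lam * a / (2 * b) * (lam * a' / (2 * b'))) = lam\<^sup>2 * (a * a') / (b * b')" for a b a' b' :: real
      by (simp add: power2_eq_square)
    then show ?thesis unfolding M_def m[OF xy(1)] m[OF xy(2)] .
  qed
  have d: "(cmod (folded lam x - folded lam y))\<^sup>2 = 4 * lam\<^sup>2 * (x - y)\<^sup>2 / ((1 + lam\<^sup>2 * x\<^sup>2) * (1 + lam\<^sup>2 * y\<^sup>2))"
  proof -
    have r: "folded lam x = g_map lam (1 / x)" "folded lam y = g_map lam (1 / y)" using folded_inside xy by auto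
    have "(1 / x - 1 / y)\<^sup>2 = (x - y)\<^sup>2 / (x\<^sup>2 * y\<^sup>2)"
      using xy by (simp add: power2_eq_square field_simps)
    moreover have "((1 / x)\<^sup>2 + lam\<^sup>2) * ((1 / y)\<^sup>2 + lam\<^sup>2) = (1 + lam\<^sup>2 * x\<^sup>2) * (1 + lam\<^sup>2 * y\<^sup>2) / (x\<^sup>2 * y\<^sup>2)"
      using xy by (simp add: power2_eq_square field_simps)
    ultimately show ?thesis unfolding r g_map_lip[OF lam] using xy p by (simp add: divide_simps)
  qed
  have k1: "(cmod (folded lam x - folded lam y))\<^sup>2 / (cmod (chr 1 x - chr 1 y))\<^sup>2 \<le> 4 * M"
  proof (cases "x = y")
    case False
    then show ?thesis unfolding d chr_1_diff Mval using p by (simp add: divide_simps)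
  qed (use M0 in simp)
  have k2: "(cmod (folded lam x - folded lam y))\<^sup>2 / (cmod (chr 1 (1 / x) - chr 1 y))\<^sup>2 \<le> 4 * M * ((x - y) / (1 - x * y))\<^sup>2"
  proof (cases "x * y = 1")
    case True
    then have "1 / x = y" using xy by (simp add: field_simps)
    then show ?thesis using True by simp
  next
    case False
    have "(1 / x - y)\<^sup>2 = (1 - x * y)\<^sup>2 / x\<^sup>2" using xy by (simp add: power2_eq_square field_simps)
    have "1 + (1 / x)\<^sup>2 = (1 + x\<^sup>2) / x\<^sup>2" using xy by (simp add: power2_eq_square field_simps)
    have K: "(cmod (chr 1 (1 / x) - chr 1 y))\<^sup>2 = 4 * (1 - x * y)\<^sup>2 / ((1 + x\<^sup>2) * (1 + y\<^sup>2))"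
    proof -
      have "4 * (a / s) / (b / s * c) = 4 * a / (b * c)" if "s \<noteq> 0" for a b c s :: real using that by simp
      from this[of "x\<^sup>2"] xy(3) \<open>(1 / x - y)\<^sup>2 = (1 - x * y)\<^sup>2 / x\<^sup>2\<close> \<open>1 + (1 / x)\<^sup>2 = (1 + x\<^sup>2) / x\<^sup>2\<close>
      show ?thesis unfolding chr_1_diff by (simp only:) simp
    qed
    have "1 - x * y \<noteq> 0" using False by simp
    then show ?thesis unfolding d K Mval power_divide using p by (simp add: divide_simps)
  qed
  have rat: "((x - y) / (1 - x * y))\<^sup>2 \<le> B"
  proof (cases "x * y = 1")
    case True
    have "(1 - x\<^sup>2) * (1 - y\<^sup>2) * (1 + 2 * (x * y)) \<le> 1"
    proof -
      have "\<bar>x\<bar> * \<bar>y\<bar> = 1" using True by (metis abs_mult abs_one)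
      then have "\<bar>x\<bar> = 1" using xy mult_left_le[of "\<bar>y\<bar>" "\<bar>x\<bar>"] by simp
      then have "x\<^sup>2 = 1" by (metis one_power2 power2_abs)
      then show ?thesis by simp
    qed
    then show ?thesis using True by (simp add: B_def)
  next
    case False
    then show ?thesis unfolding B_def by (rule fold_ratio[OF xy(1,2)])
  qed
  have H: "4 * M * ((x - y) / (1 - x * y))\<^sup>2 \<le> 4 * M * B" using rat M0 by (intro mult_left_mono) auto
  have "2 * ((cmod (folded lam x - folded lam y))\<^sup>2 / (cmod (chr 1 x - chr 1 y))\<^sup>2
        + (cmod (folded lam x - folded lam y))\<^sup>2 / (cmod (chr 1 (1 / x) - chr 1 y))\<^sup>2) \<le> 2 * (4 * M + 4 * M * B)"
    using add_mono[OF k1 order_trans[OF k2 H]] by (rule mult_left_mono) simp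
  also have "\<dots> = 8 * M * (1 + B)" by (simp add: algebra_simps)
  finally show ?thesis unfolding M_def B_def by simp
qed

text \<open>
  Folding the plane of pairs onto the square of the interval gives four copies of it, to which the
  pointwise bound applies. The bound is a combination of products of functions of one variable, so the
  integral becomes a quadratic expression in three moments; the third enters with a negative sign and is
  dropped.
\<close>

lemma folded_seminorm_le:
  assumes lam: "lam > 0"
  defines "al \<equiv> \<integral>x. fold_weight lam x \<partial>circ" and "c \<equiv> \<integral>x. fold_weight lam x * (1 - x\<^sup>2) \<partial>circ"
    and "d \<equiv> \<integral>x. fold_weight lam x * (1 - x\<^sup>2) * x \<partial>circ"
  shows "seminorm_sq (folded lam) \<le> ennreal (16 * al\<^sup>2 - 8 * c\<^sup>2)"
proof -
  note [measurable] = folded_measurable[OF lam] fold_weight_props(1)[OF lam]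
  let ?q = "\<lambda>x y. ennreal ((cmod (folded lam x - folded lam y))\<^sup>2 / (cmod (chr 1 x - chr 1 y))\<^sup>2)"
  let ?R = "\<lambda>x y. 8 * fold_weight lam x * fold_weight lam y * (2 - (1 - x\<^sup>2) * (1 - y\<^sup>2) * (1 + 2 * (x * y)))"
  have AE0: "AE x in circ. x \<noteq> 0" unfolding AE_circ by (rule AE_lborel_singleton)
  have sy: "cmod (chr 1 x - chr 1 (1 / y)) = cmod (chr 1 (1 / x) - chr 1 y)" if "x \<noteq> 0" "y \<noteq> 0" for x y
  proof -
    have "cmod (chr 1 (1 / x) - chr 1 y) = cmod (cnj (chr 1 x - chr 1 (1 / y)))"
      using chr_inverse[OF that(1), of 1] chr_inverse[OF that(2), of 1] by simp
    then show ?thesis by (simp only: complex_mod_cnj)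
  qed
  have sz: "cmod (chr 1 (1 / x) - chr 1 (1 / y)) = cmod (chr 1 x - chr 1 y)" if "x \<noteq> 0" "y \<noteq> 0" for x y
    using sy[of "1 / x" y] that by simp
  have "seminorm_sq (folded lam) = (\<integral>\<^sup>+x. \<integral>\<^sup>+y. ?q x y \<partial>circ \<partial>circ)"
    unfolding seminorm_sq_circ2[OF folded_measurable[OF lam]] by (subst circ.nn_integral_fst[symmetric]) auto
  also have "\<dots> \<le> (\<integral>\<^sup>+x. \<integral>\<^sup>+y. indicator {-1..1} y * (?q x y + ?q x (1 / y)) \<partial>circ \<partial>circ)"
    by (intro nn_integral_mono nn_integral_circ_fold) measurable
  also have "\<dots> \<le> (\<integral>\<^sup>+x. indicator {-1..1} x * ((\<integral>\<^sup>+y. indicator {-1..1} y * (?q x y + ?q x (1 / y)) \<partial>circ)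
        + (\<integral>\<^sup>+y. indicator {-1..1} y * (?q (1 / x) y + ?q (1 / x) (1 / y)) \<partial>circ)) \<partial>circ)"
    by (rule nn_integral_circ_fold) measurable
  also have "\<dots> = (\<integral>\<^sup>+x. \<integral>\<^sup>+y. indicator {-1..1} x * (indicator {-1..1} y * ((?q x y + ?q x (1 / y)) + (?q (1 / x) y + ?q (1 / x) (1 / y)))) \<partial>circ \<partial>circ)"
    by (simp add: nn_integral_add[symmetric] nn_integral_cmult[symmetric] distrib_left)
  also have "\<dots> \<le> (\<integral>\<^sup>+x. \<integral>\<^sup>+y. ennreal (?R x y) \<partial>circ \<partial>circ)"
  proof (rule nn_integral_mono_AE)
    show "AE x in circ. (\<integral>\<^sup>+y. indicator {-1..1} x * (indicator {-1..1} y * ((?q x y + ?q x (1 / y)) + (?q (1 / x) y + ?q (1 / x) (1 / y)))) \<partial>circ)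
       \<le> (\<integral>\<^sup>+y. ennreal (?R x y) \<partial>circ)"
      using AE0
    proof eventually_elim
      case (elim x)
      note x0 = elim
      show ?case
      proof (rule nn_integral_mono_AE)
        show "AE y in circ. indicator {-1..1} x * (indicator {-1..1} y * ((?q x y + ?q x (1 / y)) + (?q (1 / x) y + ?q (1 / x) (1 / y)))) \<le> ennreal (?R x y)"
          using AE0
        proof eventually_elim
          case (elim y)
          show ?case
          proof (cases "x \<in> {-1..1} \<and> y \<in> {-1..1}")
            case True
            define p q where "p = (cmod (folded lam x - folded lam y))\<^sup>2 / (cmod (chr 1 x - chr 1 y))\<^sup>2"
              and "q = (cmod (folded lam x - folded lam y))\<^sup>2 / (cmod (chr 1 (1 / x) - chr 1 y))\<^sup>2"
            have pq: "0 \<le> p" "0 \<le> q" by (simp_all add: p_def q_def)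
            have "(?q x y + ?q x (1 / y)) + (?q (1 / x) y + ?q (1 / x) (1 / y)) = (ennreal p + ennreal q) + (ennreal q + ennreal p)"
              unfolding folded_inverse sy[OF x0 elim] sz[OF x0 elim] p_def q_def ..
            also have "\<dots> = ennreal (2 * (p + q))"
              using pq by (simp flip: ennreal_plus)
            also have "\<dots> \<le> ennreal (?R x y)"
              unfolding p_def q_def by (rule ennreal_leI, rule folded_pointwise[OF lam]) (use True x0 elim in auto)
            finally show ?thesis using True by simp
          qed auto
        qed
      qed
    qed
  qed
  also have "\<dots> = (\<integral>\<^sup>+z. ennreal (?R (fst z) (snd z)) \<partial>circ2)"
    by (subst circ.nn_integral_fst[symmetric]) auto
  also have "\<dots> = ennreal (16 * al\<^sup>2 - 8 * c\<^sup>2 - 16 * d\<^sup>2)"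
  proof -
    let ?m = "fold_weight lam"
    let ?P = "\<lambda>x. ?m x * (1 - x\<^sup>2)" and ?Q = "\<lambda>x. ?m x * (1 - x\<^sup>2) * x"
    have mb: "\<bar>?m x\<bar> \<le> lam" for x using fold_weight_props(2,3)[OF lam, of x] by simp
    have sup: "?m x = 0" if "\<not> \<bar>x\<bar> \<le> 1" for x using that by (auto simp: fold_weight_def indicator_def)
    have Pb: "\<bar>?P x\<bar> \<le> lam" for x
    proof (cases "\<bar>x\<bar> \<le> 1")
      case True
      then have b: "\<bar>1 - x\<^sup>2\<bar> \<le> 1" by (simp add: abs_square_le_1)
      show ?thesis using mult_mono[OF mb[of x] b] lam by (simp add: abs_mult)
    qed (use sup lam in simp)
    have Qb: "\<bar>?Q x\<bar> \<le> lam" for x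
    proof (cases "\<bar>x\<bar> \<le> 1")
      case True
      show ?thesis using mult_mono[OF Pb[of x] True] lam by (simp add: abs_mult)
    qed (use sup lam in simp)
    have ip: "integrable circ2 (\<lambda>z. f (fst z) * g (snd z))"
      if [measurable]: "f \<in> borel_measurable borel" "g \<in> borel_measurable borel" and "\<And>x. \<bar>f x\<bar> \<le> lam" "\<And>x. \<bar>g x\<bar> \<le> lam" for f g :: "real \<Rightarrow> real"
      by (rule integrable_circ2_bounded[where B = "lam * lam"]) (use that lam in \<open>auto simp: abs_mult intro!: mult_mono\<close>)
    have Re: "?R (fst z) (snd z) = 16 * (?m (fst z) * ?m (snd z)) - 8 * (?P (fst z) * ?P (snd z)) - 16 * (?Q (fst z) * ?Q (snd z))" for z
      by (simp add: algebra_simps)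
    have i: "integrable circ2 (\<lambda>z. ?m (fst z) * ?m (snd z))" "integrable circ2 (\<lambda>z. ?P (fst z) * ?P (snd z))" "integrable circ2 (\<lambda>z. ?Q (fst z) * ?Q (snd z))"
      using mb Pb Qb by (intro ip; measurable)+
    have v: "(\<integral>z. ?m (fst z) * ?m (snd z) \<partial>circ2) = al * al" "(\<integral>z. ?P (fst z) * ?P (snd z) \<partial>circ2) = c * c" "(\<integral>z. ?Q (fst z) * ?Q (snd z) \<partial>circ2) = d * d"
      unfolding al_def c_def d_def by (rule integral_circ2_prod[where B = lam and C = lam]; use mb Pb Qb in auto)+
    (* Uses 1 + 2 * x * y \<le> (1 + x\<^sup>2) * (1 + y\<^sup>2) to see that the subtracted product is at most 1. *)
    have R0: "0 \<le> ?R x y" for x y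
    proof (cases "\<bar>x\<bar> \<le> 1 \<and> \<bar>y\<bar> \<le> 1")
      case True
      then have s: "x\<^sup>2 \<le> 1" "y\<^sup>2 \<le> 1" by (simp_all add: abs_square_le_1)
      have "2 * (x * y) \<le> x\<^sup>2 + y\<^sup>2" using sum_squares_bound[of x y] by (simp add: mult.assoc)
      moreover have "0 \<le> x\<^sup>2 * y\<^sup>2" by simp
      moreover have "(1 + x\<^sup>2) * (1 + y\<^sup>2) = 1 + (x\<^sup>2 + y\<^sup>2) + x\<^sup>2 * y\<^sup>2" by (simp add: algebra_simps)
      ultimately have "1 + 2 * (x * y) \<le> (1 + x\<^sup>2) * (1 + y\<^sup>2)" by linarith
      then have "(1 - x\<^sup>2) * (1 - y\<^sup>2) * (1 + 2 * (x * y)) \<le> (1 - x\<^sup>2) * (1 - y\<^sup>2) * ((1 + x\<^sup>2) * (1 + y\<^sup>2))"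
        using s by (intro mult_left_mono) auto
      also have "\<dots> = (1 - x\<^sup>2 * x\<^sup>2) * (1 - y\<^sup>2 * y\<^sup>2)" by (simp add: algebra_simps)
      also have "\<dots> \<le> 1 * 1"
        by (rule mult_mono) (use mult_mono[OF s(2) s(2)] in simp_all)
      finally have "0 \<le> 2 - (1 - x\<^sup>2) * (1 - y\<^sup>2) * (1 + 2 * (x * y))" by simp
      then show ?thesis using fold_weight_props(2)[OF lam] by (intro mult_nonneg_nonneg) auto
    qed (use sup in auto)
    have "integrable circ2 (\<lambda>z. ?R (fst z) (snd z))" unfolding Re using i by simp
    then have "(\<integral>\<^sup>+z. ennreal (?R (fst z) (snd z)) \<partial>circ2) = ennreal (\<integral>z. ?R (fst z) (snd z) \<partial>circ2)"
      by (rule nn_integral_eq_integral) (use R0 in simp)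
    also have "(\<integral>z. ?R (fst z) (snd z) \<partial>circ2) = 16 * al\<^sup>2 - 8 * c\<^sup>2 - 16 * d\<^sup>2"
    proof -
      have "(\<integral>z. ?R (fst z) (snd z) \<partial>circ2) = 16 * (al * al) - 8 * (c * c) - 16 * (d * d)"
        unfolding Re using i by (simp add: v)
      then show ?thesis by (simp add: power2_eq_square)
    qed
    finally show ?thesis .
  qed
  also have "\<dots> \<le> ennreal (16 * al\<^sup>2 - 8 * c\<^sup>2)" by (intro ennreal_leI) simp
  finally show ?thesis .
qed

lemma fold_weight_integrals:
  assumes lam: "lam > 0"
  shows "(\<integral>x. fold_weight lam x \<partial>circ) = 2 * arctan lam"
    and "(\<integral>x. fold_weight lam x * (1 - x\<^sup>2) \<partial>circ) = 2 * arctan lam * (1 + 1 / lam\<^sup>2) - 2 / lam"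
proof -
  have p: "0 < 1 + (lam * x)\<^sup>2" for x by (simp add: add_pos_nonneg)
  note [measurable] = fold_weight_props(1)[OF lam]
  have conv: "(\<integral>x. fold_weight lam x * h x \<partial>circ) = (\<integral>x. indicator {-1..1} x *\<^sub>R (lam / (1 + (lam * x)\<^sup>2) * h x) \<partial>lborel)"
    if [measurable]: "h \<in> borel_measurable borel" for h :: "real \<Rightarrow> real"
  proof -
    have "(\<integral>x. fold_weight lam x * h x \<partial>circ) = (\<integral>x. 2 / (1 + x\<^sup>2) * (fold_weight lam x * h x) \<partial>lborel)"
      unfolding circ_def by (subst integral_density) auto
    also have "\<dots> = (\<integral>x. indicator {-1..1} x *\<^sub>R (lam / (1 + (lam * x)\<^sup>2) * h x) \<partial>lborel)"
    proof (rule Bochner_Integration.integral_cong[OF refl])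
      fix x :: real
      have "2 / a * (lam * a / (2 * b)) = lam / b" if "a \<noteq> 0" for a b :: real using that by simp
      from this[of "1 + x\<^sup>2" "1 + lam\<^sup>2 * x\<^sup>2"]
      have "2 / (1 + x\<^sup>2) * fold_weight lam x = indicator {-1..1} x * (lam / (1 + (lam * x)\<^sup>2))"
        by (cases "x \<in> {-1..1}") (simp_all add: fold_weight_def power_mult_distrib)
      then have "(2 / (1 + x\<^sup>2) * fold_weight lam x) * h x = (indicator {-1..1} x * (lam / (1 + (lam * x)\<^sup>2))) * h x" by simp
      then show "2 / (1 + x\<^sup>2) * (fold_weight lam x * h x) = indicator {-1..1} x *\<^sub>R (lam / (1 + (lam * x)\<^sup>2) * h x)"
        by (simp only: real_scaleR_def mult.assoc)
    qed
    finally show ?thesis .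
  qed
  have arc: "((\<lambda>x. arctan (lam * x)) has_real_derivative lam / (1 + (lam * x)\<^sup>2)) (at x within S)" for x S
    by (auto intro!: derivative_eq_intros simp: divide_inverse)
  have cont: "continuous_on S (\<lambda>x. lam / (1 + (lam * x)\<^sup>2))" for S
    by (intro continuous_intros) (use p in \<open>auto simp: less_le\<close>)
  have "(\<integral>x. fold_weight lam x * 1 \<partial>circ) = arctan (lam * 1) - arctan (lam * (- 1))"
    unfolding conv[OF borel_measurable_const]
    by (rule integral_FTC_atLeastAtMost)
      (use arc cont in \<open>auto simp: has_real_derivative_iff_has_vector_derivative\<close>)
  then show "(\<integral>x. fold_weight lam x \<partial>circ) = 2 * arctan lam" by (simp add: arctan_minus)
  let ?F = "\<lambda>x. (1 + 1 / lam\<^sup>2) * arctan (lam * x) - x / lam"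
  have "(\<integral>x. fold_weight lam x * (1 - x\<^sup>2) \<partial>circ) = ?F 1 - ?F (- 1)"
  proof (subst conv)
    show "(\<integral>x. indicator {-1..1} x *\<^sub>R (lam / (1 + (lam * x)\<^sup>2) * (1 - x\<^sup>2)) \<partial>lborel) = ?F 1 - ?F (- 1)"
    proof (rule integral_FTC_atLeastAtMost)
      show "(?F has_vector_derivative lam / (1 + (lam * x)\<^sup>2) * (1 - x\<^sup>2)) (at x within {- 1..1})" for x
      proof -
        have "(?F has_real_derivative (1 + 1 / lam\<^sup>2) * (lam / (1 + (lam * x)\<^sup>2)) - 1 / lam) (at x within {- 1..1})"
          by (intro DERIV_diff DERIV_cmult arc DERIV_cdivide DERIV_ident)
        moreover have "(1 + 1 / lam\<^sup>2) * (lam / (1 + (lam * x)\<^sup>2)) - 1 / lam = lam / (1 + (lam * x)\<^sup>2) * (1 - x\<^sup>2)"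
        proof -
          have nz: "1 + (lam * x)\<^sup>2 \<noteq> 0" using p[of x] by simp
          have "(1 + 1 / lam\<^sup>2) * lam - 1 / lam * (1 + (lam * x)\<^sup>2) = lam * (1 - x\<^sup>2)"
            using lam by (simp add: field_simps power2_eq_square)
          then have "((1 + 1 / lam\<^sup>2) * lam - 1 / lam * (1 + (lam * x)\<^sup>2)) / (1 + (lam * x)\<^sup>2) = lam * (1 - x\<^sup>2) / (1 + (lam * x)\<^sup>2)" by simp
          then show ?thesis using nz by (simp add: diff_divide_distrib)
        qed
        ultimately show ?thesis by (simp add: has_real_derivative_iff_has_vector_derivative)
      qed
      show "continuous_on {- 1..1} (\<lambda>x. lam / (1 + (lam * x)\<^sup>2) * (1 - x\<^sup>2))"
        by (intro continuous_intros cont)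
    qed simp
  qed simp
  also have "\<dots> = 2 * arctan lam * (1 + 1 / lam\<^sup>2) - 2 / lam" by (simp add: arctan_minus algebra_simps)
  finally show "(\<integral>x. fold_weight lam x * (1 - x\<^sup>2) \<partial>circ) = 2 * arctan lam * (1 + 1 / lam\<^sup>2) - 2 / lam" .
qed

lemma arctan_upper: assumes "0 \<le> r" shows "arctan r \<le> r"
proof -
  have "(\<lambda>x. x - arctan x) 0 \<le> (\<lambda>x. x - arctan x) r"
  proof (rule DERIV_nonneg_imp_nondecreasing[OF assms])
    fix x :: real
    have "((\<lambda>x. x - arctan x) has_real_derivative 1 - inverse (1 + x\<^sup>2)) (at x)"
      by (auto intro!: derivative_eq_intros)
    moreover have "0 \<le> 1 - inverse (1 + x\<^sup>2)" by (simp add: inverse_le_1_iff)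
    ultimately show "\<exists>y. ((\<lambda>x. x - arctan x) has_real_derivative y) (at x) \<and> 0 \<le> y" by blast
  qed
  then show ?thesis by simp
qed

lemma arctan_lower: assumes "0 \<le> r" shows "r - r ^ 3 / 3 \<le> arctan r"
proof -
  have "(\<lambda>x. arctan x - (x - x ^ 3 / 3)) 0 \<le> (\<lambda>x. arctan x - (x - x ^ 3 / 3)) r"
  proof (rule DERIV_nonneg_imp_nondecreasing[OF assms])
    fix x :: real
    have "((\<lambda>x. arctan x - (x - x ^ 3 / 3)) has_real_derivative inverse (1 + x\<^sup>2) - (1 - x\<^sup>2)) (at x)"
      by (auto intro!: derivative_eq_intros simp: power2_eq_square)
    moreover have "0 \<le> inverse (1 + x\<^sup>2) - (1 - x\<^sup>2)"
    proof -
      have p: "0 < 1 + x\<^sup>2" by simp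
      have "(1 - x\<^sup>2) * (1 + x\<^sup>2) = 1 - x\<^sup>2 * x\<^sup>2" by (simp add: algebra_simps)
      also have "\<dots> \<le> 1" by simp
      finally have "1 - x\<^sup>2 \<le> 1 / (1 + x\<^sup>2)" using p by (subst pos_le_divide_eq) auto
      then show ?thesis by (simp add: inverse_eq_divide)
    qed
    ultimately show "\<exists>y. ((\<lambda>x. arctan x - (x - x ^ 3 / 3)) has_real_derivative y) (at x) \<and> 0 \<le> y" by blast
  qed
  then show ?thesis by simp
qed

text \<open>
  By the mean value theorem \<open>arctan lam > lam / (1 + lam\<^sup>2)\<close>.
\<close>

lemma fold_moment_pos: assumes "lam > 0" shows "0 < 2 * arctan lam * (1 + 1 / lam\<^sup>2) - 2 / lam"
proof -
  have "\<exists>z. 0 < z \<and> z < lam \<and> arctan lam - arctan 0 = (lam - 0) * (inverse (1 + z\<^sup>2))"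
    by (rule MVT2[OF assms]) (auto intro!: derivative_eq_intros)
  then obtain z where z: "0 < z" "z < lam" "arctan lam = lam * inverse (1 + z\<^sup>2)" by auto
  have "z\<^sup>2 < lam\<^sup>2" using z by (intro power_strict_mono) auto
  then have "lam * inverse (1 + lam\<^sup>2) < arctan lam" unfolding z(3) using assms
    by (intro mult_strict_left_mono less_imp_inverse_less) auto
  then have "lam / (1 + lam\<^sup>2) < arctan lam" by (simp add: divide_inverse)
  then have "lam < arctan lam * (1 + lam\<^sup>2)" by (simp add: pos_divide_less_eq)
  then have "lam / lam\<^sup>2 < arctan lam * (1 + lam\<^sup>2) / lam\<^sup>2" using assms by (intro divide_strict_right_mono) auto
  also have "arctan lam * (1 + lam\<^sup>2) / lam\<^sup>2 = arctan lam * (1 + 1 / lam\<^sup>2)" using assms by (simp add: field_simps)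
  also have "lam / lam\<^sup>2 = 1 / lam" by (simp add: power2_eq_square)
  finally have "1 / lam < arctan lam * (1 + 1 / lam\<^sup>2)" .
  then have "2 * (1 / lam) < 2 * (arctan lam * (1 + 1 / lam\<^sup>2))" by (rule mult_strict_left_mono) simp
  then show ?thesis by simp
qed

text \<open>
  The bound of \<open>folded_seminorm_le\<close> with its two moments evaluated.
\<close>

definition fold_bound :: "real \<Rightarrow> real" where
  "fold_bound lam = 16 * (2 * arctan lam)\<^sup>2 - 8 * (2 * arctan lam * (1 + 1 / lam\<^sup>2) - 2 / lam)\<^sup>2"

text \<open>
  With \<open>r = 1 / lam\<close>, the first moment is \<open>\<pi> - 2 * arctan r\<close>. If its square is at most half of \<open>\<pi>\<^sup>2\<close>,
  positivity of the second moment suffices. Otherwise \<open>r < 6 / 10\<close>, and the Taylor bounds of \<open>arctan r\<close>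
  leave the gain \<open>r\<^sup>2 * (2 * \<pi>\<^sup>2 - 8 - 16 / 3 * \<pi> * r)\<close>, which is positive on this range.
\<close>

lemma fold_bound_lt_8: assumes lam: "lam > 0" shows "fold_bound lam < 8 * pi\<^sup>2"
proof -
  define al where "al = 2 * arctan lam"
  define r where "r = 1 / lam"
  define c where "c = al * (1 + r\<^sup>2) - 2 * r"
  have ph: "fold_bound lam = 16 * al\<^sup>2 - 8 * c\<^sup>2" by (simp add: fold_bound_def al_def c_def r_def power_divide)
  have cp: "0 < c" using fold_moment_pos[OF lam] by (simp add: c_def al_def r_def power_divide)
  have al0: "0 \<le> al" using lam by (simp add: al_def)
  have r0: "0 < r" using lam by (simp add: r_def)
  have pi: "3.14 < pi" "pi < 3.15" using pi_approx by simp_all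
  have alr: "al = pi - 2 * arctan r"
    using Transcendental.arctan_inverse[of lam] lam by (simp add: al_def r_def)
  show ?thesis
  proof (cases "2 * al\<^sup>2 \<le> pi\<^sup>2")
    case True
    have "0 < c\<^sup>2" using cp by simp
    then show ?thesis unfolding ph using True by linarith
  next
    case big: False
    have r6: "r < 6 / 10"
    proof (rule ccontr)
      assume "\<not> r < 6 / 10"
      then have "arctan (6 / 10) \<le> arctan r" by (intro arctan_monotone') simp
      moreover have "528 / 1000 \<le> arctan (6 / 10)" using arctan_lower[of "6 / 10"] by (simp add: power3_eq_cube)
      ultimately have "al \<le> pi - 1.056" unfolding alr by simp
      then have "al \<le> 2.1" using pi by simp
      then have "al\<^sup>2 \<le> 2.1\<^sup>2" using al0 by (intro power_mono) auto
      moreover have "3.14\<^sup>2 \<le> pi\<^sup>2" using pi by (intro power_mono) auto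
      ultimately show False using big by (simp add: power2_eq_square)
    qed
    define d where "d = 2 * arctan r"
    have d1: "d \<le> 2 * r" using arctan_upper[of r] r0 by (simp add: d_def)
    have d2: "2 * r - 2 / 3 * r ^ 3 \<le> d" using arctan_lower[of r] r0 by (simp add: d_def)
    have d0: "0 \<le> d" using r0 by (simp add: d_def)
    have ald: "al = pi - d" by (simp add: alr d_def)
    define e where "e = d + 2 * r - al * r\<^sup>2"
    have ce: "c = pi - e" by (simp add: c_def e_def ald algebra_simps)
    have c2: "pi\<^sup>2 - 2 * pi * e \<le> c\<^sup>2" unfolding ce by (simp add: power2_eq_square algebra_simps)
    have "2 * al\<^sup>2 - pi\<^sup>2 < pi\<^sup>2 - 2 * pi * e"
    proof -
      have id: "pi\<^sup>2 - 2 * pi * e - (2 * al\<^sup>2 - pi\<^sup>2) = 2 * pi * (d - 2 * r) + 2 * pi * al * r\<^sup>2 - 2 * d\<^sup>2"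
        by (simp add: e_def ald power2_eq_square algebra_simps)
      have "2 * pi * (- (2 / 3 * r ^ 3)) \<le> 2 * pi * (d - 2 * r)" using d2 by (intro mult_left_mono) auto
      moreover have "2 * pi * (pi - 2 * r) * r\<^sup>2 \<le> 2 * pi * al * r\<^sup>2"
        using d1 by (intro mult_right_mono mult_left_mono) (auto simp: ald)
      moreover have "d\<^sup>2 \<le> (2 * r)\<^sup>2" using d0 d1 by (intro power_mono) auto
      ultimately have "r\<^sup>2 * (2 * pi\<^sup>2 - 8 - 16 / 3 * pi * r) \<le> 2 * pi * (d - 2 * r) + 2 * pi * al * r\<^sup>2 - 2 * d\<^sup>2"
        by (simp add: power2_eq_square power3_eq_cube algebra_simps)
      moreover have "0 < r\<^sup>2 * (2 * pi\<^sup>2 - 8 - 16 / 3 * pi * r)"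
      proof (rule mult_pos_pos)
        have "pi * r \<le> 3.15 * (6 / 10)" using pi r6 r0 by (intro mult_mono) auto
        moreover have "3.14\<^sup>2 \<le> pi\<^sup>2" using pi by (intro power_mono) auto
        ultimately show "0 < 2 * pi\<^sup>2 - 8 - 16 / 3 * pi * r" by (simp add: power2_eq_square)
      qed (use r0 in simp)
      ultimately show ?thesis using id by linarith
    qed
    then show ?thesis unfolding ph using c2 by linarith
  qed
qed

text \<open>
  For \<open>lam \<le> 1\<close> the first moment is at most \<open>\<pi> / 2\<close> and the second is positive; the strict inequality at
  1 extends to slightly larger scales by continuity.
\<close>

lemma fold_bound_lt_4: "\<exists>l0>1. \<forall>lam. 0 < lam \<and> lam < l0 \<longrightarrow> fold_bound lam < 4 * pi\<^sup>2"
proof -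
  have le1: "fold_bound lam < 4 * pi\<^sup>2" if "0 < lam" "lam \<le> 1" for lam
  proof -
    have "arctan lam \<le> pi / 4" using arctan_monotone'[OF that(2)] by (simp add: arctan_one)
    moreover have "0 \<le> arctan lam" using that by simp
    ultimately have "(2 * arctan lam)\<^sup>2 \<le> (pi / 2)\<^sup>2" by (intro power_mono) auto
    then have "(2 * arctan lam)\<^sup>2 \<le> pi\<^sup>2 / 4" by (simp add: power_divide)
    moreover have "0 < (2 * arctan lam * (1 + 1 / lam\<^sup>2) - 2 / lam)\<^sup>2"
      using fold_moment_pos[OF that(1)] by (rule zero_less_power)
    ultimately show ?thesis unfolding fold_bound_def by linarith
  qed
  have "isCont fold_bound 1" unfolding fold_bound_def[abs_def] by (intro continuous_intros) auto
  then have "(fold_bound \<longlongrightarrow> fold_bound 1) (at 1)" by (simp add: isCont_def)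
  moreover have "fold_bound 1 < 4 * pi\<^sup>2" by (rule le1) auto
  ultimately have "eventually (\<lambda>x. fold_bound x < 4 * pi\<^sup>2) (at 1)" by (rule order_tendstoD(2))
  then obtain d where d: "d > 0" "\<And>x. x \<noteq> 1 \<Longrightarrow> dist x 1 < d \<Longrightarrow> fold_bound x < 4 * pi\<^sup>2"
    by (auto simp: eventually_at)
  show ?thesis
  proof (intro exI[of _ "1 + d"] conjI allI impI)
    fix lam assume "0 < lam \<and> lam < 1 + d"
    then show "fold_bound lam < 4 * pi\<^sup>2"
      using le1[of lam] d(2)[of lam] by (cases "lam \<le> 1") (auto simp: dist_real_def)
  qed (use d in auto)
qed

lemma folded_props:
  assumes lam: "lam > 0"
  shows "folded lam \<in> competitors (g_map lam)" "deg (folded lam) = 0" "En (folded lam) \<le> max 0 (fold_bound lam) / (2 * pi)"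
proof -
  have s: "seminorm_sq (folded lam) \<le> ennreal (fold_bound lam)"
    using folded_seminorm_le[OF lam] unfolding fold_weight_integrals[OF lam] fold_bound_def .
  also have "\<dots> \<le> ennreal (2 * pi * (max 0 (fold_bound lam) / (2 * pi)))" by (intro ennreal_leI) simp
  finally have s2: "seminorm_sq (folded lam) \<le> ennreal (2 * pi * (max 0 (fold_bound lam) / (2 * pi)))" .
  have nn: "0 \<le> max 0 (fold_bound lam) / (2 * pi)" by simp
  show "En (folded lam) \<le> max 0 (fold_bound lam) / (2 * pi)" by (rule En_le(1)[OF s2 nn])
  have n: "S1_map (folded lam)"
    unfolding S1_map_def using folded_measurable[OF lam] En_le(2)[OF s2 nn] S1_map_cmod[OF g_map_props(1)[OF lam]] by (auto simp: folded_def)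
  then show "folded lam \<in> competitors (g_map lam)" by (simp add: competitors_def folded_def)
  show "deg (folded lam) = 0" by (rule deg_symmetric[OF n folded_inverse])
qed

section \<open>Existence in degree zero\<close>

text \<open>
  Beyond the frequency \<open>K\<close> the sum of the squared coefficients is at most the energy divided by \<open>K\<close>.
\<close>

lemma l2_split:
  assumes u: "S1_map u" and v: "S1_map v" and K: "K > 0" and B: "En u \<le> B" "En v \<le> B"
  shows "(\<integral>x. (cmod (u x - v x))\<^sup>2 \<partial>circ) \<le> (\<Sum>k\<in>{- int K..int K}. (cmod (coef u k - coef v k))\<^sup>2) + 4 * B / real K"
proof -
  let ?w = "\<lambda>x. u x - v x"
  note [measurable] = S1_map_measurable[OF u] S1_map_measurable[OF v]
  note dm = diff_fin(2)[OF u v] diff_fin(3)[OF u v] diff_fin(1)[OF u v]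
  have cw: "coef ?w k = coef u k - coef v k" for k
    by (rule coef_diff[where B = 1 and C = 1]) (use u v in \<open>auto simp: S1_map_def\<close>)
  have EB: "En ?w \<le> 4 * B" using diff_fin(4)[OF u v] B by simp
  let ?c = "\<lambda>k. (cmod (coef u k - coef v k))\<^sup>2"
  have h1: "((\<lambda>k. if k \<in> {- int K..int K} then ?c k else 0) has_sum (\<Sum>k\<in>{- int K..int K}. ?c k)) UNIV"
    by (rule has_sum_finite_neutralI[of "{- int K..int K}"]) auto
  have h2: "((\<lambda>k. 1 / real K * (of_int \<bar>k\<bar> * ?c k)) has_sum (1 / real K * En ?w)) UNIV"
    using has_sum_cmult_right[OF energy_fourier[OF dm], of "1 / real K"] by (simp only: cw)
  have "(\<integral>x. (cmod (?w x))\<^sup>2 \<partial>circ) \<le> (\<Sum>k\<in>{- int K..int K}. ?c k) + 1 / real K * En ?w"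
  proof (rule has_sum_mono[OF _ has_sum_add[OF h1 h2]])
    show "(?c has_sum (\<integral>x. (cmod (?w x))\<^sup>2 \<partial>circ)) UNIV" using parseval[OF dm] by (simp only: cw)
    fix k :: int
    show "?c k \<le> (if k \<in> {- int K..int K} then ?c k else 0) + 1 / real K * (of_int \<bar>k\<bar> * ?c k)"
    proof (cases "k \<in> {- int K..int K}")
      case True
      have "0 \<le> 1 / real K * (of_int \<bar>k\<bar> * ?c k)" by simp
      then show ?thesis unfolding if_P[OF True] by linarith
    next
      case False
      then have "int K \<le> \<bar>k\<bar>" by auto
      then have "real K \<le> of_int \<bar>k\<bar>" by linarith
      then have "1 \<le> 1 / real K * of_int \<bar>k\<bar>" using K by (simp add: divide_simps)
      then have "1 * ?c k \<le> 1 / real K * of_int \<bar>k\<bar> * ?c k" by (rule mult_right_mono) simp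
      then show ?thesis unfolding if_not_P[OF False] by (simp only: mult.assoc mult_1 add_0)
    qed
  qed
  also have "1 / real K * En ?w \<le> 1 / real K * (4 * B)" using EB by (intro mult_left_mono) auto
  finally show ?thesis by simp
qed

text \<open>
  Energy and degree combine to sums of nonnegative terms \<open>(\<bar>k\<bar> \<plusminus> k) * \<bar>a\<^sub>k\<bar>\<^sup>2\<close>, which are lower
  semicontinuous. For the limit this gives \<open>En u + 2 \<pi> \<bar>deg u\<bar> \<le> m\<close>: a lost degree is paid for with
  \<open>2 \<pi>\<close> of energy. Together with \<open>En u \<ge> 2 \<pi> \<bar>deg u\<bar>\<close> and \<open>m < 4 \<pi>\<close> the degree of the limit is below
  one in absolute value, hence zero.
\<close>

lemma degree_zero_limit:
  assumes s: "\<And>n. S1_map (s n)" "\<And>n. deg (s n) = 0" "\<And>n. En (s n) \<le> m + 1 / (real n + 1)"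
    and lim: "\<And>x. (\<lambda>n. s n x) \<longlonglongrightarrow> u x" and m: "m < 4 * pi"
  shows "S1_map u" "deg u = 0" "En u \<le> m"
proof -
  have sm: "s n \<in> borel_measurable borel" for n by (rule S1_map_measurable[OF s(1)])
  note [measurable] = sm
  have um [measurable]: "u \<in> borel_measurable borel"
    by (rule borel_measurable_LIMSEQ_metric[OF sm lim])
  have u1: "cmod (u x) = 1" for x
    using tendsto_norm[OF lim[of x]] S1_map_cmod[OF s(1)] by (simp add: LIMSEQ_const_iff)
  have fin: "seminorm_sq u < \<infinity>"
  proof -
    have "seminorm_sq u = (\<integral>\<^sup>+z. liminf (\<lambda>n. ennreal (gagliardo (s n) z)) \<partial>plane)"
      unfolding seminorm_sq_pair[OF um]
    proof (rule nn_integral_cong)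
      fix z :: "real \<times> real"
      have "(\<lambda>n. (cmod (s n (fst z) - s n (snd z)))\<^sup>2 * (1 / (fst z - snd z)\<^sup>2)) \<longlonglongrightarrow> (cmod (u (fst z) - u (snd z)))\<^sup>2 * (1 / (fst z - snd z)\<^sup>2)"
        by (intro tendsto_intros lim)
      then have "(\<lambda>n. ennreal (gagliardo (s n) z)) \<longlonglongrightarrow> ennreal ((cmod (u (fst z) - u (snd z)))\<^sup>2 / (fst z - snd z)\<^sup>2)"
        by (intro tendsto_ennrealI) (simp add: gagliardo_def)
      then show "ennreal ((cmod (u (fst z) - u (snd z)))\<^sup>2 / (fst z - snd z)\<^sup>2) = liminf (\<lambda>n. ennreal (gagliardo (s n) z))"
        by (simp add: lim_imp_Liminf)
    qed
    also have "\<dots> \<le> liminf (\<lambda>n. \<integral>\<^sup>+z. ennreal (gagliardo (s n) z) \<partial>plane)"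
      by (rule nn_integral_liminf) measurable
    also have "\<dots> \<le> liminf (\<lambda>n. ennreal (2 * pi * (m + 1)))"
    proof (intro Liminf_mono always_eventually allI)
      fix n
      have "(\<integral>\<^sup>+z. ennreal (gagliardo (s n) z) \<partial>plane) = seminorm_sq (s n)"
        unfolding seminorm_sq_pair[OF sm] gagliardo_def ..
      also have "\<dots> = ennreal (2 * pi * En (s n))" by (rule seminorm_sq_En[OF S1_map_fin[OF s(1)]])
      also have "\<dots> \<le> ennreal (2 * pi * (m + 1))"
      proof (intro ennreal_leI mult_left_mono)
        have "1 / (real n + 1) \<le> 1" by simp
        then show "En (s n) \<le> m + 1" using s(3)[of n] by linarith
      qed simp
      finally show "(\<integral>\<^sup>+z. ennreal (gagliardo (s n) z) \<partial>plane) \<le> ennreal (2 * pi * (m + 1))" .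
    qed
    also have "\<dots> = ennreal (2 * pi * (m + 1))" by (simp add: Liminf_const)
    finally show ?thesis by (metis ennreal_less_top infinity_ennreal_def order.strict_trans1)
  qed
  show nu: "S1_map u" unfolding S1_map_def using um u1 fin by simp
  have cl: "(\<lambda>n. coef (s n) k) \<longlonglongrightarrow> coef u k" for k
    unfolding coef_def
  proof (rule tendsto_mult_left, rule integral_dominated_convergence[where w = "\<lambda>_. 1"])
    show "AE x in circ. (\<lambda>n. s n x * chr (- k) x) \<longlonglongrightarrow> u x * chr (- k) x"
      by (intro AE_I2 tendsto_intros lim)
  qed (use S1_map_cmod[OF s(1)] in \<open>auto simp: norm_mult\<close>)
  have half: "En u + t * (2 * pi * deg u) \<le> m" if t: "t = 1 \<or> t = - 1" for t :: real
  proof -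
    let ?p = "\<lambda>v k. of_int \<bar>k\<bar> * (cmod (coef v k))\<^sup>2 + t * (of_int k * (cmod (coef v k))\<^sup>2)"
    have hs: "(?p v has_sum (En v + t * (2 * pi * deg v))) UNIV" if "S1_map v" for v
      by (intro has_sum_add has_sum_cmult_right S1_map_energy deg_has_sum that)
    have p0: "0 \<le> ?p v k" for v k
    proof -
      have "0 \<le> (of_int \<bar>k\<bar> + t * of_int k) * (cmod (coef v k))\<^sup>2" using t by (intro mult_nonneg_nonneg) auto
      then show ?thesis by (simp add: algebra_simps)
    qed
    show ?thesis
    proof (rule has_sum_le_finite_sums[OF hs[OF nu]])
      fix F :: "int set" assume F: "finite F" "F \<subseteq> UNIV"
      show "sum (?p u) F \<le> m"
      proof (rule LIMSEQ_le)
        show "(\<lambda>n. sum (?p (s n)) F) \<longlonglongrightarrow> sum (?p u) F"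
          by (intro tendsto_intros cl)
        have "(\<lambda>n. m + 1 / (real n + 1)) \<longlonglongrightarrow> m + 0" by (intro tendsto_intros) real_asymp
        then show "(\<lambda>n. m + 1 / (real n + 1)) \<longlonglongrightarrow> m" by simp
        have "sum (?p (s n)) F \<le> m + 1 / (real n + 1)" for n
        proof -
          have "sum (?p (s n)) F \<le> En (s n) + t * (2 * pi * deg (s n))"
            using has_sum_mono2[OF has_sum_finite[OF F(1)] hs[OF s(1)]] p0 by auto
          then show ?thesis using s(2,3)[of n] by simp
        qed
        then show "\<exists>N. \<forall>n\<ge>N. sum (?p (s n)) F \<le> m + 1 / (real n + 1)" by blast
      qed
    qed
  qed
  have "En u + 2 * pi * \<bar>deg u\<bar> \<le> m" using half[of 1] half[of "- 1"] by (cases "deg u \<ge> 0") auto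
  moreover have "2 * pi * \<bar>deg u\<bar> \<le> En u" by (rule En_ge_deg[OF nu])
  moreover obtain n :: int where n: "deg u = of_int n" using deg_integer[OF nu] by blast
  ultimately have "2 * pi * \<bar>deg u\<bar> < 2 * pi * 1" using m by linarith
  then have "\<bar>deg u\<bar> < 1" by simp
  then show d0: "deg u = 0" using n by simp
  show "En u \<le> m" using half[of 1] d0 by simp
qed

text \<open>
  Along a subsequence of a minimizing sequence all coefficients converge. By \<open>l2_split\<close> the subsequence
  is then a Cauchy sequence in \<open>L\<^sup>1\<close>, so a further subsequence converges almost everywhere, and
  \<open>degree_zero_limit\<close> applies to it.
\<close>

lemma degree_zero_minimizer:
  assumes g: "S1_map g" and w0: "w0 \<in> competitors g" "deg w0 = 0" "En w0 < 4 * pi"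
  obtains u where "u \<in> competitors g" "deg u = 0" "\<And>w. w \<in> competitors g \<Longrightarrow> deg w = 0 \<Longrightarrow> En u \<le> En w"
proof -
  define A where "A = {v \<in> competitors g. deg v = 0}"
  define m where "m = Inf (En ` A)"
  have A0: "w0 \<in> A" using w0 by (simp add: A_def)
  have bdd: "bdd_below (En ` A)" by (rule bdd_belowI[of _ 0]) (auto simp: En_nonneg)
  have ml: "m \<le> En w" if "w \<in> A" for w unfolding m_def using that bdd by (intro cInf_lower) auto
  have m4: "m < 4 * pi" using ml[OF A0] w0(3) by simp
  have m0: "0 \<le> m" unfolding m_def using A0 by (intro cInf_greatest) (auto simp: En_nonneg)
  have "\<exists>v\<in>A. En v < m + 1 / (real n + 1)" for n
  proof -
    have "Inf (En ` A) < m + 1 / (real n + 1)" unfolding m_def by simp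
    then show ?thesis using A0 by (subst (asm) cInf_less_iff[OF _ bdd]) auto
  qed
  then obtain v where v: "\<And>n. v n \<in> A" "\<And>n. En (v n) < m + 1 / (real n + 1)" by metis
  have nv: "S1_map (v n)" "deg (v n) = 0" "\<And>x. x \<notin> unit_ivl \<Longrightarrow> v n x = g x" for n using v(1)[of n] by (auto simp: A_def competitors_def)
  have cb: "norm (coef (v n) k) \<le> sqrt (2 * pi)" for n k
  proof -
    have "sum (\<lambda>k. (cmod (coef (v n) k))\<^sup>2) {k} \<le> 2 * pi"
      using has_sum_mono2[OF has_sum_finite[of "{k}"] S1_map_parseval[OF nv(1)]] by auto
    then show ?thesis by (simp add: real_le_rsqrt)
  qed
  obtain k0 where k0: "strict_mono (k0 :: nat \<Rightarrow> nat)" "\<And>i. i \<in> UNIV \<Longrightarrow> \<exists>l. (\<lambda>n. coef (v (k0 n)) i) \<longlonglongrightarrow> l"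
    using function_convergent_subsequence[of "UNIV :: int set" "\<lambda>n. coef (v n)" "sqrt (2 * pi)"] cb by auto
  define s where "s n = v (k0 n)" for n
  have ns: "S1_map (s n)" "deg (s n) = 0" for n using nv by (auto simp: s_def)
  have sg: "s n x = g x" if "x \<notin> unit_ivl" for n x using nv(3) that by (simp add: s_def)
  have Es: "En (s n) \<le> m + 1 / (real n + 1)" for n
  proof -
    have "n \<le> k0 n" using k0(1) by (rule seq_suble)
    then have "1 / (real (k0 n) + 1) \<le> 1 / (real n + 1)" by (intro divide_left_mono) auto
    then show ?thesis using v(2)[of "k0 n"] by (simp add: s_def)
  qed
  have EB: "En (s n) \<le> m + 1" for n
  proof -
    have "1 / (real n + 1) \<le> 1" by simp
    then show ?thesis using Es[of n] by linarith
  qed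
  obtain l where l: "\<And>k. (\<lambda>n. coef (s n) k) \<longlonglongrightarrow> l k"
    using k0(2) unfolding s_def by (metis UNIV_I)
  note [measurable] = S1_map_measurable[OF ns(1)] S1_map_measurable[OF g]
  have wint: "integrable circ (\<lambda>x. (cmod (s i x - s j x))\<^sup>2)" "integrable circ (\<lambda>x. cmod (s i x - s j x))" for i j
  proof -
    have b: "cmod (s i x - s j x) \<le> 2" for x by (rule diff_fin(3)[OF ns(1) ns(1)])
    show "integrable circ (\<lambda>x. (cmod (s i x - s j x))\<^sup>2)"
      by (rule integrable_circ_bounded[where B = "2\<^sup>2"]) (use power_mono[OF b, of _ 2] in auto)
    show "integrable circ (\<lambda>x. cmod (s i x - s j x))"
      by (rule integrable_circ_bounded[where B = 2]) (use b in auto)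
  qed
  have "\<exists>N. \<forall>i\<ge>N. \<forall>j\<ge>N. (\<integral>x. norm (s i x - s j x) \<partial>circ) < e" if e: "e > 0" for e
  proof -
    (* With this t, integrating norm \<le> t / 2 + norm\<^sup>2 / (2 * t) over the circle costs e / 2 for the constant. *)
    define t where "t = e / (2 * pi)"
    have t: "t > 0" using e by (simp add: t_def)
    obtain K :: nat where K: "real K > 4 * (m + 1) / (e * t / 2)" using reals_Archimedean2 by blast
    have Kp: "K > 0"
    proof -
      have "0 < 4 * (m + 1) / (e * t / 2)" using m0 e t by simp
      then show ?thesis using K by (simp flip: of_nat_0_less_iff)
    qed
    have K2: "4 * (m + 1) / real K < e * t / 2"
    proof -
      have "4 * (m + 1) < real K * (e * t / 2)" using K e t by (simp add: pos_divide_less_eq)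
      then show ?thesis using Kp by (simp add: pos_divide_less_eq mult.commute)
    qed
    let ?S = "\<lambda>n. \<Sum>k\<in>{- int K..int K}. (cmod (coef (s n) k - l k))\<^sup>2"
    have "?S \<longlonglongrightarrow> (\<Sum>k\<in>{- int K..int K}. (cmod (l k - l k))\<^sup>2)"
      by (intro tendsto_intros l)
    then have "?S \<longlonglongrightarrow> 0" by simp
    then have "eventually (\<lambda>n. ?S n < e * t / 8) sequentially"
      by (rule order_tendstoD(2)) (use e t in simp)
    then obtain N where N: "\<And>n. n \<ge> N \<Longrightarrow> ?S n < e * t / 8" by (auto simp: eventually_sequentially)
    have "(\<integral>x. norm (s i x - s j x) \<partial>circ) < e" if ij: "i \<ge> N" "j \<ge> N" for i j
    proof -
      define Q where "Q = (\<integral>x. (cmod (s i x - s j x))\<^sup>2 \<partial>circ)"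
      have "(\<Sum>k\<in>{- int K..int K}. (cmod (coef (s i) k - coef (s j) k))\<^sup>2) \<le> (\<Sum>k\<in>{- int K..int K}. 2 * (cmod (coef (s i) k - l k))\<^sup>2 + 2 * (cmod (coef (s j) k - l k))\<^sup>2)"
      proof (rule sum_mono)
        fix k
        show "(cmod (coef (s i) k - coef (s j) k))\<^sup>2 \<le> 2 * (cmod (coef (s i) k - l k))\<^sup>2 + 2 * (cmod (coef (s j) k - l k))\<^sup>2"
          using norm_add_sq_le[of "coef (s i) k - l k" "l k - coef (s j) k"] by (simp add: norm_minus_commute)
      qed
      also have "\<dots> = 2 * ?S i + 2 * ?S j" by (simp add: sum.distrib sum_distrib_left)
      finally have "Q < e * t"
        using l2_split[OF ns(1)[of i] ns(1)[of j] Kp EB EB] K2 N[OF ij(1)] N[OF ij(2)] unfolding Q_def by linarith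
      have "(\<integral>x. norm (s i x - s j x) \<partial>circ) \<le> (\<integral>x. t / 2 + (cmod (s i x - s j x))\<^sup>2 / (2 * t) \<partial>circ)"
      proof (rule integral_mono)
        fix x
        have "0 \<le> (cmod (s i x - s j x) - t)\<^sup>2 / (2 * t)" using t by simp
        also have "\<dots> = t / 2 + (cmod (s i x - s j x))\<^sup>2 / (2 * t) - norm (s i x - s j x)"
          using t by (simp add: power2_eq_square field_simps)
        finally show "norm (s i x - s j x) \<le> t / 2 + (cmod (s i x - s j x))\<^sup>2 / (2 * t)" by simp
      qed (use wint in auto)
      also have "\<dots> = e / 2 + Q / (2 * t)"
        using wint by (simp add: Q_def t_def)
      also have "\<dots> < e" using \<open>Q < e * t\<close> t e by (simp add: field_simps)
      finally show ?thesis .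
    qed
    then show ?thesis by blast
  qed
  moreover have "integrable circ (s n)" for n
    by (rule integrable_circ_bounded[where B = 1]) (use ns in \<open>auto simp: S1_map_def\<close>)
  ultimately obtain r where r: "strict_mono r" "AE x in circ. Cauchy (\<lambda>i. s (r i) x)"
    using cauchy_L1_AE_cauchy_subseq[of circ s] by blast
  define Cx where "Cx = {x. Cauchy (\<lambda>i. s (r i) x)}"
  have Cm [measurable]: "Cx \<in> sets borel"
    using sets_Collect_Cauchy[of "\<lambda>i. s (r i)" borel] by (simp add: Cx_def)
  (* On the null set of divergence the sequence is replaced by g, so that it converges at every point and
     still agrees with g off the interval. *)
  define w where "w i x = (if x \<in> Cx then s (r i) x else g x)" for i x
  have [measurable]: "w i \<in> borel_measurable borel" for i unfolding w_def by measurable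
  have wae: "AE x in lborel. w i x = s (r i) x" for i
    using r(2) unfolding AE_circ by eventually_elim (simp add: w_def Cx_def)
  have wS: "seminorm_sq (w i) = seminorm_sq (s (r i))" for i by (rule seminorm_sq_cong_AE[OF wae])
  have nw: "S1_map (w i)" for i
    unfolding S1_map_def using S1_map_fin[OF ns(1)] S1_map_cmod[OF ns(1)] S1_map_cmod[OF g] by (auto simp: wS, simp add: w_def)
  have dw: "deg (w i) = 0" for i using deg_cong_AE[OF nw ns(1) wae] ns(2) by simp
  have Ew: "En (w i) \<le> m + 1 / (real i + 1)" for i
  proof -
    have "En (w i) = En (s (r i))" by (simp add: En_def wS)
    also have "\<dots> \<le> m + 1 / (real (r i) + 1)" by (rule Es)
    also have "\<dots> \<le> m + 1 / (real i + 1)"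
      using seq_suble[OF r(1), of i] by (intro add_left_mono divide_left_mono) auto
    finally show ?thesis .
  qed
  define u where "u x = lim (\<lambda>i. w i x)" for x
  have lim: "(\<lambda>i. w i x) \<longlonglongrightarrow> u x" for x
  proof -
    have "convergent (\<lambda>i. w i x)"
      by (cases "x \<in> Cx") (auto simp: w_def Cx_def Cauchy_convergent_iff convergent_const)
    then show ?thesis unfolding u_def by (simp add: convergent_LIMSEQ_iff)
  qed
  have ug: "u x = g x" if "x \<notin> unit_ivl" for x
  proof -
    have "w i x = g x" for i using sg[OF that] by (simp add: w_def)
    then show ?thesis by (simp add: u_def)
  qed
  note U = degree_zero_limit[OF nw dw Ew lim m4]
  show thesis
  proof (rule that[of u])
    show "u \<in> competitors g" using U(1) ug by (simp add: competitors_def)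
    show "deg u = 0" by (rule U(2))
    show "En u \<le> En w" if "w \<in> competitors g" "deg w = 0" for w
      using U(3) ml[of w] that by (simp add: A_def)
  qed
qed

lemma ex_degree_zero_minimizer:
  assumes lam: "lam > 0"
  shows "\<exists>u. u \<in> competitors (g_map lam) \<and> deg u = 0 \<and> (\<forall>w\<in>competitors (g_map lam). deg w = 0 \<longrightarrow> En u \<le> En w)"
proof -
  have "max 0 (fold_bound lam) / (2 * pi) < 4 * pi"
    using fold_bound_lt_8[OF lam] by (simp add: divide_less_eq power2_eq_square)
  then have "En (folded lam) < 4 * pi" using folded_props(3)[OF lam] by linarith
  from degree_zero_minimizer[OF g_map_props(1)[OF lam] folded_props(1,2)[OF lam] this] show ?thesis by metis
qed

text \<open>
  For scales below the threshold the reflected competitor, and with it the minimizer of degree zero, has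
  energy below \<open>2 \<pi>\<close>. Every map of nonzero degree has at least this energy, and so has the datum.
\<close>

theorem degree_zero_minimizers:
  "\<exists>u_s :: real \<Rightarrow> real \<Rightarrow> complex.
        (\<forall>lam>0. minimizes (u_s lam) (adm_deg unit_ivl (g_map lam) 0)) \<and>
        (\<exists>lam_0>1. \<forall>lam\<in>{0<..<lam_0}.
           minimizes (u_s lam) (adm unit_ivl (g_map lam)) \<and>
           \<not> minimizes (g_map lam) (adm unit_ivl (g_map lam)))"
proof -
  obtain us where us: "\<And>lam. lam > 0 \<Longrightarrow> us lam \<in> competitors (g_map lam)" "\<And>lam. lam > 0 \<Longrightarrow> deg (us lam) = 0"
    "\<And>lam w. lam > 0 \<Longrightarrow> w \<in> competitors (g_map lam) \<Longrightarrow> deg w = 0 \<Longrightarrow> En (us lam) \<le> En w"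
    using ex_degree_zero_minimizer by metis
  have deg0: "minimizes (us lam) (adm_deg unit_ivl (g_map lam) 0)" if lam: "lam > 0" for lam
    by (rule minimizes_adm_degI[OF g_map_props(1)[OF lam] us(1)[OF lam]]) (use us(2,3)[OF lam] in auto)
  obtain l0 where l0: "l0 > 1" "\<And>lam. 0 < lam \<and> lam < l0 \<Longrightarrow> fold_bound lam < 4 * pi\<^sup>2" using fold_bound_lt_4 by blast
  have small: "minimizes (us lam) (adm unit_ivl (g_map lam)) \<and> \<not> minimizes (g_map lam) (adm unit_ivl (g_map lam))"
    if "lam \<in> {0<..<l0}" for lam
  proof -
    have lam: "lam > 0" using that by simp
    note g = g_map_props[OF lam]
    have gc: "g_map lam \<in> competitors (g_map lam)" using g by (simp add: competitors_def)
    have "max 0 (fold_bound lam) / (2 * pi) < 2 * pi"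
      using l0(2)[of lam] that by (simp add: divide_less_eq power2_eq_square)
    then have lt: "En (us lam) < 2 * pi"
      using us(3)[OF lam folded_props(1,2)[OF lam]] folded_props(3)[OF lam] by linarith
    have all: "En (us lam) \<le> En w" if w: "w \<in> competitors (g_map lam)" for w
    proof (rule ccontr)
      assume n: "\<not> En (us lam) \<le> En w"
      have nw: "S1_map w" using w by (simp add: competitors_def)
      obtain k :: int where k: "deg w = of_int k" using deg_integer[OF nw] by blast
      have "2 * pi * \<bar>deg w\<bar> < 2 * pi * 1" using En_ge_deg[OF nw] n lt by linarith
      then have "\<bar>deg w\<bar> < 1" by simp
      then have "deg w = 0" using k by simp
      then show False using us(3)[OF lam w] n by simp
    qed
    have "minimizes (us lam) (adm unit_ivl (g_map lam))"
      by (rule minimizes_admI[OF g(1) us(1)[OF lam] all])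
    moreover have "\<not> minimizes (g_map lam) (adm unit_ivl (g_map lam))"
    proof
      assume "minimizes (g_map lam) (adm unit_ivl (g_map lam))"
      then have "energy (g_map lam) \<le> energy (us lam)" using competitors_adm(1)[OF us(1)[OF lam]] by (simp add: minimizes_def)
      then have "2 * pi \<le> En (us lam)"
        using competitors_adm(2)[OF gc] competitors_adm(2)[OF us(1)[OF lam]] g(3) En_nonneg[of "us lam"] by simp
      then show False using lt by simp
    qed
    ultimately show ?thesis by blast
  qed
  show ?thesis using deg0 small l0(1) by blast
qed

theorem theorem1p3:
  fixes I :: "real set"
  assumes "I = {-1<..<1}"
  shows
    "(\<forall>lam>0. unique_minimizer (g_map lam) (adm_deg I (g_map lam) 1)) \<and>
     (\<exists>lam_s>1. \<forall>lam\<ge>lam_s. unique_minimizer (g_map lam) (adm I (g_map lam))) \<and>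
     (\<exists>u_s :: real \<Rightarrow> real \<Rightarrow> complex.
        (\<forall>lam>0. minimizes (u_s lam) (adm_deg I (g_map lam) 0)) \<and>
        (\<exists>lam_0>1. \<forall>lam\<in>{0<..<lam_0}.
           minimizes (u_s lam) (adm I (g_map lam)) \<and>
           \<not> minimizes (g_map lam) (adm I (g_map lam)))) \<and>
     (\<forall>lam>0. \<forall>k::int. k > 1 \<longrightarrow> \<not> (\<exists>u. minimizes u (adm_deg I (g_map lam) k)))"
  unfolding assms
proof (intro conjI allI impI)
  show "unique_minimizer (g_map lam) (adm_deg unit_ivl (g_map lam) 1)" if "lam > 0" for lam
    using degree_one_unique_minimizer that .
  show "\<exists>lam_s>1. \<forall>lam\<ge>lam_s. unique_minimizer (g_map lam) (adm unit_ivl (g_map lam))"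
    using large_scale_unique_minimizer pi_gt3 by (intro exI[of _ "72 * pi"]) auto
  show "\<not> (\<exists>u. minimizes u (adm_deg unit_ivl (g_map lam) k))" if "lam > 0" "k > 1" for lam k
    using no_minimizer_of_higher_degree that .
qed (rule degree_zero_minimizers)

end
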